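(* Let $T>0$, $R_0>0$, and let $f:\mathbb{R}\times[R_0,+\infty)\to\mathbb{R}$ be a continuous function, $T$-periodic in its first variable. For each integer $j>0$ put $\mu_j=(\pi j/T)^2$ and let $\psi_j:\mathbb{R}\to\mathbb{R}$ be the $T/j$-periodic function with $\psi_j(t)=\sin(\sqrt{\mu_j}\,t)$ for $t\in[0,T/j]$. Let $N>0$ be an integer and assume that there exists a constant $\hat\eta$ such that $$\mu_N x-\hat\eta\le f(t,x)\le\mu_{N+1}x+\hat\eta\qquad\text{for every } t\in[0,T]\text{ and every } x>R_0 .$$ Assume moreover that, for every $\tau\in[0,T]$, $$\int_0^T\limsup_{x\to+\infty}\bigl(f(t,x+R_0)-\mu_{N+1}x\bigr)\,\psi_{N+1}(t+\tau)\,dt<0$$ and $$\int_0^T\liminf_{x\to+\infty}\bigl(f(t,x+R_0)-\mu_{N}x\bigr)\,\psi_{N}(t+\tau)\,dt>0 .$$ Then, for every integer $\nu>0$, there exists an integer $k_\nu>0$ such that, for every integer $k\ge k_\nu$, there exist $L\in\mathbb{R}$ and an $R_0$-bouncing solution $(\rho,\vartheta)$, defined on $\mathbb{R}$, of the system $$\rho''-\frac{L^2}{\rho^3}+f(t,\rho)=0,\qquad \rho^2\vartheta'=L,$$ which is periodic with period $kT$ and makes exactly $\nu$ revolutions around the origin in the period time $kT$, in the sense that, for every $t\in\mathbb{R}$, $$\rho(t+T)=\rho(t),\qquad \vartheta(t+kT)=\vartheta(t)+2\pi\nu .$$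
   Context: **Bouncing solutions (scalar equation).** Let $w\in\mathbb{R}$ and let $p:\mathbb{R}\times[w,+\infty)\to\mathbb{R}$ be continuous. A $w$-bouncing solution of $x''+p(t,x)=0$ is a continuous function $x$ defined on some interval $(a,b)$ (possibly $\mathbb{R}$), with $x(t)\ge w$ for every $t\in(a,b)$, such that: (i) if $t_0\in(a,b)$ and $x(t_0)>w$, then $x$ is twice differentiable at $t_0$ and $x''(t_0)+p(t_0,x(t_0))=0$; (ii) if $t_0\in(a,b)$, $x(t_0)=w$ and, in a neighborhood of $t_0$, $x(t)>w$ for $t\ne t_0$, then the one-sided derivatives $x'(t_0^-)$ and $x'(t_0^+)$ exist and $x'(t_0^-)=-x'(t_0^+)$; (iii) if $t_0\in(a,b)$, $x(t_0)=w$ and either $x'(t_0^-)$ or $x'(t_0^+)$ exists and is different from $0$, then, in a neighborhood of $t_0$, $x(t)>w$ for $t\ne t_0$; (iv) if $x(t)=w$ for all $t$ in a non-trivial interval $I\subseteq(a,b)$, then $p(t,w)\ge 0$ for every $t\in I$. **Bouncing solutions of the system.** $(\rho,\vartheta)$ is an $R_0$-bouncing solution of the system $\rho''-L^2/\rho^3+f(t,\rho)=0$, $\rho^2\vartheta'=L$ if $\rho$ is an $R_0$-bouncing solution of the first equation, i.e. with $p(t,\rho)=-L^2/\rho^3+f(t,\rho)$ and $w=R_0$, and $\vartheta$ satisfies $\rho^2\vartheta'=L$. The number $L$ (the angular momentum) is not prescribed in advance. *)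

theory Defs
  imports "HOL-Analysis.Analysis"
begin

definition bouncing_solution ::
  "real \<Rightarrow> (real \<Rightarrow> real \<Rightarrow> real) \<Rightarrow> ereal \<Rightarrow> ereal \<Rightarrow> (real \<Rightarrow> real) \<Rightarrow> bool"
  where
  "bouncing_solution w p a b x \<longleftrightarrow>
     a < b \<and>
     continuous_on (einterval a b) x \<and>
     (\<forall>t\<in>einterval a b. w \<le> x t) \<and>
     (\<comment> \<open>twice differentiable at \<open>t0\<close>: differentiable near \<open>t0\<close>, with derivative differentiable at \<open>t0\<close>\<close>
      \<forall>t0\<in>einterval a b. w < x t0 \<longrightarrow>
        (\<forall>\<^sub>F t in nhds t0. x differentiable (at t)) \<and>
        deriv x differentiable (at t0) \<and>
        deriv (deriv x) t0 + p t0 (x t0) = 0) \<and>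
     (\<forall>t0\<in>einterval a b. x t0 = w \<and> (\<forall>\<^sub>F t in at t0. w < x t) \<longrightarrow>
        (\<exists>dl dr. (x has_real_derivative dl) (at_left t0) \<and>
                 (x has_real_derivative dr) (at_right t0) \<and> dl = - dr)) \<and>
     (\<forall>t0\<in>einterval a b. x t0 = w \<and>
        (\<exists>d. d \<noteq> 0 \<and> ((x has_real_derivative d) (at_left t0) \<or>
                       (x has_real_derivative d) (at_right t0))) \<longrightarrow>
        (\<forall>\<^sub>F t in at t0. w < x t)) \<and>
     (\<forall>I. is_interval I \<and> I \<subseteq> einterval a b \<and> (\<exists>r\<in>I. \<exists>s\<in>I. r < s) \<and> (\<forall>t\<in>I. x t = w) \<longrightarrow>
        (\<forall>t\<in>I. 0 \<le> p t w))"

definition bouncing_system_solution ::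
  "real \<Rightarrow> (real \<Rightarrow> real \<Rightarrow> real) \<Rightarrow> real \<Rightarrow> ereal \<Rightarrow> ereal \<Rightarrow> (real \<Rightarrow> real) \<Rightarrow> (real \<Rightarrow> real) \<Rightarrow> bool"
  where
  "bouncing_system_solution R0 f L a b \<rho> \<theta> \<longleftrightarrow>
     bouncing_solution R0 (\<lambda>t r. - L\<^sup>2 / r ^ 3 + f t r) a b \<rho> \<and>
     (\<forall>t\<in>einterval a b. \<theta> differentiable (at t) \<and> (\<rho> t)\<^sup>2 * deriv \<theta> t = L)"

definition mu :: "real \<Rightarrow> nat \<Rightarrow> real" where
  "mu T j = (pi * real j / T)\<^sup>2"

definition psi :: "real \<Rightarrow> nat \<Rightarrow> real \<Rightarrow> real" where
  "psi T j t = sin (sqrt (mu T j) * (t - (T / real j) * of_int \<lfloor>t / (T / real j)\<rfloor>))"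

lemma psi_periodic:
  assumes "0 < T" "0 < j"
  shows "psi T j (t + T / real j) = psi T j t"
proof -
  have "(t + T / real j) / (T / real j) = t / (T / real j) + 1"
    using assms by (simp add: field_simps)
  then have "\<lfloor>(t + T / real j) / (T / real j)\<rfloor> = \<lfloor>t / (T / real j)\<rfloor> + 1"
    by simp
  then show ?thesis
    unfolding psi_def by (simp add: algebra_simps)
qed

lemma psi_eq_sin:
  assumes "0 < T" "0 < j" "t \<in> {0..T / real j}"
  shows "psi T j t = sin (sqrt (mu T j) * t)"
proof (cases "t = T / real j")
  case True
  have "sqrt (mu T j) = pi * real j / T"
    using assms by (simp add: mu_def)
  then show ?thesis
    using True assms by (simp add: psi_def)
next
  case False
  then have "\<lfloor>t / (T / real j)\<rfloor> = 0"
    using assms by (simp add: floor_eq_iff field_simps)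
  then show ?thesis
    by (simp add: psi_def)
qed

text \<open>
  Integral over a set, with values in the extended reals, of an extended real valued function:
  the integral of the positive part minus that of the negative part (\<open>e2ennreal\<close> sends negative
  arguments to 0). Meaningful when at most one of the two is infinite; the value infinity
  is allowed.
\<close>
definition ereal_set_integral :: "'a measure \<Rightarrow> 'a set \<Rightarrow> ('a \<Rightarrow> ereal) \<Rightarrow> ereal" where
  "ereal_set_integral M A g =
     enn2ereal (\<integral>\<^sup>+x\<in>A. e2ennreal (g x) \<partial>M) - enn2ereal (\<integral>\<^sup>+x\<in>A. e2ennreal (- g x) \<partial>M)"

lemma ereal_set_integral_eq_set_lebesgue_integral:
  assumes "set_integrable M A h"
  shows "ereal_set_integral M A (\<lambda>x. ereal (h x)) = ereal (LINT x:A|M. h x)"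
proof -
  let ?g = "\<lambda>x. indicator A x *\<^sub>R h x"
  have g: "integrable M ?g"
    using assms by (simp add: set_integrable_def)
  have pos: "(\<integral>\<^sup>+x\<in>A. e2ennreal (ereal (h x)) \<partial>M) = (\<integral>\<^sup>+x. ennreal (?g x) \<partial>M)"
    by (intro nn_integral_cong) (auto simp: indicator_def)
  have neg: "(\<integral>\<^sup>+x\<in>A. e2ennreal (- ereal (h x)) \<partial>M) = (\<integral>\<^sup>+x. ennreal (- ?g x) \<partial>M)"
    by (intro nn_integral_cong) (auto simp: indicator_def)
  have fin: "(\<integral>\<^sup>+x. ennreal (?g x) \<partial>M) \<noteq> \<infinity>" "(\<integral>\<^sup>+x. ennreal (- ?g x) \<partial>M) \<noteq> \<infinity>"
    using g unfolding real_integrable_def by auto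
  obtain u where u: "0 \<le> u" "(\<integral>\<^sup>+x. ennreal (?g x) \<partial>M) = ennreal u"
    using fin(1) by (cases "\<integral>\<^sup>+x. ennreal (?g x) \<partial>M" rule: ennreal_cases) auto
  obtain v where v: "0 \<le> v" "(\<integral>\<^sup>+x. ennreal (- ?g x) \<partial>M) = ennreal v"
    using fin(2) by (cases "\<integral>\<^sup>+x. ennreal (- ?g x) \<partial>M" rule: ennreal_cases) auto
  have "(LINT x:A|M. h x) = u - v"
    unfolding set_lebesgue_integral_def real_lebesgue_integral_def[OF g] u v
    using u(1) v(1) by simp
  then show ?thesis
    unfolding ereal_set_integral_def pos neg u v using u(1) v(1) by simp
qed

end

theory Submission
  imports Defs "HOL-Complex_Analysis.Great_Picard"
begin

text \<open>
  Write \<open>\<rho> = R0 + x\<close> and \<open>L = c / \<integral>\<rho>\<^sup>-\<^sup>2\<close> with \<open>c = 2\<pi>\<nu>/k\<close>: the number of revolutions is then correct by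
  construction, and a \<open>T\<close>-periodic bouncing solution of an equation with a nonlocal coefficient
  \<open>L\<close> is needed. The wall is replaced by a stiff spring, and a fixed
  point of the shooting map on (disc of initial data) \<open>\<times>\<close> (range of \<open>L\<close>) is found by Brouwer's theorem
  (applied to Euler polygons, since solutions need not be unique). The fixed point is genuine
  unless a solution starting on the boundary circle returns to its own ray. On a large circle this
  is impossible: the phase rotates by more than \<open>N\<close> and less than \<open>N + 1\<close> half turns, since otherwise
  the solutions would be asymptotic to \<open>A \<bar>sin\<bar>\<close> and Fatou's lemma would contradict one of the
  Landesman-Lazer conditions. Finally the stiffness tends to infinity; energy is continuous in the
  limit, which gives the elastic bounce law.
\<close>

section \<open>Shooting without uniqueness\<close>

text \<open>As \<open>f\<close> is merely continuous there is no Poincare map, and \<open>L\<close>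
  depends on the whole orbit. Carrying the integral of 1/\<rho> squared as an additional state turns
  this dependence into an end condition. A clipping keeps \<open>L\<close> in \<open>{0..1}\<close>;
  all estimates are uniform over that range and do not involve \<open>k\<close>, so for large
  \<open>k\<close> the number \<open>c\<close> falls below a fixed lower bound of the integral and
  the clipping is inactive. This is where \<open>k\<^sub>\<nu>\<close> comes from.

  The stiffness must dominate the amplitude (\<open>\<rho> ^ 4 \<le> n\<close>): the time lost
  against the spring is then of order 1/\<rho>^2, while the Landesman-Lazer conditions are felt in
  the phase at order 1/\<rho>.

  In the stiff limit velocities jump and have no equicontinuity. The energy, kinetic plus elastic,
  changes at a rate free of \<open>n\<close>, because the spring conserves it. Compactness is
  therefore applied to position and energy together; the speed is recovered from the energy, and its
  sign on either side of an impact from the fact that the orbit stays in front of the wall.\<close>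

definition polygon :: "real \<Rightarrow> (nat \<Rightarrow> 'a::real_normed_vector) \<Rightarrow> real \<Rightarrow> 'a" where
  "polygon h e t = e (nat \<lfloor>t / h\<rfloor>) + (t / h - real (nat \<lfloor>t / h\<rfloor>)) *\<^sub>R (e (Suc (nat \<lfloor>t / h\<rfloor>)) - e (nat \<lfloor>t / h\<rfloor>))"

lemma polygon_cell:
  assumes "0 < h" "real i * h \<le> t" "t \<le> real (Suc i) * h"
  shows "polygon h e t = e i + (t / h - real i) *\<^sub>R (e (Suc i) - e i)"
proof (cases "t = real (Suc i) * h")
  case True
  then have "t / h = real (Suc i)" using assms by simp
  moreover have "nat \<lfloor>real (Suc i)\<rfloor> = Suc i" by (metis floor_of_nat nat_int)
  ultimately show ?thesis by (simp add: polygon_def)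
next
  case False
  then have "\<lfloor>t / h\<rfloor> = int i"
    using assms by (intro floor_unique) (auto simp: field_simps)
  then show ?thesis by (simp add: polygon_def)
qed

lemma polygon_node: "0 < h \<Longrightarrow> polygon h e (real i * h) = e i"
  by (subst polygon_cell[of h i]) (auto simp: algebra_simps)

text \<open>The step bound is asked only of the cells between \<open>a\<close> and \<open>b\<close>.
  With all cells it gives equicontinuity of the polygons; with the cells near one time, after a
  linear motion has been subtracted, it controls the derivative of their limit.\<close>

lemma polygon_lipschitz:
  assumes h: "0 < h" and st: "real a * h \<le> s" "s \<le> t" "t \<le> real b * h"
    and step: "\<And>i. a \<le> i \<Longrightarrow> i < b \<Longrightarrow> norm (e (Suc i) - e i) \<le> C * h"
  shows "norm (polygon h e t - polygon h e s) \<le> C * (t - s)"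
  using st step
proof (induction b arbitrary: s t)
  case 0
  have "0 \<le> real a * h" using h by simp
  then have "s = t" using 0 by simp
  then show ?case by simp
next
  case (Suc b)
  have cell: "norm (polygon h e t - polygon h e s) \<le> C * (t - s)"
    if "real b * h \<le> s" "s \<le> t" "t \<le> real (Suc b) * h" "a \<le> b" for s t
  proof -
    have "polygon h e t - polygon h e s = ((t - s) / h) *\<^sub>R (e (Suc b) - e b)"
      using that h by (subst (1 2) polygon_cell[of h b]) (auto simp: algebra_simps diff_divide_distrib)
    also have "norm \<dots> = (t - s) / h * norm (e (Suc b) - e b)"
      using that h by simp
    also have "\<dots> \<le> (t - s) / h * (C * h)"
      using that h Suc.prems(4)[of b] by (intro mult_left_mono) auto
    finally show ?thesis using h by (simp add: mult.commute)
  qed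
  show ?case
  proof (cases "a \<le> b")
    case False
    then have "real (Suc b) * h \<le> real a * h" using h by (intro mult_right_mono) auto
    then have "s = t" using Suc.prems by linarith
    then show ?thesis by simp
  next
    case ab: True
    consider "t \<le> real b * h" | "real b * h \<le> s" | "s < real b * h" "real b * h < t" by linarith
    then show ?thesis
    proof cases
      case 1
      show ?thesis by (rule Suc.IH) (use 1 Suc.prems in auto)
    next
      case 2
      show ?thesis by (rule cell) (use 2 ab Suc.prems in auto)
    next
      case 3
      have "norm (polygon h e t - polygon h e (real b * h)) \<le> C * (t - real b * h)"
        by (rule cell) (use 3 ab Suc.prems in auto)
      moreover have "norm (polygon h e (real b * h) - polygon h e s) \<le> C * (real b * h - s)"
        by (rule Suc.IH) (use 3 ab Suc.prems in auto)
      ultimately show ?thesis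
        using norm_triangle_ineq[of "polygon h e t - polygon h e (real b * h)" "polygon h e (real b * h) - polygon h e s"]
        by (simp add: algebra_simps)
    qed
  qed
qed

text \<open>Interpolation is linear in the nodes and reproduces linear motions, so the deviation of
  a polygon from the velocity \<open>v\<close> is again a polygon, to which
  \<open>polygon_lipschitz\<close> applies.\<close>

lemma polygon_minus_linear:
  assumes "0 < h"
  shows "polygon h (\<lambda>i. e i - (real i * h) *\<^sub>R v) t = polygon h e t - t *\<^sub>R v"
proof -
  define i where "i = nat \<lfloor>t / h\<rfloor>"
  have "t *\<^sub>R v = (real i * h) *\<^sub>R v + ((t / h - real i) * h) *\<^sub>R v"
    unfolding scaleR_left_distrib[symmetric] using assms by (simp add: algebra_simps)
  then show ?thesis
    unfolding polygon_def i_def[symmetric] by (simp add: algebra_simps)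
qed

section \<open>Euler iterates: growth and dependence on a parameter\<close>

fun euler :: "real \<Rightarrow> (real \<Rightarrow> 'a::real_normed_vector \<Rightarrow> 'a) \<Rightarrow> 'a \<Rightarrow> nat \<Rightarrow> 'a" where
  "euler h F z 0 = z"
| "euler h F z (Suc i) = euler h F z i + h *\<^sub>R F (real i * h) (euler h F z i)"

text \<open>Discrete Gronwall inequality: one step multiplies \<open>1 + norm\<close> by at most
  \<open>1 + B * h\<close>, which is at most \<open>exp (B * h)\<close>. The resulting bound depends
  on the elapsed time and not on the number of steps.\<close>

lemma euler_bound:
  assumes "0 \<le> h" "0 \<le> B" "real i * h \<le> T"
    and growth: "\<And>t z. t \<in> {0..T} \<Longrightarrow> norm (F t z) \<le> B * (1 + norm z)"
  shows "1 + norm (euler h F z i) \<le> exp (B * (real i * h)) * (1 + norm z)"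
  using assms(3)
proof (induction i)
  case (Suc i)
  let ?e = "euler h F z i"
  have i: "0 \<le> real i * h" "real i * h \<le> T" using Suc.prems assms(1) by (auto simp: algebra_simps)
  have "norm (euler h F z (Suc i)) \<le> norm ?e + h * norm (F (real i * h) ?e)"
    using norm_triangle_ineq[of ?e "h *\<^sub>R F (real i * h) ?e"] assms(1) by simp
  also have "\<dots> \<le> norm ?e + h * (B * (1 + norm ?e))"
    using assms(1) growth i by (intro add_mono mult_left_mono) auto
  finally have "1 + norm (euler h F z (Suc i)) \<le> (1 + B * h) * (1 + norm ?e)"
    by (simp add: algebra_simps)
  also have "\<dots> \<le> exp (B * h) * (exp (B * (real i * h)) * (1 + norm z))"
    using Suc.IH i assms(1,2) exp_ge_add_one_self[of "B * h"] by (intro mult_mono) auto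
  also have "\<dots> = exp (B * (real (Suc i) * h)) * (1 + norm z)"
    by (simp add: exp_add[symmetric] algebra_simps)
  finally show ?case .
qed simp

text \<open>Each iterate is a finite composition of continuous maps. This takes the place of
  continuous dependence of solutions on data, which fails without uniqueness.\<close>

lemma continuous_on_euler:
  assumes F: "continuous_on (D \<times> {0..T} \<times> UNIV) (\<lambda>(p, t, z). F p t z)"
    and \<iota>: "continuous_on D \<iota>" and h: "0 \<le> h" "real i * h \<le> T"
  shows "continuous_on D (\<lambda>p. euler h (F p) (\<iota> p) i)"
  using h(2)
proof (induction i)
  case (Suc i)
  have i: "0 \<le> real i * h" "real i * h \<le> T" using Suc.prems h(1) by (auto simp: algebra_simps)
  have IH: "continuous_on D (\<lambda>p. euler h (F p) (\<iota> p) i)" by (rule Suc.IH[OF i(2)])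
  have "continuous_on D (\<lambda>p. (\<lambda>(p, t, z). F p t z) (p, real i * h, euler h (F p) (\<iota> p) i))"
    by (rule continuous_on_compose2[OF F]) (use i IH in \<open>auto intro!: continuous_intros\<close>)
  then show ?case using IH by (auto intro!: continuous_intros)
qed (use \<iota> in simp)

lemma dist_triple_le: "dist (a, b, c) (a', b', c') \<le> dist a a' + (dist b b' + dist c c')"
proof -
  have "dist (b, c) (b', c') \<le> dist b b' + dist c c'"
    unfolding dist_Pair_Pair by (rule sqrt_sum_squares_le_sum) auto
  moreover have "dist (a, b, c) (a', b', c') \<le> dist a a' + dist (b, c) (b', c')"
    unfolding dist_Pair_Pair[of a] by (rule sqrt_sum_squares_le_sum) auto
  ultimately show ?thesis by simp
qed

text \<open>The parameter \<open>p\<close> fixes both the vector field and the initial state, and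
  \<open>\<pi>\<close> sends the end state back to a parameter. Brouwer's theorem solves the
  discretised problem for every step size. The polygons are uniformly bounded and share a Lipschitz
  constant, so a subsequence converges uniformly, and joint continuity of \<open>F\<close> makes the
  limit a solution for the limiting parameter.\<close>

theorem shooting_fixed_point:
  fixes F :: "'p::euclidean_space \<Rightarrow> real \<Rightarrow> 'a::euclidean_space \<Rightarrow> 'a"
  assumes D: "compact D" "convex D" "D \<noteq> {}" and T: "0 < T" and B: "0 \<le> B"
    and F: "continuous_on (D \<times> {0..T} \<times> UNIV) (\<lambda>(p, t, z). F p t z)"
    and growth: "\<And>p t z. p \<in> D \<Longrightarrow> t \<in> {0..T} \<Longrightarrow> norm (F p t z) \<le> B * (1 + norm z)"
    and \<iota>: "continuous_on D \<iota>"
    and \<pi>: "continuous_on (D \<times> UNIV) (\<lambda>(p, z). \<pi> p z)" "\<And>p z. p \<in> D \<Longrightarrow> \<pi> p z \<in> D"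
  obtains p z where "p \<in> D" "z 0 = \<iota> p" "\<pi> p (z T) = p"
    "\<And>t. t \<in> {0..T} \<Longrightarrow> (z has_vector_derivative F p t (z t)) (at t within {0..T})"
proof -
  \<comment> \<open>The step divides \<open>T\<close> exactly: node \<open>Suc m\<close> is the time
    \<open>T\<close>, so the end value of the polygon is the last Euler iterate.\<close>
  define h where "h m = T / real (Suc m)" for m
  have h: "0 < h m" and hT: "real (Suc m) * h m = T" for m using T by (auto simp: h_def)
  have node: "real i * h m \<in> {0..T}" if "i \<le> Suc m" for i m
  proof -
    have "real i * h m \<le> real (Suc m) * h m"
      using that h[of m] by (intro mult_right_mono) auto
    then show ?thesis unfolding hT[of m] using h[of m] by simp
  qed
  have "\<exists>p\<in>D. \<pi> p (euler (h m) (F p) (\<iota> p) (Suc m)) = p" for m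
  proof -
    have "continuous_on D (\<lambda>p. euler (h m) (F p) (\<iota> p) (Suc m))"
      by (rule continuous_on_euler[OF F \<iota>]) (use h[of m] hT[of m] in auto)
    then have "continuous_on D (\<lambda>p. (\<lambda>(p, z). \<pi> p z) (p, euler (h m) (F p) (\<iota> p) (Suc m)))"
      by (intro continuous_on_compose2[OF \<pi>(1)] continuous_intros) auto
    then have "continuous_on D (\<lambda>p. \<pi> p (euler (h m) (F p) (\<iota> p) (Suc m)))" by simp
    from brouwer[OF D this] \<pi>(2) show ?thesis by blast
  qed
  then obtain p where p: "\<And>m. p m \<in> D" "\<And>m. \<pi> (p m) (euler (h m) (F (p m)) (\<iota> (p m)) (Suc m)) = p m"
    by metis
  define e where "e m = euler (h m) (F (p m)) (\<iota> (p m))" for m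
  define z where "z m = polygon (h m) (e m)" for m
  have "compact (\<iota> ` D)" by (rule compact_continuous_image[OF \<iota> D(1)])
  then obtain M0 where M0: "\<And>q. q \<in> D \<Longrightarrow> norm (\<iota> q) \<le> M0"
    unfolding compact_eq_bounded_closed bounded_iff by blast
  \<comment> \<open>A bound on \<open>1 + norm\<close> at the nodes that serves all step sizes at
    once; with linear growth it yields the common Lipschitz constant \<open>C\<close> below.\<close>
  define M where "M = exp (B * T) * (1 + M0)"
  have eM: "1 + norm (e m i) \<le> M" if "i \<le> Suc m" for m i
  proof -
    have "1 + norm (e m i) \<le> exp (B * (real i * h m)) * (1 + norm (\<iota> (p m)))"
      unfolding e_def by (rule euler_bound[where T=T]) (use node[OF that] h[of m] B growth p in auto)
    also have "\<dots> \<le> M"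
      unfolding M_def using node[OF that] B M0[OF p(1)[of m]]
      by (intro mult_mono) (auto intro: mult_left_mono)
    finally show ?thesis .
  qed
  define C where "C = B * M"
  have M1: "1 \<le> M" using eM[of 0 0] norm_ge_zero[of "e 0 0"] by linarith
  have C0: "0 \<le> C" using B M1 by (simp add: C_def)
  have step: "norm (e m (Suc i) - e m i) \<le> C * h m" if "i < Suc m" for m i
  proof -
    have "norm (F (p m) (real i * h m) (e m i)) \<le> B * M"
      using growth[OF p(1) node[of i m]] eM[of i m] that B
      by (meson le_trans less_imp_le mult_left_mono order_trans)
    then show ?thesis using h[of m] by (simp add: e_def C_def mult.commute mult_left_mono)
  qed
  have lip: "norm (z m t - z m s) \<le> C * \<bar>t - s\<bar>" if "s \<in> {0..T}" "t \<in> {0..T}" for m s t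
    using that
  proof (induction s t rule: linorder_wlog)
    case (le s t)
    then show ?case
      unfolding z_def using polygon_lipschitz[OF h, of 0 m s t "Suc m" "e m" C] step hT[of m] by simp
  next
    case (sym s t)
    then show ?case by (simp add: norm_minus_commute abs_minus_commute)
  qed
  have z0: "z m 0 = \<iota> (p m)" for m
    using polygon_node[OF h, of m "e m" 0] by (simp add: z_def e_def)
  have zT: "z m T = euler (h m) (F (p m)) (\<iota> (p m)) (Suc m)" for m
    using polygon_node[OF h, of m "e m" "Suc m"] hT[of m] by (simp add: z_def e_def)
  obtain zz k1 where zz: "continuous_on {0..T} zz" and k1: "strict_mono (k1 :: nat \<Rightarrow> nat)"
    and lim1: "\<And>\<epsilon>. 0 < \<epsilon> \<Longrightarrow> \<exists>N. \<forall>n x. n \<ge> N \<and> x \<in> {0..T} \<longrightarrow> norm (z (k1 n) x - zz x) < \<epsilon>"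
  proof (rule Arzela_Ascoli[of "{0..T}" z "M + C * T"])
    show "norm (z m t) \<le> M + C * T" if "t \<in> {0..T}" for m t
    proof -
      have "norm (z m t - z m 0) \<le> C * \<bar>t - 0\<bar>" by (rule lip) (use that T in auto)
      also have "\<dots> \<le> C * T" using that C0 by (intro mult_left_mono) auto
      finally have "norm (z m t - z m 0) \<le> C * T" .
      moreover have "norm (z m 0) \<le> M" using eM[of 0 m] by (simp add: z0 e_def)
      ultimately show ?thesis using norm_triangle_sub[of "z m t" "z m 0"] by linarith
    qed
    show "\<exists>d>0. \<forall>n y. y \<in> {0..T} \<and> norm (x - y) < d \<longrightarrow> norm (z n x - z n y) < \<epsilon>"
      if "x \<in> {0..T}" "0 < \<epsilon>" for x \<epsilon> :: real
    proof (intro exI[of _ "\<epsilon> / (C + 1)"] conjI allI impI)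
      show "0 < \<epsilon> / (C + 1)" using that C0 by simp
      fix n y assume y: "y \<in> {0..T} \<and> norm (x - y) < \<epsilon> / (C + 1)"
      have "norm (z n x - z n y) \<le> C * \<bar>x - y\<bar>" by (rule lip) (use y that in auto)
      also have "\<dots> \<le> (C + 1) * \<bar>x - y\<bar>" by (intro mult_right_mono) auto
      also have "\<dots> < \<epsilon>" using y C0 by (simp add: field_simps)
      finally show "norm (z n x - z n y) < \<epsilon>" .
    qed
  qed (use compact_Icc in auto)
  obtain q k2 where q: "q \<in> D" and k2: "strict_mono (k2 :: nat \<Rightarrow> nat)"
    and limp: "((p \<circ> k1) \<circ> k2) \<longlonglongrightarrow> q"
    using D(1) p(1) unfolding compact_def by (metis comp_apply)
  define r where "r = k1 \<circ> k2"
  have r: "strict_mono r" using k1 k2 by (simp add: r_def strict_mono_o)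
  have limp: "(\<lambda>n. p (r n)) \<longlonglongrightarrow> q" using limp by (simp add: r_def o_def)
  have limu: "\<forall>\<^sub>F n in sequentially. \<forall>x\<in>{0..T}. norm (z (r n) x - zz x) < \<epsilon>" if \<epsilon>: "0 < \<epsilon>" for \<epsilon>
  proof -
    obtain N where N: "\<And>n x. n \<ge> N \<Longrightarrow> x \<in> {0..T} \<Longrightarrow> norm (z (k1 n) x - zz x) < \<epsilon>"
      using lim1[OF \<epsilon>] by blast
    show ?thesis unfolding eventually_sequentially r_def
      using N seq_suble[OF k2] by (metis comp_apply le_trans)
  qed
  have limz: "(\<lambda>n. z (r n) x) \<longlonglongrightarrow> zz x" if "x \<in> {0..T}" for x
  proof (rule tendstoI)
    fix \<epsilon> :: real assume "0 < \<epsilon>"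
    from limu[OF this] show "\<forall>\<^sub>F n in sequentially. dist (z (r n) x) (zz x) < \<epsilon>"
      by (rule eventually_mono) (use that in \<open>simp add: dist_norm\<close>)
  qed
  have h0: "(\<lambda>n. h (r n)) \<longlonglongrightarrow> 0"
  proof -
    have "h \<longlonglongrightarrow> 0" unfolding h_def
      by (rule LIMSEQ_Suc[OF lim_const_over_n])
    from LIMSEQ_subseq_LIMSEQ[OF this r] show ?thesis by (simp add: o_def)
  qed
  have liplim: "norm (zz t - zz s) \<le> C * \<bar>t - s\<bar>" if "s \<in> {0..T}" "t \<in> {0..T}" for s t
    by (rule tendsto_upperbound[OF tendsto_norm[OF tendsto_diff[OF limz limz]]]) (use lip that in auto)
  show ?thesis
  proof
    show "q \<in> D" by fact
    have "(\<lambda>n. \<iota> (p (r n))) \<longlonglongrightarrow> \<iota> q"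
      by (rule continuous_on_tendsto_compose[OF \<iota> limp q]) (use p in auto)
    moreover have "(\<lambda>n. \<iota> (p (r n))) \<longlonglongrightarrow> zz 0" using limz[of 0] T by (simp add: z0)
    ultimately show "zz 0 = \<iota> q" by (rule LIMSEQ_unique[rotated])
    have "(\<lambda>n. (\<lambda>(p, z). \<pi> p z) (p (r n), z (r n) T)) \<longlonglongrightarrow> (\<lambda>(p, z). \<pi> p z) (q, zz T)"
      by (rule continuous_on_tendsto_compose[OF \<pi>(1)])
        (use limp limz[of T] T p q in \<open>auto intro!: tendsto_intros\<close>)
    then have "(\<lambda>n. p (r n)) \<longlonglongrightarrow> \<pi> q (zz T)" by (simp add: zT p(2) del: euler.simps)
    then show "\<pi> q (zz T) = q" using limp by (rule LIMSEQ_unique)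
    fix t0 assume t0: "t0 \<in> {0..T}"
    let ?v = "F q t0 (zz t0)"
    show "(zz has_vector_derivative ?v) (at t0 within {0..T})"
      unfolding has_vector_derivative_def has_derivative_within_alt
    proof (intro conjI allI impI)
      show "bounded_linear (\<lambda>x. x *\<^sub>R ?v)" by (rule bounded_linear_scaleR_left)
      fix \<epsilon> :: real assume \<epsilon>: "0 < \<epsilon>"
      obtain \<delta> where \<delta>: "0 < \<delta>" and F\<delta>: "\<And>a b c. a \<in> D \<Longrightarrow> b \<in> {0..T} \<Longrightarrow> 
          dist (a, b, c) (q, t0, zz t0) < \<delta> \<Longrightarrow> norm (F a b c - ?v) < \<epsilon>"
        using F[unfolded continuous_on_iff, rule_format, of "(q, t0, zz t0)" \<epsilon>] q t0 \<epsilon>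
        by (fastforce simp: dist_norm)
      \<comment> \<open>The tolerance \<open>\<delta>\<close> is spent on the parameter, on time,
        and twice on the state. The nodes involved lie within \<open>2 * d\<close> of
        \<open>t0\<close>: \<open>d\<close> for the endpoints and another \<open>d\<close> for the
        step size. Over that span the limit moves by at most \<open>C * (2 * d)\<close>.\<close>
      define d where "d = \<delta> / (8 * (1 + C))"
      have d: "0 < d" "2 * d \<le> \<delta> / 4" "C * (2 * d) \<le> \<delta> / 4"
        using \<delta> C0 by (auto simp: d_def field_simps)
      have key: "norm (zz t - zz s - (t - s) *\<^sub>R ?v) \<le> \<epsilon> * (t - s)"
        if st: "s \<in> {0..T}" "t \<in> {0..T}" "s \<le> t" "\<bar>s - t0\<bar> < d" "\<bar>t - t0\<bar> < d" for s t
      proof -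
        have ev: "\<forall>\<^sub>F n in sequentially. norm (z (r n) t - z (r n) s - (t - s) *\<^sub>R ?v) \<le> \<epsilon> * (t - s)"
        proof -
          have "\<forall>\<^sub>F n in sequentially. dist (p (r n)) q < \<delta> / 4"
            using limp \<delta> by (intro tendstoD) auto
          moreover have "\<forall>\<^sub>F n in sequentially. h (r n) < d"
            using h0 d by (intro order_tendstoD(2)) auto
          moreover have "\<forall>\<^sub>F n in sequentially. \<forall>x\<in>{0..T}. norm (z (r n) x - zz x) < \<delta> / 4"
            by (intro limu) (use \<delta> in simp)
          ultimately show ?thesis
          proof eventually_elim
            case (elim n)
            define m where "m = r n"
            define a where "a = nat \<lfloor>s / h m\<rfloor>"
            define b where "b = nat \<lceil>t / h m\<rceil>"
            have hm: "0 < h m" "h m < d" using h elim by (auto simp: m_def)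
            have a1: "real a * h m \<le> s" "s - h m < real a * h m"
            proof -
              have "0 \<le> s / h m" using st hm by simp
              then have "real a \<le> s / h m" "s / h m < real a + 1"
                unfolding a_def by (auto simp: of_nat_nat)
              then show "real a * h m \<le> s" "s - h m < real a * h m" using hm by (auto simp: field_simps)
            qed
            have b1: "t \<le> real b * h m" "real b * h m < t + h m" "b \<le> Suc m"
            proof -
              have "0 \<le> t / h m" using st hm by simp
              then have "t / h m \<le> real b" "real b < t / h m + 1"
                unfolding b_def using ceiling_correct[of "t / h m"] by (auto simp: of_nat_nat)
              then show "t \<le> real b * h m" and *: "real b * h m < t + h m" using hm by (auto simp: field_simps)
              have "real b * h m < real (Suc (Suc m)) * h m" using * st hT[of m] by (simp add: algebra_simps)
              then show "b \<le> Suc m" using hm by auto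
            qed
            \<comment> \<open>With the motion of velocity \<open>?v\<close> removed, it remains to
              see that every slope used between nodes \<open>a\<close> and \<open>b\<close> is
              within \<open>\<epsilon>\<close> of \<open>?v\<close>.\<close>
            have "norm (polygon (h m) (\<lambda>i. e m i - (real i * h m) *\<^sub>R ?v) t
                - polygon (h m) (\<lambda>i. e m i - (real i * h m) *\<^sub>R ?v) s) \<le> \<epsilon> * (t - s)"
            proof (rule polygon_lipschitz[OF hm(1) a1(1) st(3) b1(1)])
              fix i assume i: "a \<le> i" "i < b"
              have iT: "real i * h m \<in> {0..T}" using node[of i m] i b1 by simp
              have "real a * h m \<le> real i * h m" using i hm by (intro mult_right_mono) auto
              moreover have "real i * h m + h m \<le> real b * h m"
                using mult_right_mono[of "real (Suc i)" "real b" "h m"] i hm by (simp add: algebra_simps)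
              ultimately have near: "\<bar>real i * h m - t0\<bar> < 2 * d"
                using a1 b1(2) st(4,5) hm unfolding abs_less_iff by linarith
              have "z m (real i * h m) = e m i" using polygon_node[OF hm(1)] by (simp add: z_def)
              then have "norm (e m i - zz (real i * h m)) < \<delta> / 4" using elim(3) iT unfolding m_def by metis
              moreover have "norm (zz (real i * h m) - zz t0) \<le> C * \<bar>real i * h m - t0\<bar>"
                using liplim iT t0 by simp
              moreover have "\<dots> \<le> C * (2 * d)" using near C0 by (intro mult_left_mono) auto
              ultimately have "norm (e m i - zz t0) < \<delta> / 2"
                using norm_triangle_ineq[of "e m i - zz (real i * h m)" "zz (real i * h m) - zz t0"] d(3) by simp
              moreover have "dist (p m) q < \<delta> / 4" using elim by (simp add: m_def)
              moreover have "dist (p m, real i * h m, e m i) (q, t0, zz t0)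
                 \<le> dist (p m) q + (dist (real i * h m) t0 + dist (e m i) (zz t0))"
                by (rule dist_triple_le)
              ultimately have "dist (p m, real i * h m, e m i) (q, t0, zz t0) < \<delta>"
                using near d by (simp add: dist_norm)
              then have "norm (F (p m) (real i * h m) (e m i) - ?v) < \<epsilon>" using F\<delta> p iT by blast
              moreover have "e m (Suc i) - (real (Suc i) * h m) *\<^sub>R ?v - (e m i - (real i * h m) *\<^sub>R ?v)
                = h m *\<^sub>R (F (p m) (real i * h m) (e m i) - ?v)"
                by (simp add: e_def algebra_simps)
              ultimately show "norm (e m (Suc i) - (real (Suc i) * h m) *\<^sub>R ?v - (e m i - (real i * h m) *\<^sub>R ?v)) \<le> \<epsilon> * h m"
                using hm by (simp add: mult.commute)
            qed
            then show ?case
              unfolding polygon_minus_linear[OF hm(1)] by (simp add: z_def m_def algebra_simps)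
          qed
        qed
        show ?thesis
          by (rule tendsto_upperbound[OF tendsto_norm[OF tendsto_diff[OF tendsto_diff[OF limz limz] tendsto_const]] ev])
            (use st in auto)
      qed
      show "\<exists>d>0. \<forall>y\<in>{0..T}. norm (y - t0) < d \<longrightarrow>
           norm (zz y - zz t0 - (y - t0) *\<^sub>R ?v) \<le> \<epsilon> * norm (y - t0)"
      proof (intro exI[of _ d] conjI ballI impI)
        show "0 < d" by (fact d)
        fix y assume y: "y \<in> {0..T}" "norm (y - t0) < d"
        show "norm (zz y - zz t0 - (y - t0) *\<^sub>R ?v) \<le> \<epsilon> * norm (y - t0)"
        proof (cases "t0 \<le> y")
          case True
          then show ?thesis using key[of t0 y] y t0 d by simp
        next
          case False
          have "norm (zz t0 - zz y - (t0 - y) *\<^sub>R ?v) = norm (zz y - zz t0 - (y - t0) *\<^sub>R ?v)"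
            by (subst norm_minus_cancel[symmetric]) (simp add: algebra_simps)
          then show ?thesis using key[of y t0] y t0 d False by simp
        qed
      qed
    qed
  qed
qed

section \<open>The penalised impact oscillator\<close>

lemma has_real_derivative_max0_power2:
  "((\<lambda>x::real. (max x 0)\<^sup>2) has_real_derivative 2 * max x 0) (at x)"
proof -
  consider "x < 0" | "x > 0" | "x = 0" by linarith
  then show ?thesis
  proof cases
    case 1
    show ?thesis
      by (rule has_field_derivative_transform_within_open[of "\<lambda>x. 0" _ _ "{..<0}"]) (use 1 in auto)
  next
    case 2
    have "((\<lambda>x. x\<^sup>2) has_real_derivative 2 * x) (at x)" by (auto intro!: derivative_eq_intros)
    from has_field_derivative_transform_within_open[OF this, of "{0<..}"] show ?thesis using 2 by auto
  next
    case 3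
    have "((\<lambda>h::real. (max h 0)\<^sup>2 / h) \<longlongrightarrow> 0) (at 0)"
    proof (rule Lim_null_comparison)
      show "\<forall>\<^sub>F h in at 0. norm ((max h 0)\<^sup>2 / h) \<le> norm (h::real)"
        by (auto simp: max_def power2_eq_square)
      show "((\<lambda>h::real. norm h) \<longlongrightarrow> 0) (at 0)" by (intro tendsto_norm_zero tendsto_ident_at)
    qed
    then show ?thesis using 3 by (simp add: DERIV_def)
  qed
qed

text \<open>The bound on \<open>E'\<close> makes \<open>E t * exp (- C * t)\<close> nonincreasing
  and \<open>E t * exp (C * t)\<close> nondecreasing. The second inequality is what keeps large
  orbits large during the whole period.\<close>

lemma gronwall_two_sided:
  fixes E :: "real \<Rightarrow> real"
  assumes t: "t \<in> {0..T}" and C: "0 \<le> C"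
    and deriv: "\<And>s. s \<in> {0..T} \<Longrightarrow> (E has_real_derivative E' s) (at s within {0..T})"
    and bound: "\<And>s. s \<in> {0..T} \<Longrightarrow> \<bar>E' s\<bar> \<le> C * E s"
  shows "E t \<le> exp (C * t) * E 0" "E 0 \<le> exp (C * t) * E t"
proof -
  have aux: "E t * exp (k * t) \<le> E 0 * exp (k * 0)" if "k * C = - C\<^sup>2 " "k = - C" for k
  proof (rule DERIV_nonpos_imp_decreasing_open[of 0 t])
    fix s assume s: "0 < s" "s < t"
    have "(E has_real_derivative E' s) (at s)"
      using deriv[of s] s t at_within_Icc_at[of 0 s T] by auto
    then have "((\<lambda>s. E s * exp (k * s)) has_real_derivative (E' s + k * E s) * exp (k * s)) (at s)"
      by (auto intro!: derivative_eq_intros simp: algebra_simps)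
    moreover have "(E' s + k * E s) * exp (k * s) \<le> 0"
      using bound[of s] s t that by (intro mult_nonpos_nonneg) auto
    ultimately show "\<exists>y. ((\<lambda>s. E s * exp (k * s)) has_real_derivative y) (at s) \<and> y \<le> 0" by blast
  next
    have "continuous_on {0..T} E"
      by (rule DERIV_continuous_on) (rule deriv)
    then show "continuous_on {0..t} (\<lambda>s. E s * exp (k * s))"
      using t by (auto intro!: continuous_intros elim: continuous_on_subset)
  qed (use t in auto)
  have aux2: "E 0 * exp (C * 0) \<le> E t * exp (C * t)"
  proof (rule DERIV_nonneg_imp_increasing_open[of 0 t])
    fix s assume s: "0 < s" "s < t"
    have "(E has_real_derivative E' s) (at s)"
      using deriv[of s] s t at_within_Icc_at[of 0 s T] by auto
    then have "((\<lambda>s. E s * exp (C * s)) has_real_derivative (E' s + C * E s) * exp (C * s)) (at s)"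
      by (auto intro!: derivative_eq_intros simp: algebra_simps)
    moreover have "0 \<le> (E' s + C * E s) * exp (C * s)"
      using bound[of s] s t by (intro mult_nonneg_nonneg) auto
    ultimately show "\<exists>y. ((\<lambda>s. E s * exp (C * s)) has_real_derivative y) (at s) \<and> 0 \<le> y" by blast
  next
    have "continuous_on {0..T} E"
      by (rule DERIV_continuous_on) (rule deriv)
    then show "continuous_on {0..t} (\<lambda>s. E s * exp (C * s))"
      using t by (auto intro!: continuous_intros elim: continuous_on_subset)
  qed (use t in auto)
  show "E t \<le> exp (C * t) * E 0"
    using aux[of "- C"] by (simp add: power2_eq_square exp_minus field_simps)
  show "E 0 \<le> exp (C * t) * E t" using aux2 by (simp add: mult.commute)
qed

text \<open>Infinitely many zeros in a compact interval accumulate at a zero, and the difference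
  quotients taken along them vanish, so the derivative there would be 0.\<close>

lemma finite_simple_zeros:
  fixes f :: "real \<Rightarrow> real"
  assumes deriv: "\<And>t. t \<in> {a..b} \<Longrightarrow> (f has_real_derivative f' t) (at t within {a..b})"
    and simple: "\<And>t. t \<in> {a..b} \<Longrightarrow> f t = 0 \<Longrightarrow> f' t \<noteq> 0"
  shows "finite {t \<in> {a..b}. f t = 0}"
proof (rule ccontr)
  let ?Z = "{t \<in> {a..b}. f t = 0}"
  assume "infinite ?Z"
  then obtain t where t: "t \<in> {a..b}" "t islimpt ?Z"
    using compact_Icc[of a b] unfolding compact_eq_Bolzano_Weierstrass
    by (metis (no_types, lifting) mem_Collect_eq subsetI)
  have "continuous_on {a..b} f"
    by (rule DERIV_continuous_on) (rule deriv)
  then have "closed ?Z" by (intro continuous_closed_preimage_constant) auto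
  then have "f t = 0" using t closed_limpt by blast
  have "(f has_real_derivative f' t) (at t within ?Z)"
    using deriv[OF t(1)] by (rule has_field_derivative_subset) auto
  then have "((\<lambda>y. (f y - f t) / (y - t)) \<longlongrightarrow> f' t) (at t within ?Z)"
    by (simp add: has_field_derivative_iff)
  moreover have "((\<lambda>y. (f y - f t) / (y - t)) \<longlongrightarrow> 0) (at t within ?Z)"
    by (rule Lim_transform_within[OF tendsto_const[of 0], of 1])
      (use \<open>f t = 0\<close> in auto)
  ultimately have "f' t = 0"
    using t(2) tendsto_unique trivial_limit_within by blast
  then show False using simple[OF t(1) \<open>f t = 0\<close>] by simp
qed

text \<open>Near \<open>t\<close> the continuous logarithm equals
  \<open>h t + Ln (W s / W t)\<close>: continuity keeps the change of the imaginary part below 1,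
  hence within the principal branch, and \<open>Ln\<close> is differentiable at 1.\<close>

lemma has_vector_derivative_log:
  fixes h W :: "real \<Rightarrow> complex"
  assumes "open S" "t \<in> S" and h: "continuous_on S h"
    and W: "\<And>s. s \<in> S \<Longrightarrow> exp (h s) = W s" and deriv: "(W has_vector_derivative W') (at t)"
  shows "(h has_vector_derivative W' / W t) (at t)"
proof -
  have W0: "W t \<noteq> 0" using W[OF assms(2)] by (metis exp_not_eq_zero)
  have "(h \<longlongrightarrow> h t) (at t)"
    using h assms(1,2) by (metis at_within_open continuous_on_def)
  then have "\<forall>\<^sub>F s in at t. dist (h s) (h t) < 1" by (intro tendstoD) auto
  then obtain d where d: "0 < d" "\<And>s. s \<noteq> t \<Longrightarrow> dist s t < d \<Longrightarrow> dist (h s) (h t) < 1"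
    unfolding eventually_at by blast
  let ?U = "S \<inter> ball t d"
  have eq: "h t + Ln (W s / W t) = h s" if "s \<in> ?U" for s
  proof -
    have "dist (h s) (h t) < 1" using d(2)[of s] that by (cases "s = t") (auto simp: dist_commute)
    then have "\<bar>Im (h s - h t)\<bar> < 1" using abs_Im_le_cmod[of "h s - h t"] by (simp add: dist_norm)
    then have "Ln (exp (h s - h t)) = h s - h t" using pi_gt3 by (intro Ln_exp) auto
    moreover have "exp (h s - h t) = W s / W t" using W that assms(2) by (simp add: exp_diff)
    ultimately show ?thesis by simp
  qed
  have 1: "((\<lambda>s. W s / W t) has_vector_derivative W' / W t) (at t)"
    using deriv by (auto intro!: derivative_eq_intros)
  have 2: "(Ln has_field_derivative inverse (W t / W t)) (at (W t / W t))"
    using W0 by (intro has_field_derivative_Ln) auto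
  have "((\<lambda>s. h t + Ln (W s / W t)) has_vector_derivative W' / W t) (at t)"
    using field_vector_diff_chain_at[OF 1 2] W0 by (auto intro!: derivative_eq_intros simp: o_def)
  then show ?thesis
    by (rule has_vector_derivative_transform_within_open[of _ _ _ ?U]) (use assms(1,2) d eq in auto)
qed

text \<open>Here \<open>x\<close> is the distance from the wall and \<open>l\<close> the angular
  momentum, confined to \<open>{0..1}\<close>. By \<open>g_pos\<close> the force behind the wall is
  its value at the wall, so that the penalised equation makes sense for
  \<open>x < 0\<close>.\<close>

locale impact =
  fixes T B :: real and g :: "real \<Rightarrow> real \<Rightarrow> real \<Rightarrow> real"
  assumes T: "0 < T" and B: "0 \<le> B"
    and g_cont: "continuous_on UNIV (\<lambda>(l, t, x). g l t x)"
    and g_pos: "g l t x = g l t (max x 0)"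
    and g_growth: "l \<in> {0..1} \<Longrightarrow> \<bar>g l t x\<bar> \<le> B * (1 + max x 0)"
begin

text \<open>The wall at \<open>x = 0\<close> is replaced by a spring of stiffness \<open>n\<close> acting on \<open>x < 0\<close>.\<close>
definition penalized :: "real \<Rightarrow> real \<Rightarrow> (real \<Rightarrow> real) \<Rightarrow> (real \<Rightarrow> real) \<Rightarrow> bool" where
  "penalized n l x v \<longleftrightarrow> (\<forall>t\<in>{0..T}. (x has_real_derivative v t) (at t within {0..T}) \<and>
     (v has_real_derivative n * max (- x t) 0 - g l t (x t)) (at t within {0..T}))"

text \<open>Twice the mechanical energy of the piecewise linear oscillator with frequency
  \<open>\<omega>\<close> in front of the wall and stiffness \<open>n\<close> behind it. The
  frequency is a parameter of the observer and not of the equation: the two resonant frequencies are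
  used for rotation, the value 0 in the stiff limit.\<close>

definition energy :: "real \<Rightarrow> real \<Rightarrow> real \<Rightarrow> real \<Rightarrow> real" where
  "energy \<omega> n x v = v\<^sup>2 + \<omega>\<^sup>2 * (max x 0)\<^sup>2 + n * (max (- x) 0)\<^sup>2"

text \<open>Arises from \<open>2 * \<bar>v\<bar> * \<bar>d\<bar> \<le> v\<^sup>2 + d\<^sup>2\<close>
  and the squared linear growth bound for the deviation \<open>d\<close> of the force. That it does
  not involve \<open>n\<close> makes all later bounds uniform in the stiffness.\<close>

definition rate :: "real \<Rightarrow> real" where
  "rate \<omega> = 1 + 2 * B\<^sup>2 + 2 * (B + \<omega>\<^sup>2)\<^sup>2 / \<omega>\<^sup>2"

text \<open>On \<open>x \<ge> 0\<close> this is \<open>(v + \<i> \<omega> x)\<^sup>2\<close>; on \<open>x \<le> 0\<close> it is the energy. Hence half its argument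
  increases by \<open>\<pi>\<close> from one impact to the next and stays constant while the spring is compressed.\<close>
definition phase_point :: "real \<Rightarrow> real \<Rightarrow> real \<Rightarrow> real \<Rightarrow> complex" where
  "phase_point \<omega> n x v = Complex (v\<^sup>2 - \<omega>\<^sup>2 * (max x 0)\<^sup>2 + n * (max (- x) 0)\<^sup>2) (2 * \<omega> * max x 0 * v)"

lemma penalizedD:
  assumes "penalized n l x v" "t \<in> {0..T}"
  shows "(x has_real_derivative v t) (at t within {0..T})"
    "(v has_real_derivative n * max (- x t) 0 - g l t (x t)) (at t within {0..T})"
  using assms by (auto simp: penalized_def)

lemma penalizedD_at:
  assumes "penalized n l x v" "0 < t" "t < T"
  shows "(x has_real_derivative v t) (at t)"
    "(v has_real_derivative n * max (- x t) 0 - g l t (x t)) (at t)"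
  using penalizedD[OF assms(1), of t] assms at_within_Icc_at[of 0 t T] by auto

lemma penalized_continuous:
  assumes "penalized n l x v"
  shows "continuous_on {0..T} x" "continuous_on {0..T} v"
  by (rule DERIV_continuous_on, erule penalizedD[OF assms])+

lemma continuous_on_g:
  assumes "continuous_on S l" "continuous_on S t" "continuous_on S x"
  shows "continuous_on S (\<lambda>s. g (l s) (t s) (x s))"
proof -
  have "continuous_on S (\<lambda>s. (\<lambda>(l, t, x). g l t x) (l s, t s, x s))"
    by (rule continuous_on_compose2[OF g_cont]) (use assms in \<open>auto intro!: continuous_intros\<close>)
  then show ?thesis by simp
qed

section \<open>Energy of the penalised oscillator\<close>

lemma energy_nonneg: "0 \<le> n \<Longrightarrow> 0 \<le> energy \<omega> n x v"
  by (simp add: energy_def)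

lemma energy_pos_iff: "0 < n \<Longrightarrow> 0 < \<omega> \<Longrightarrow> 0 < energy \<omega> n x v \<longleftrightarrow> x \<noteq> 0 \<or> v \<noteq> 0"
  by (cases "x < 0"; cases "x = 0") (auto simp: energy_def max_def add_nonneg_pos add_pos_nonneg add_pos_pos)

text \<open>The phase point is positively homogeneous of degree 2, so two states on the same ray
  have phase points with the same argument.\<close>

lemma phase_point_scale: "0 \<le> c \<Longrightarrow> phase_point \<omega> n (c * x) (c * v) = of_real (c\<^sup>2) * phase_point \<omega> n x v"
  by (cases "x < 0"; cases "c = 0") (auto simp: phase_point_def complex_eq_iff max_def power_mult_distrib algebra_simps power2_eq_square mult_le_0_iff zero_le_mult_iff mult_less_0_iff zero_less_mult_iff)

text \<open>In front of the wall this is the modulus of a complex square; behind it the phase point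
  is the energy itself, a nonnegative real.\<close>

lemma norm_phase_point: "0 \<le> n \<Longrightarrow> norm (phase_point \<omega> n x v) = energy \<omega> n x v"
proof -
  assume n: "0 \<le> n"
  have "(v\<^sup>2 - \<omega>\<^sup>2 * (max x 0)\<^sup>2 + n * (max (- x) 0)\<^sup>2)\<^sup>2 + (2 * \<omega> * max x 0 * v)\<^sup>2 = (energy \<omega> n x v)\<^sup>2"
    by (cases "x < 0") (auto simp: energy_def max_def power2_eq_square algebra_simps)
  then show ?thesis using energy_nonneg[OF n, of \<omega> x v] by (simp add: cmod_def phase_point_def)
qed

text \<open>The spring force is the gradient of the spring term, so all contributions of
  \<open>n\<close> cancel, and only the deviation of \<open>g\<close> from the linear force does
  work.\<close>

lemma energy_derivative:
  assumes "penalized n l x v" "t \<in> {0..T}"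
  shows "((\<lambda>t. energy \<omega> n (x t) (v t)) has_real_derivative
     - 2 * v t * (g l t (x t) - \<omega>\<^sup>2 * max (x t) 0)) (at t within {0..T})"
proof -
  note d = penalizedD[OF assms]
  have 1: "((\<lambda>t. (max (x t) 0)\<^sup>2) has_real_derivative 2 * max (x t) 0 * v t) (at t within {0..T})"
    using DERIV_chain2[OF has_real_derivative_max0_power2 d(1)] .
  have 2: "((\<lambda>t. (max (- x t) 0)\<^sup>2) has_real_derivative 2 * max (- x t) 0 * (- v t)) (at t within {0..T})"
    using DERIV_chain2[OF has_real_derivative_max0_power2 DERIV_minus[OF d(1)]] .
  show ?thesis
    unfolding energy_def by (rule derivative_eq_intros 1 2 d refl)+ (simp add: algebra_simps)
qed

lemma energy_rate:
  assumes "l \<in> {0..1}" "0 < \<omega>" "0 \<le> n"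
  shows "\<bar>- 2 * v * (g l t x - \<omega>\<^sup>2 * max x 0)\<bar> \<le> rate \<omega> * (1 + energy \<omega> n x v)"
proof -
  let ?d = "g l t x - \<omega>\<^sup>2 * max x 0"
  have "\<bar>?d\<bar> \<le> B + (B + \<omega>\<^sup>2) * max x 0"
    using g_growth[OF assms(1), of t x] abs_triangle_ineq4[of "g l t x" "\<omega>\<^sup>2 * max x 0"]
    by (simp add: algebra_simps abs_mult)
  then have "?d\<^sup>2 \<le> (B + (B + \<omega>\<^sup>2) * max x 0)\<^sup>2" by (rule power2_le_iff_abs_le[THEN iffD2, rotated]) (use B in auto)
  also have "\<dots> \<le> 2 * B\<^sup>2 + 2 * ((B + \<omega>\<^sup>2) * max x 0)\<^sup>2"
    using sum_squares_bound[of B "(B + \<omega>\<^sup>2) * max x 0"] by (simp add: power2_sum)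
  also have "\<dots> = 2 * B\<^sup>2 + 2 * (B + \<omega>\<^sup>2)\<^sup>2 / \<omega>\<^sup>2 * (\<omega>\<^sup>2 * (max x 0)\<^sup>2)"
    using assms by (simp add: power_mult_distrib)
  also have "\<dots> \<le> 2 * B\<^sup>2 + 2 * (B + \<omega>\<^sup>2)\<^sup>2 / \<omega>\<^sup>2 * energy \<omega> n x v"
    using assms by (intro add_left_mono mult_left_mono) (auto simp: energy_def)
  finally have "?d\<^sup>2 \<le> 2 * B\<^sup>2 + 2 * (B + \<omega>\<^sup>2)\<^sup>2 / \<omega>\<^sup>2 * energy \<omega> n x v" .
  moreover have "\<bar>- 2 * v * ?d\<bar> \<le> v\<^sup>2 + ?d\<^sup>2"
    using sum_squares_bound[of "\<bar>v\<bar>" "\<bar>?d\<bar>"] by (simp add: abs_mult)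
  moreover have "v\<^sup>2 \<le> energy \<omega> n x v" using assms by (simp add: energy_def)
  ultimately have "\<bar>- 2 * v * ?d\<bar> \<le> energy \<omega> n x v + (2 * B\<^sup>2 + 2 * (B + \<omega>\<^sup>2)\<^sup>2 / \<omega>\<^sup>2 * energy \<omega> n x v)"
    by linarith
  also have "\<dots> \<le> rate \<omega> * (1 + energy \<omega> n x v)"
    using energy_nonneg[OF assms(3), of \<omega> x v] B by (simp add: rate_def algebra_simps add_divide_distrib)
  finally show ?thesis .
qed

lemma rate_nonneg: "0 \<le> rate \<omega>" using B by (simp add: rate_def)

lemma energy_growth:
  assumes "penalized n l x v" "t \<in> {0..T}" "l \<in> {0..1}" "0 < \<omega>" "0 \<le> n"
  shows "1 + energy \<omega> n (x t) (v t) \<le> exp (rate \<omega> * T) * (1 + energy \<omega> n (x 0) (v 0))"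
    "1 + energy \<omega> n (x 0) (v 0) \<le> exp (rate \<omega> * T) * (1 + energy \<omega> n (x t) (v t))"
proof -
  let ?E = "\<lambda>t. 1 + energy \<omega> n (x t) (v t)"
  let ?E' = "\<lambda>t. - 2 * v t * (g l t (x t) - \<omega>\<^sup>2 * max (x t) 0)"
  have d: "(?E has_real_derivative ?E' s) (at s within {0..T})" if "s \<in> {0..T}" for s
    using energy_derivative[OF assms(1) that] by (auto intro!: derivative_eq_intros)
  have b: "\<bar>?E' s\<bar> \<le> rate \<omega> * ?E s" if "s \<in> {0..T}" for s
    by (rule energy_rate) (use assms in auto)
  note G = gronwall_two_sided[of t T "rate \<omega>" ?E ?E', OF assms(2) rate_nonneg d b]
  have e: "exp (rate \<omega> * t) \<le> exp (rate \<omega> * T)"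
    using assms(2) rate_nonneg by (auto intro: mult_left_mono)
  have p: "0 \<le> ?E s" for s using energy_nonneg[OF assms(5), of \<omega> "x s" "v s"] by simp
  show "?E t \<le> exp (rate \<omega> * T) * ?E 0"
    using G(1) mult_right_mono[OF e p[of 0]] by linarith
  show "?E 0 \<le> exp (rate \<omega> * T) * ?E t"
    using G(2) mult_right_mono[OF e p[of t]] by linarith
qed

section \<open>The phase angle along a solution\<close>

definition dev :: "real \<Rightarrow> real \<Rightarrow> real \<Rightarrow> real \<Rightarrow> real" where
  "dev \<omega> l t x = g l t x - \<omega>\<^sup>2 * max x 0"

definition pressed :: "real \<Rightarrow> real" where
  "pressed x = (if x \<le> 0 then 1 else 0)"

lemma max0_derivative:
  assumes "(x has_real_derivative v) (at t)" "x t \<noteq> 0"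
  shows "((\<lambda>s. max (x s) 0) has_real_derivative (if x t > 0 then v else 0)) (at t)"
proof -
  have "isCont x t" using assms(1) by (rule DERIV_isCont)
  then have lim: "(x \<longlongrightarrow> x t) (at t)" by (simp add: isCont_def)
  show ?thesis
  proof (cases "x t > 0")
    case True
    have "\<forall>\<^sub>F s in at t. 0 < x s" by (rule order_tendstoD(1)[OF lim True])
    then have "\<forall>\<^sub>F s in nhds t. x s = max (x s) 0"
      using True by (auto simp: eventually_nhds_conv_at elim: eventually_mono)
    then have "(x has_real_derivative v) (at t) \<longleftrightarrow> ((\<lambda>s. max (x s) 0) has_real_derivative v) (at t)"
      by (intro DERIV_cong_ev) auto
    then show ?thesis using assms True by simp
  next
    case False
    then have "x t < 0" using assms(2) by simp
    have "\<forall>\<^sub>F s in at t. x s < 0" by (rule order_tendstoD(2)[OF lim \<open>x t < 0\<close>])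
    then have "\<forall>\<^sub>F s in nhds t. 0 = max (x s) 0"
      using \<open>x t < 0\<close> by (auto simp: eventually_nhds_conv_at elim: eventually_mono)
    then have "((\<lambda>s. 0) has_real_derivative 0) (at t) \<longleftrightarrow> ((\<lambda>s. max (x s) 0) has_real_derivative 0) (at t)"
      by (intro DERIV_cong_ev) auto
    then show ?thesis using False by simp
  qed
qed

text \<open>Where \<open>x\<close> vanishes, positive energy forces a nonzero velocity, so the zeros
  are simple. The corners of the positive part of \<open>x\<close> along the orbit are thus confined
  to finitely many times.\<close>

lemma finite_zeros:
  assumes "penalized n l x v" "0 < n" "0 < \<omega>" "\<And>t. t \<in> {0..T} \<Longrightarrow> 0 < energy \<omega> n (x t) (v t)"
  shows "finite {t \<in> {0..T}. x t = 0}"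
  using penalizedD(1)[OF assms(1)]
  by (rule finite_simple_zeros) (use assms energy_pos_iff in auto)

text \<open>The numerator is the derivative of \<open>phase_point\<close> along the equation, so the
  imaginary part of the quotient is the angular velocity of the phase point. For
  \<open>x > 0\<close> it is \<open>2 * \<omega> * (v\<^sup>2 + x * g l t x)\<close> over the
  energy; splitting the linear force off \<open>g\<close> leaves \<open>2 * \<omega>\<close> and the
  deviation term. For \<open>x < 0\<close> numerator and denominator are real.\<close>

lemma phase_rate:
  assumes "0 < energy \<omega> n x v" "0 \<le> n" "x \<noteq> 0"
  shows "Im (Complex (2 * v * (n * max (- x) 0 - g l t x) - 2 * \<omega>\<^sup>2 * max x 0 * v - 2 * n * max (- x) 0 * v)
             (2 * \<omega> * ((if x > 0 then v else 0) * v + max x 0 * (n * max (- x) 0 - g l t x))) / phase_point \<omega> n x v)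
      = 2 * (\<omega> - \<omega> * pressed x + \<omega> * (max x 0 * dev \<omega> l t x / energy \<omega> n x v))"
proof -
  have N: "(Re (phase_point \<omega> n x v))\<^sup>2 + (Im (phase_point \<omega> n x v))\<^sup>2 = (energy \<omega> n x v)\<^sup>2"
    using norm_phase_point[OF assms(2), of \<omega> x v] cmod_power2 by metis
  show ?thesis
  proof (cases "x > 0")
    case True
    define e where "e = energy \<omega> n x v"
    have E: "e = v\<^sup>2 + \<omega>\<^sup>2 * x\<^sup>2" using True by (simp add: energy_def e_def)
    define b where "b = 2 * \<omega> * (v * v - x * g l t x)"
    define a where "a = - 2 * v * g l t x - 2 * \<omega>\<^sup>2 * x * v"
    have e0: "e \<noteq> 0" using assms by (simp add: e_def)
    have "Im (Complex a b / phase_point \<omega> n x v) = (b * (v\<^sup>2 - \<omega>\<^sup>2 * x\<^sup>2) - a * (2 * \<omega> * x * v)) / e\<^sup>2"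
      unfolding Im_divide N e_def[symmetric] using True by (simp add: phase_point_def)
    also have "b * (v\<^sup>2 - \<omega>\<^sup>2 * x\<^sup>2) - a * (2 * \<omega> * x * v) = 2 * \<omega> * (v\<^sup>2 + x * g l t x) * e"
      unfolding E a_def b_def by (simp add: power2_eq_square algebra_simps)
    also have "2 * \<omega> * (v\<^sup>2 + x * g l t x) * e / e\<^sup>2 = 2 * (\<omega> + \<omega> * (x * (g l t x - \<omega>\<^sup>2 * x) / e))"
      using e0 by (simp add: field_simps power2_eq_square) (simp add: E power2_eq_square algebra_simps)
    finally show ?thesis
      using True by (simp add: dev_def pressed_def a_def b_def e_def)
  next
    case False
    then show ?thesis using assms by (simp add: phase_point_def pressed_def Im_divide)
  qed
qed

text \<open>The derivative formula holds away from the contacts. These are finitely many and the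
  logarithm \<open>h\<close> is continuous across them, so the fundamental theorem with a finite
  exceptional set applies.\<close>

lemma phase_has_integral:
  assumes pen: "penalized n l x v" and "0 < n" "0 < \<omega>"
    and E: "\<And>t. t \<in> {0..T} \<Longrightarrow> 0 < energy \<omega> n (x t) (v t)"
    and h: "continuous_on {0..T} h" "\<And>t. t \<in> {0..T} \<Longrightarrow> exp (h t) = phase_point \<omega> n (x t) (v t)"
    and t: "t \<in> {0..T}"
  shows "((\<lambda>s. \<omega> - \<omega> * pressed (x s) + \<omega> * (max (x s) 0 * dev \<omega> l s (x s) / energy \<omega> n (x s) (v s)))
    has_integral Im (h t) / 2 - Im (h 0) / 2) {0..t}"
proof (rule fundamental_theorem_of_calculus_interior_strong[OF finite_zeros[OF pen assms(2,3) E]])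
  fix s assume s: "s \<in> {0<..<t} - {t \<in> {0..T}. x t = 0}"
  then have s0: "s \<in> {0<..<T}" and xs: "x s \<noteq> 0" using t by auto
  note d = penalizedD_at[OF pen, of s]
  let ?W' = "Complex (2 * v s * (n * max (- x s) 0 - g l s (x s)) - 2 * \<omega>\<^sup>2 * max (x s) 0 * v s - 2 * n * max (- x s) 0 * v s)
             (2 * \<omega> * ((if x s > 0 then v s else 0) * v s + max (x s) 0 * (n * max (- x s) 0 - g l s (x s))))"
  have 1: "((\<lambda>t. (max (x t) 0)\<^sup>2) has_real_derivative 2 * max (x s) 0 * v s) (at s)"
    using DERIV_chain2[OF has_real_derivative_max0_power2 d(1)] s0 by simp
  have 2: "((\<lambda>t. (max (- x t) 0)\<^sup>2) has_real_derivative 2 * max (- x s) 0 * (- v s)) (at s)"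
    using DERIV_chain2[OF has_real_derivative_max0_power2 DERIV_minus[OF d(1)]] s0 by simp
  have 3: "((\<lambda>s. max (x s) 0) has_real_derivative (if x s > 0 then v s else 0)) (at s)"
    using max0_derivative d(1) xs s0 by simp
  have d2: "(v has_real_derivative n * max (- x s) 0 - g l s (x s)) (at s)" using d(2) s0 by simp
  have "((\<lambda>t. phase_point \<omega> n (x t) (v t)) has_vector_derivative ?W') (at s)"
    unfolding phase_point_def has_vector_derivative_complex_iff complex.sel
  proof
    show "((\<lambda>t. (v t)\<^sup>2 - \<omega>\<^sup>2 * (max (x t) 0)\<^sup>2 + n * (max (- x t) 0)\<^sup>2) has_real_derivative
       (2 * v s * (n * max (- x s) 0 - g l s (x s)) - 2 * \<omega>\<^sup>2 * max (x s) 0 * v s - 2 * n * max (- x s) 0 * v s)) (at s)"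
      by (rule derivative_eq_intros 1 2 d2 refl)+ (simp add: algebra_simps)
    show "((\<lambda>t. 2 * \<omega> * max (x t) 0 * v t) has_real_derivative
       (2 * \<omega> * ((if x s > 0 then v s else 0) * v s + max (x s) 0 * (n * max (- x s) 0 - g l s (x s))))) (at s)"
      by (rule derivative_eq_intros 3 d2 refl)+ (simp add: algebra_simps)
  qed
  from has_vector_derivative_log[OF _ _ _ _ this, of "{0<..<T}" h]
  have "(h has_vector_derivative ?W' / phase_point \<omega> n (x s) (v s)) (at s)"
    using s0 h(2) continuous_on_subset[OF h(1), of "{0<..<T}"] by fastforce
  then have "((\<lambda>t. Im (h t)) has_real_derivative Im (?W' / phase_point \<omega> n (x s) (v s))) (at s)"
    unfolding has_vector_derivative_complex_iff by simp
  then have "((\<lambda>t. Im (h t) / 2) has_real_derivative Im (?W' / phase_point \<omega> n (x s) (v s)) / 2) (at s)"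
    by (rule DERIV_cdivide)
  also have "Im (?W' / phase_point \<omega> n (x s) (v s)) / 2 =
     \<omega> - \<omega> * pressed (x s) + \<omega> * (max (x s) 0 * dev \<omega> l s (x s) / energy \<omega> n (x s) (v s))"
    by (subst phase_rate) (use E[of s] s0 assms xs in auto)
  finally show "((\<lambda>t. Im (h t) / 2) has_vector_derivative
     \<omega> - \<omega> * pressed (x s) + \<omega> * (max (x s) 0 * dev \<omega> l s (x s) / energy \<omega> n (x s) (v s))) (at s)"
    by (simp add: has_real_derivative_iff_has_vector_derivative)
next
  show "continuous_on {0..t} (\<lambda>t. Im (h t) / 2)"
    using h(1) t by (auto intro!: continuous_intros elim: continuous_on_subset)
qed (use t in auto)

text \<open>The real part of the phase point is the energy times the cosine of its argument; the
  double angle formula then recovers the position from the phase. Control of phase and energy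
  thereby becomes control of \<open>x\<close>.\<close>

lemma phase_sin:
  assumes "exp h = phase_point \<omega> n x v" "0 \<le> n"
  shows "(sin (Im h / 2))\<^sup>2 * energy \<omega> n x v = \<omega>\<^sup>2 * (max x 0)\<^sup>2"
proof -
  have n: "norm (exp h) = energy \<omega> n x v" using assms norm_phase_point by simp
  have "Re (exp h) = energy \<omega> n x v * cos (Im h)"
    unfolding n[symmetric] by (simp add: Re_exp)
  also have "cos (Im h) = 1 - 2 * (sin (Im h / 2))\<^sup>2"
    using cos_double_sin[of "Im h / 2"] by simp
  finally show ?thesis using assms(1) by (simp add: phase_point_def energy_def algebra_simps)
qed

lemma continuous_on_energy:
  assumes "continuous_on S x" "continuous_on S v"
  shows "continuous_on S (\<lambda>t. energy \<omega> n (x t) (v t))"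
  unfolding energy_def using assms by (intro continuous_intros)

lemma continuous_on_phase_point:
  assumes "continuous_on S x" "continuous_on S v"
  shows "continuous_on S (\<lambda>t. phase_point \<omega> n (x t) (v t))"
  unfolding phase_point_def Complex_eq using assms by (intro continuous_intros)

text \<open>For one state the two frequencies never give opposite directions: the imaginary parts
  have the positive ratio \<open>\<omega> / \<omega>'\<close> unless both vanish, and in that case
  the two real points have the same sign. Hence the principal logarithm of the ratio is continuous
  along an orbit.\<close>

lemma phase_point_ratio:
  assumes "0 < \<omega>" "0 < \<omega>'" "0 < n" "x \<noteq> 0 \<or> v \<noteq> 0"
  shows "phase_point \<omega> n x v / phase_point \<omega>' n x v \<notin> \<real>\<^sub>\<le>\<^sub>0"
proof -
  let ?W = "phase_point \<omega> n x v" and ?V = "phase_point \<omega>' n x v"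
  have V0: "?V \<noteq> 0"
    using norm_phase_point[of n \<omega>' x v] energy_pos_iff[of n \<omega>' x v] assms by auto
  consider "x \<le> 0" | "x > 0" "v = 0" | "x > 0" "v \<noteq> 0" by linarith
  then show ?thesis
  proof cases
    case 1
    then have "?W = ?V" by (simp add: phase_point_def max_def)
    then show ?thesis using V0 by simp
  next
    case 2
    then have "?W = of_real (- (\<omega>\<^sup>2 * x\<^sup>2))" "?V = of_real (- (\<omega>'\<^sup>2 * x\<^sup>2))"
      by (auto simp: phase_point_def complex_eq_iff)
    then have "?W / ?V = of_real ((\<omega>\<^sup>2 * x\<^sup>2) / (\<omega>'\<^sup>2 * x\<^sup>2))" by simp
    moreover have "0 < (\<omega>\<^sup>2 * x\<^sup>2) / (\<omega>'\<^sup>2 * x\<^sup>2)" using 2 assms by simp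
    ultimately show ?thesis by (simp only: nonpos_Reals_of_real_iff not_le)
  next
    case 3
    show ?thesis
    proof
      assume "?W / ?V \<in> \<real>\<^sub>\<le>\<^sub>0"
      then obtain r where r: "?W / ?V = of_real r" "r \<le> 0" by (auto elim: nonpos_Reals_cases)
      then have "?W = of_real r * ?V" using V0 by (simp add: field_simps)
      then have "2 * \<omega> * max x 0 * v = r * (2 * \<omega>' * max x 0 * v)"
        by (simp add: phase_point_def complex_eq_iff)
      then have "\<omega> = r * \<omega>'" using 3 by (simp add: max_def)
      then show False using r assms by (metis mult_nonpos_nonneg less_imp_le not_le)
    qed
  qed
qed

text \<open>If the orbit ends on its initial ray, the argument grows by a multiple of 2\<pi>, so
  half of it grows by \<open>pi * of_int j\<close>. The same \<open>j\<close> serves both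
  frequencies because the two logarithms differ by the single-valued \<open>q\<close>, which has
  equal values at both ends.\<close>

lemma winding_number_exists:
  assumes pen: "penalized n l x v" and n: "0 < n" and \<omega>: "0 < \<omega>1" "0 < \<omega>2"
    and nz: "\<And>t. t \<in> {0..T} \<Longrightarrow> x t \<noteq> 0 \<or> v t \<noteq> 0"
    and aligned: "x T = c * x 0" "v T = c * v 0" "0 < c"
  obtains h1 h2 and j :: int where
    "continuous_on {0..T} h1" "\<And>t. t \<in> {0..T} \<Longrightarrow> exp (h1 t) = phase_point \<omega>1 n (x t) (v t)"
    "continuous_on {0..T} h2" "\<And>t. t \<in> {0..T} \<Longrightarrow> exp (h2 t) = phase_point \<omega>2 n (x t) (v t)"
    "Im (h1 T) / 2 - Im (h1 0) / 2 = pi * of_int j" "Im (h2 T) / 2 - Im (h2 0) / 2 = pi * of_int j"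
proof -
  let ?W = "\<lambda>\<omega> t. phase_point \<omega> n (x t) (v t)"
  have W0: "?W \<omega> t \<noteq> 0" if "t \<in> {0..T}" "0 < \<omega>" for \<omega> t
    using norm_phase_point[of n \<omega> "x t" "v t"] energy_pos_iff[of n \<omega> "x t" "v t"] nz[OF that(1)] n that(2) by auto
  have cW: "continuous_on {0..T} (?W \<omega>)" for \<omega>
    by (rule continuous_on_phase_point[OF penalized_continuous[OF pen]])
  obtain h1 where h1: "continuous_on {0..T} h1" "\<And>t. t \<in> {0..T} \<Longrightarrow> ?W \<omega>1 t = exp (h1 t)"
    using continuous_logarithm_on_contractible[OF cW convex_imp_contractible, of \<omega>1] W0 \<omega>(1) by auto
  define q where "q t = Ln (?W \<omega>1 t / ?W \<omega>2 t)" for t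
  define h2 where "h2 t = h1 t - q t" for t
  have cq: "continuous_on {0..T} q"
  proof -
    have "continuous_on {0..T} (\<lambda>t. ?W \<omega>1 t / ?W \<omega>2 t)"
      using cW W0 \<omega> by (intro continuous_on_divide) auto
    then have "continuous_on {0..T} (\<lambda>t. Ln (?W \<omega>1 t / ?W \<omega>2 t))"
      by (rule continuous_on_Ln') (use phase_point_ratio[OF \<omega> n] nz in auto)
    then show ?thesis unfolding q_def[abs_def] .
  qed
  have h2: "exp (h2 t) = ?W \<omega>2 t" if "t \<in> {0..T}" for t
    using W0[OF that] \<omega> h1(2)[OF that] by (simp add: h2_def q_def exp_diff)
  have TT: "T \<in> {0..T}" "0 \<in> {0..T}" using T by auto
  have sc: "?W \<omega> T = of_real (c\<^sup>2) * ?W \<omega> 0" for \<omega>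
    using phase_point_scale[of c] aligned by simp
  have "q T = q 0" using sc W0 aligned(3) by (simp add: q_def)
  have "exp (h1 T) = exp (h1 0 + of_real (ln (c\<^sup>2)))"
    using sc[of \<omega>1] h1(2)[OF TT(1)] h1(2)[OF TT(2)] aligned(3) by (simp add: exp_add exp_of_real del: of_real_power)
  then obtain j where j: "h1 T = h1 0 + of_real (ln (c\<^sup>2)) + (of_int (2 * j) * pi) * \<i>"
    by (auto simp: exp_eq)
  then have "Im (h1 T) = Im (h1 0) + 2 * j * pi" by simp
  then have 1: "Im (h1 T) / 2 - Im (h1 0) / 2 = pi * of_int j" by (simp add: field_simps)
  then have 2: "Im (h2 T) / 2 - Im (h2 0) / 2 = pi * of_int j"
    using \<open>q T = q 0\<close> by (simp add: h2_def diff_divide_distrib)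
  show ?thesis
    by (rule that[of h1 h2 j]) (use h1 h2 1 2 cq in \<open>auto simp: h2_def[abs_def] intro!: continuous_intros\<close>)
qed

section \<open>Estimates for solutions of large energy\<close>

lemma continuous_on_dev:
  assumes "continuous_on S l" "continuous_on S t" "continuous_on S x"
  shows "continuous_on S (\<lambda>s. dev \<omega> (l s) (t s) (x s))"
  unfolding dev_def using assms by (intro continuous_intros continuous_on_g)

lemma component_bounds:
  assumes "energy \<omega> n x v \<le> (a * \<rho>)\<^sup>2" "0 < \<omega>" "0 < n" "0 \<le> a" "0 \<le> \<rho>"
  shows "\<bar>v\<bar> \<le> a * \<rho>" "max x 0 \<le> a * \<rho> / \<omega>" "max (- x) 0 \<le> a * \<rho> / sqrt n"
proof -
  have ar: "0 \<le> a * \<rho>" using assms by simp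
  have "v\<^sup>2 \<le> (a * \<rho>)\<^sup>2" "(\<omega> * max x 0)\<^sup>2 \<le> (a * \<rho>)\<^sup>2" "(sqrt n * max (- x) 0)\<^sup>2 \<le> (a * \<rho>)\<^sup>2"
    using assms(1,3) by (auto simp: energy_def power_mult_distrib intro: order_trans[rotated])
  then have *: "\<bar>v\<bar> \<le> a * \<rho>" "\<bar>\<omega> * max x 0\<bar> \<le> a * \<rho>" "\<bar>sqrt n * max (- x) 0\<bar> \<le> a * \<rho>"
    using ar by (auto intro!: abs_le_square_iff[THEN iffD2, of _ "a * \<rho>", unfolded abs_of_nonneg[OF ar]])
  show "\<bar>v\<bar> \<le> a * \<rho>" by (fact *(1))
  show "max x 0 \<le> a * \<rho> / \<omega>" using *(2) assms(2) by (simp only: pos_le_divide_eq abs_le_iff mult.commute)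
  have "0 < sqrt n" using assms(3) by simp
  then show "max (- x) 0 \<le> a * \<rho> / sqrt n" using *(3) by (simp only: pos_le_divide_eq abs_le_iff mult.commute)
qed

text \<open>A virial identity. With \<open>m = max (- x) 0\<close>, the derivative of
  \<open>m v\<close> is \<open>2 n m\<^sup>2 - m g\<close> minus the energy while the spring is
  compressed. Now \<open>n m\<^sup>2\<close> is at most the penetration depth times the spring force
  \<open>n m\<close>, whose integral is the total impulse, of order \<open>\<rho>\<close>. So the
  energy integrated over the contact time is of order \<open>\<rho>\<^sup>2 / sqrt n\<close>, and
  dividing by the lower energy bound leaves a time of order \<open>1 / sqrt n\<close>.\<close>

lemma pressed_time:
  assumes pen: "penalized n l x v" and l: "l \<in> {0..1}" and n: "0 < n" and \<omega>: "0 < \<omega>"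
    and \<rho>: "1 \<le> \<rho>" and a: "1 \<le> a"
    and E: "\<And>t. t \<in> {0..T} \<Longrightarrow> energy \<omega> n (x t) (v t) \<le> (a * \<rho>)\<^sup>2"
      "\<And>t. t \<in> {0..T} \<Longrightarrow> (\<rho> / a)\<^sup>2 \<le> energy \<omega> n (x t) (v t)"
    and int: "(\<lambda>t. pressed (x t)) integrable_on {0..T}"
  shows "integral {0..T} (\<lambda>t. pressed (x t)) \<le> a ^ 3 * (6 * a + 3 * T * B * (1 + a / \<omega>)) / sqrt n"
proof -
  let ?E = "\<lambda>t. energy \<omega> n (x t) (v t)"
  let ?m = "\<lambda>t. max (- x t) 0"
  \<comment> \<open>\<open>b\<close> bounds the force along the orbit and \<open>\<sigma>\<close>
    the penetration depth; the small factor \<open>1 / sqrt n\<close> enters through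
    \<open>\<sigma>\<close>.\<close>
  define b where "b = B * (1 + a / \<omega>) * \<rho>"
  define \<sigma> where "\<sigma> = a * \<rho> / sqrt n"
  note cont = penalized_continuous[OF pen]
  have TT: "T \<in> {0..T}" "0 \<in> {0..T}" using T by auto
  have E0: "0 < ?E t" if "t \<in> {0..T}" for t
    using E(2)[OF that] \<rho> a by (rule_tac less_le_trans[of 0 "(\<rho> / a)\<^sup>2"]) auto
  have bnd: "\<bar>v t\<bar> \<le> a * \<rho>" "max (x t) 0 \<le> a * \<rho> / \<omega>" "?m t \<le> \<sigma>" if "t \<in> {0..T}" for t
    using component_bounds[OF E(1)[OF that] \<omega> n] \<rho> a by (auto simp: \<sigma>_def)
  have s0: "0 \<le> \<sigma>" using a \<rho> n by (simp add: \<sigma>_def)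
  have g: "\<bar>g l t (x t)\<bar> \<le> b" if "t \<in> {0..T}" for t
  proof -
    have "B * (1 + max (x t) 0) \<le> B * (\<rho> + a * \<rho> / \<omega>)"
      using bnd(2)[OF that] \<rho> B by (intro mult_left_mono add_mono) auto
    then show ?thesis using g_growth[OF l, of t "x t"] by (simp add: b_def algebra_simps)
  qed
  have cg: "continuous_on {0..T} (\<lambda>t. g l t (x t))" by (intro continuous_on_g continuous_intros cont)
  have cm: "continuous_on {0..T} ?m" by (intro continuous_intros cont)
  have iv: "((\<lambda>t. n * ?m t - g l t (x t)) has_integral v T - v 0) {0..T}"
    using penalizedD(2)[OF pen] T
    by (intro fundamental_theorem_of_calculus) (auto simp: has_real_derivative_iff_has_vector_derivative)
  have ig: "((\<lambda>t. g l t (x t)) has_integral integral {0..T} (\<lambda>t. g l t (x t))) {0..T}"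
    using cg integrable_continuous_interval by blast
  \<comment> \<open>The impulse of the spring is the change of velocity plus the impulse of
    \<open>g\<close>; it stays bounded however stiff the spring is.\<close>
  have im: "((\<lambda>t. n * ?m t) has_integral v T - v 0 + integral {0..T} (\<lambda>t. g l t (x t))) {0..T}"
    using has_integral_add[OF iv ig] by simp
  have "integral {0..T} (\<lambda>t. g l t (x t)) \<le> integral {0..T} (\<lambda>t. b)"
    using g cg by (intro integral_le integrable_continuous_interval continuous_intros) (auto simp: abs_le_iff)
  then have Im: "integral {0..T} (\<lambda>t. n * ?m t) \<le> 2 * a * \<rho> + T * b"
    unfolding integral_unique[OF im] using bnd(1)[OF TT(1)] bnd(1)[OF TT(2)] T by (simp add: abs_le_iff algebra_simps)
  \<comment> \<open>The virial identity, integrated over the period with the contacts as exceptional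
    points.\<close>
  have ip: "((\<lambda>t. - pressed (x t) * ?E t + 2 * (n * (?m t)\<^sup>2) - ?m t * g l t (x t)) has_integral ?m T * v T - ?m 0 * v 0) {0..T}"
  proof (rule fundamental_theorem_of_calculus_interior_strong[OF finite_zeros[OF pen n \<omega> E0]])
    fix t assume "t \<in> {0<..<T} - {t \<in> {0..T}. x t = 0}"
    then have t: "0 < t" "t < T" "x t \<noteq> 0" by auto
    note d = penalizedD_at[OF pen t(1,2)]
    have d1: "((\<lambda>s. max (- x s) 0) has_real_derivative (if - x t > 0 then - v t else 0)) (at t)"
      by (rule max0_derivative) (use t d in \<open>auto intro!: derivative_eq_intros\<close>)
    have "((\<lambda>s. ?m s * v s) has_real_derivative
        (if - x t > 0 then - v t else 0) * v t + (n * ?m t - g l t (x t)) * ?m t) (at t)"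
      by (rule derivative_eq_intros d1 d(2) refl)+
    also have "(if - x t > 0 then - v t else 0) * v t + (n * ?m t - g l t (x t)) * ?m t
      = - pressed (x t) * ?E t + 2 * (n * (?m t)\<^sup>2) - ?m t * g l t (x t)"
      using t(3) by (auto simp: pressed_def energy_def max_def power2_eq_square algebra_simps)
    finally show "((\<lambda>s. ?m s * v s) has_vector_derivative
        - pressed (x t) * ?E t + 2 * (n * (?m t)\<^sup>2) - ?m t * g l t (x t)) (at t)"
      by (simp add: has_real_derivative_iff_has_vector_derivative)
  qed (use T cm cont in \<open>auto intro!: continuous_intros\<close>)
  let ?k = "\<lambda>t. 2 * (n * (?m t)\<^sup>2) - ?m t * g l t (x t)"
  have ck: "continuous_on {0..T} ?k" by (intro continuous_intros cm cg)
  then have ik: "(?k has_integral integral {0..T} ?k) {0..T}" using integrable_continuous_interval by blast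
  have pE: "((\<lambda>t. pressed (x t) * ?E t) has_integral integral {0..T} ?k - (?m T * v T - ?m 0 * v 0)) {0..T}"
    using has_integral_diff[OF ik ip] by (simp add: algebra_simps)
  have "?k t \<le> 2 * \<sigma> * (n * ?m t) + \<sigma> * b" if "t \<in> {0..T}" for t
  proof -
    have "n * (?m t)\<^sup>2 \<le> \<sigma> * (n * ?m t)"
      using bnd(3)[OF that] n mult_right_mono[of "?m t" "\<sigma>" "n * ?m t"] by (simp add: power2_eq_square algebra_simps)
    moreover have "- (?m t * g l t (x t)) \<le> \<sigma> * b"
    proof -
      have "\<bar>?m t * g l t (x t)\<bar> \<le> \<sigma> * b"
        unfolding abs_mult using bnd(3)[OF that] g[OF that] s0 by (intro mult_mono) auto
      then show ?thesis by simp
    qed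
    ultimately show ?thesis by simp
  qed
  then have "integral {0..T} ?k \<le> integral {0..T} (\<lambda>t. 2 * \<sigma> * (n * ?m t) + \<sigma> * b)"
    by (intro integral_le integrable_continuous_interval ck continuous_intros cm)
  also have "\<dots> = integral {0..T} (\<lambda>t. 2 * \<sigma> * (n * ?m t)) + integral {0..T} (\<lambda>t. \<sigma> * b)"
    by (intro integral_add integrable_continuous_interval continuous_intros cm)
  also have "integral {0..T} (\<lambda>t. 2 * \<sigma> * (n * ?m t)) = 2 * \<sigma> * integral {0..T} (\<lambda>t. n * ?m t)"
    by (rule integral_mult_right)
  also have "integral {0..T} (\<lambda>t. \<sigma> * b) = T * (\<sigma> * b)" using T by simp
  also have "2 * \<sigma> * integral {0..T} (\<lambda>t. n * ?m t) + T * (\<sigma> * b) \<le> 2 * \<sigma> * (2 * a * \<rho> + T * b) + T * (\<sigma> * b)"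
    using Im s0 by (intro add_right_mono mult_left_mono) auto
  finally have k: "integral {0..T} ?k \<le> 2 * \<sigma> * (2 * a * \<rho> + T * b) + T * (\<sigma> * b)" .
  have mv: "\<bar>?m t * v t\<bar> \<le> \<sigma> * (a * \<rho>)" if "t \<in> {0..T}" for t
    unfolding abs_mult using bnd(1,3)[OF that] s0 by (intro mult_mono) auto
  have "integral {0..T} (\<lambda>t. pressed (x t) * ?E t) \<le> 2 * \<sigma> * (2 * a * \<rho> + T * b) + T * (\<sigma> * b) + 2 * (\<sigma> * (a * \<rho>))"
    unfolding integral_unique[OF pE] using k mv[OF TT(1)] mv[OF TT(2)] unfolding abs_le_iff by linarith
  also have "\<dots> = \<sigma> * \<rho> * (6 * a + 3 * T * B * (1 + a / \<omega>))" by (simp add: b_def algebra_simps)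
  finally have 1: "integral {0..T} (\<lambda>t. pressed (x t) * ?E t) \<le> \<sigma> * \<rho> * (6 * a + 3 * T * B * (1 + a / \<omega>))" .
  have "integral {0..T} (\<lambda>t. (\<rho> / a)\<^sup>2 * pressed (x t)) \<le> integral {0..T} (\<lambda>t. pressed (x t) * ?E t)"
  proof (rule integral_le)
    show "(\<lambda>t. (\<rho> / a)\<^sup>2 * pressed (x t)) integrable_on {0..T}" using int by (intro integrable_on_mult_right)
    show "(\<lambda>t. pressed (x t) * ?E t) integrable_on {0..T}" using pE by blast
    show "(\<rho> / a)\<^sup>2 * pressed (x t) \<le> pressed (x t) * ?E t" if "t \<in> {0..T}" for t
      using E(2)[OF that] by (simp add: pressed_def)
  qed
  then have "(\<rho> / a)\<^sup>2 * integral {0..T} (\<lambda>t. pressed (x t)) \<le> \<sigma> * \<rho> * (6 * a + 3 * T * B * (1 + a / \<omega>))"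
    using 1 by simp
  moreover have "\<sigma> * \<rho> * Z = (\<rho> / a)\<^sup>2 * (a ^ 3 * Z / sqrt n)" for Z
    using a n by (simp add: \<sigma>_def power2_eq_square power3_eq_cube field_simps)
  ultimately have "(\<rho> / a)\<^sup>2 * integral {0..T} (\<lambda>t. pressed (x t)) 
      \<le> (\<rho> / a)\<^sup>2 * (a ^ 3 * (6 * a + 3 * T * B * (1 + a / \<omega>)) / sqrt n)"
    by simp
  then show ?thesis
    by (rule mult_left_le_imp_le) (use a \<rho> in auto)
qed

text \<open>The factor 2 under the root absorbs the additive 1 in \<open>energy_growth\<close> once
  \<open>a \<le> \<rho>\<close>; what is left is a purely multiplicative band, so the orbit is of
  size \<open>\<rho>\<close> at all times.\<close>

lemma energy_band:
  assumes pen: "penalized n l x v" and l: "l \<in> {0..1}" and \<omega>: "0 < \<omega>" and n: "0 \<le> n"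
    and a: "a = sqrt (2 * exp (rate \<omega> * T))" "a \<le> \<rho>" and E0: "energy \<omega> n (x 0) (v 0) = \<rho>\<^sup>2"
    and t: "t \<in> {0..T}"
  shows "energy \<omega> n (x t) (v t) \<le> (a * \<rho>)\<^sup>2" "(\<rho> / a)\<^sup>2 \<le> energy \<omega> n (x t) (v t)"
proof -
  let ?A = "exp (rate \<omega> * T)" and ?E = "energy \<omega> n (x t) (v t)"
  have A1: "1 \<le> ?A" using rate_nonneg T by simp
  have a2: "a\<^sup>2 = 2 * ?A" by (simp add: a)
  have a0: "0 \<le> a" by (simp add: a)
  have \<rho>a: "2 * ?A \<le> \<rho>\<^sup>2" using power_mono[OF a(2) a0, of 2] a2 by simp
  note G = energy_growth[OF pen t l \<omega> n, unfolded E0]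
  have "1 \<le> \<rho>\<^sup>2" using \<rho>a A1 by linarith
  have "?E \<le> ?A * (1 + \<rho>\<^sup>2)" using G(1) by simp
  also have "\<dots> \<le> ?A * (2 * \<rho>\<^sup>2)" using \<open>1 \<le> \<rho>\<^sup>2\<close> A1 by (intro mult_left_mono) auto
  finally show "?E \<le> (a * \<rho>)\<^sup>2" by (simp add: power_mult_distrib a2)
  have "\<rho>\<^sup>2 + 2 * ?A \<le> 2 * \<rho>\<^sup>2" using \<rho>a by simp
  then have "\<rho>\<^sup>2 + 2 * ?A \<le> 2 * ?A * (1 + ?E)" using G(2) by linarith
  then have "\<rho>\<^sup>2 \<le> 2 * ?A * ?E" by (simp add: algebra_simps)
  then show "(\<rho> / a)\<^sup>2 \<le> ?E" by (simp add: power_divide a2 field_simps)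
qed

text \<open>The phase is free rotation, minus the delay caused by compression, plus the effect of
  the deviation. Integrability of \<open>pressed\<close> is obtained by solving the phase identity
  for it, every other term being integrable.\<close>

lemma phase_formula:
  assumes pen: "penalized n l x v" and "0 < n" "0 < \<omega>"
    and E: "\<And>t. t \<in> {0..T} \<Longrightarrow> 0 < energy \<omega> n (x t) (v t)"
    and h: "continuous_on {0..T} h" "\<And>t. t \<in> {0..T} \<Longrightarrow> exp (h t) = phase_point \<omega> n (x t) (v t)"
    and t: "t \<in> {0..T}"
  defines "w \<equiv> \<lambda>s. max (x s) 0 * dev \<omega> l s (x s) / energy \<omega> n (x s) (v s)"
  shows "continuous_on {0..T} w" "(\<lambda>s. pressed (x s)) integrable_on {0..t}"
    "Im (h t) / 2 - Im (h 0) / 2 = \<omega> * t - \<omega> * integral {0..t} (\<lambda>s. pressed (x s)) + \<omega> * integral {0..t} w"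
proof -
  note cont = penalized_continuous[OF pen]
  show cw: "continuous_on {0..T} w"
    unfolding w_def using E cont
    by (intro continuous_intros continuous_on_dev continuous_on_energy) fastforce+
  let ?D = "Im (h t) / 2 - Im (h 0) / 2"
  have ph: "((\<lambda>s. \<omega> - \<omega> * pressed (x s) + \<omega> * w s) has_integral ?D) {0..t}"
    unfolding w_def by (rule phase_has_integral[OF pen assms(2,3) E h t])
  have iw: "(w has_integral integral {0..t} w) {0..t}"
    using t by (intro integrable_integral integrable_continuous_interval continuous_on_subset[OF cw]) auto
  have ic: "((\<lambda>s. \<omega>) has_integral \<omega> * t) {0..t}" using has_integral_const_real[of \<omega> 0 t] t by (simp add: mult.commute)
  have "((\<lambda>s. \<omega> + \<omega> * w s - (\<omega> - \<omega> * pressed (x s) + \<omega> * w s)) has_integral (\<omega> * t + \<omega> * integral {0..t} w - ?D)) {0..t}"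
    by (intro has_integral_diff has_integral_add ic has_integral_mult_right iw ph)
  then have "((\<lambda>s. \<omega> * pressed (x s)) has_integral (\<omega> * t + \<omega> * integral {0..t} w - ?D)) {0..t}" by simp
  from has_integral_mult_right[OF this, of "1 / \<omega>"]
  have ip: "((\<lambda>s. pressed (x s)) has_integral (\<omega> * t + \<omega> * integral {0..t} w - ?D) / \<omega>) {0..t}"
    using assms(3) by simp
  then show "(\<lambda>s. pressed (x s)) integrable_on {0..t}" by blast
  show "?D = \<omega> * t - \<omega> * integral {0..t} (\<lambda>s. pressed (x s)) + \<omega> * integral {0..t} w"
    unfolding integral_unique[OF ip] using assms(3) by simp
qed

text \<open>The sign \<open>\<sigma>\<close> treats both resonances at once: 1 for a force bounded
  below by the linear one, -1 for a force bounded above. If the orbit does not rotate beyond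
  \<open>\<omega> * T\<close> in the direction of \<open>\<sigma>\<close>, the integral of
  \<open>\<sigma> * w\<close> is at most the contact time. Together with the pointwise lower bound
  from \<open>side\<close> this makes \<open>w\<close> small in the integral norm, and then phase
  and logarithmic energy are nearly those of the linear oscillator.\<close>

lemma slow_rotation_estimates:
  assumes \<omega>: "0 < \<omega>" and \<sigma>: "\<bar>\<sigma>\<bar> = 1" and K: "0 \<le> K"
    and side: "\<And>l t x. l \<in> {0..1} \<Longrightarrow> 0 \<le> x \<Longrightarrow> - K \<le> \<sigma> * (g l t x - \<omega>\<^sup>2 * x)"
  obtains C where "1 \<le> C" and "\<And>n l x v h \<rho>. penalized n l x v \<Longrightarrow> l \<in> {0..1} \<Longrightarrow> C \<le> \<rho> \<Longrightarrow>
      energy \<omega> n (x 0) (v 0) = \<rho>\<^sup>2 \<Longrightarrow> \<rho> ^ 4 \<le> n \<Longrightarrow>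
      continuous_on {0..T} h \<Longrightarrow> (\<And>t. t \<in> {0..T} \<Longrightarrow> exp (h t) = phase_point \<omega> n (x t) (v t)) \<Longrightarrow>
      \<sigma> * (Im (h T) / 2 - Im (h 0) / 2 - \<omega> * T) \<le> 0 \<Longrightarrow>
      (\<forall>t\<in>{0..T}. (\<rho> / C)\<^sup>2 \<le> energy \<omega> n (x t) (v t) \<and>
         \<bar>Im (h t) / 2 - Im (h 0) / 2 - \<omega> * t\<bar> \<le> C / \<rho> \<and>
         \<bar>ln (energy \<omega> n (x t) (v t)) - ln (\<rho>\<^sup>2)\<bar> \<le> C / sqrt \<rho> \<and>
         - (C / \<rho>) \<le> \<sigma> * (max (x t) 0 * dev \<omega> l t (x t) / energy \<omega> n (x t) (v t))) \<and>
      integral {0..T} (\<lambda>t. \<sigma> * (max (x t) 0 * dev \<omega> l t (x t) / energy \<omega> n (x t) (v t))) \<le> C / \<rho>\<^sup>2"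
proof -
  define a where "a = sqrt (2 * exp (rate \<omega> * T))"
  have "1 \<le> exp (rate \<omega> * T)" using rate_nonneg T by simp
  then have "1 \<le> 2 * exp (rate \<omega> * T)" by linarith
  then have a1: "1 \<le> a" unfolding a_def by (rule real_sqrt_ge_one)
  \<comment> \<open>\<open>P\<close> comes from \<open>pressed_time\<close>, \<open>K1\<close> from
    the lower bound on \<open>\<sigma> * w\<close>, \<open>K2\<close> from the integral of
    \<open>\<bar>w\<bar>\<close>, \<open>K3\<close> from the deviation divided by the energy,
    \<open>K4\<close> from the variation of the logarithmic energy; \<open>B'\<close> is the growth
    constant of the deviation.\<close>
  define P where "P = a ^ 3 * (6 * a + 3 * T * B * (1 + a / \<omega>))"
  define K1 where "K1 = K * a ^ 3 / \<omega>"
  define K2 where "K2 = P + 2 * T * K1"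
  define B' where "B' = B + \<omega>\<^sup>2"
  define K3 where "K3 = (B + B' * a / \<omega>) * a\<^sup>2"
  define K4 where "K4 = T + T * B * K3 + B' * K2"
  have P0: "0 \<le> P" using a1 T B \<omega> by (simp add: P_def)
  have K10: "0 \<le> K1" using a1 K \<omega> by (simp add: K1_def)
  have K20: "0 \<le> K2" using P0 K10 T by (simp add: K2_def)
  have B'0: "0 \<le> B'" using B by (simp add: B'_def)
  have K30: "0 \<le> K3" using B B'0 a1 \<omega> by (simp add: K3_def)
  have K40: "0 \<le> K4" using T B K30 B'0 K20 by (simp add: K4_def)
  define C where "C = a + \<omega> * (P + K2) + K4 + K1 + P"
  have Ca: "a \<le> C" "\<omega> * (P + K2) \<le> C" "K4 \<le> C" "K1 \<le> C" "P \<le> C"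
    using a1 \<omega> P0 K20 K40 K10 by (auto simp: C_def)
  show ?thesis
  proof (rule that[of C])
    show C1: "1 \<le> C" using Ca a1 by linarith
    fix n l x v h \<rho>
    assume pen: "penalized n l x v" and l: "l \<in> {0..1}" and \<rho>: "C \<le> \<rho>"
      and E0: "energy \<omega> n (x 0) (v 0) = \<rho>\<^sup>2" and n: "\<rho> ^ 4 \<le> n"
      and h: "continuous_on {0..T} h" "\<And>t. t \<in> {0..T} \<Longrightarrow> exp (h t) = phase_point \<omega> n (x t) (v t)"
      and slow: "\<sigma> * (Im (h T) / 2 - Im (h 0) / 2 - \<omega> * T) \<le> 0"
    let ?E = "\<lambda>t. energy \<omega> n (x t) (v t)"
    let ?d = "\<lambda>t. dev \<omega> l t (x t)"
    define w where "w = (\<lambda>t. max (x t) 0 * ?d t / ?E t)"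
    have \<rho>1: "1 \<le> \<rho>" "a \<le> \<rho>" using \<rho> C1 Ca by auto
    then have n0: "0 < n" using n by (intro less_le_trans[OF _ n]) auto
    \<comment> \<open>The reason for requiring \<open>\<rho> ^ 4 \<le> n\<close>: a contact time of
      order \<open>1 / sqrt n\<close> becomes one of order
      \<open>1 / \<rho>\<^sup>2\<close>.\<close>
    have sn: "\<rho>\<^sup>2 \<le> sqrt n" using n by (intro real_le_rsqrt) (simp add: power_mult[symmetric])
    note band = energy_band[OF pen l \<omega> less_imp_le[OF n0] a_def \<rho>1(2) E0]
    have Epos: "0 < ?E t" if "t \<in> {0..T}" for t
      using band(2)[OF that] \<rho>1 a1 by (rule_tac less_le_trans[of 0 "(\<rho> / a)\<^sup>2"]) auto
    have Einv: "1 / ?E t \<le> (a / \<rho>)\<^sup>2" if "t \<in> {0..T}" for t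
      using band(2)[OF that] Epos[OF that] \<rho>1 a1 by (simp add: field_simps power_divide)
    have TT: "T \<in> {0..T}" using T by simp
    have form: "continuous_on {0..T} w" "(\<lambda>s. pressed (x s)) integrable_on {0..t}"
      "Im (h t) / 2 - Im (h 0) / 2 = \<omega> * t - \<omega> * integral {0..t} (\<lambda>s. pressed (x s)) + \<omega> * integral {0..t} w"
      if "t \<in> {0..T}" for t
      unfolding w_def by (rule phase_formula[OF pen n0 \<omega> _ h(1) _ that]; use Epos h(2) in blast)+
    have cw: "continuous_on {0..T} w" using form(1)[OF TT] by simp
    note cont = penalized_continuous[OF pen]
    have xp: "max (x t) 0 \<le> a * \<rho> / \<omega>" if "t \<in> {0..T}" for t
      using component_bounds(2)[OF band(1)[OF that] \<omega> n0] \<rho>1 a1 by simp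
    define Q where "Q = integral {0..T} (\<lambda>t. pressed (x t))"
    have Q0: "0 \<le> Q" unfolding Q_def by (rule integral_nonneg[OF form(2)[OF TT]]) (simp add: pressed_def)
    have Q: "Q \<le> P / \<rho>\<^sup>2"
    proof -
      have "Q \<le> P / sqrt n"
        unfolding Q_def P_def by (rule pressed_time[OF pen l n0 \<omega> \<rho>1(1) a1 band form(2)[OF TT]])
      also have "\<dots> \<le> P / \<rho>\<^sup>2" using sn P0 \<rho>1 n0 by (intro divide_left_mono mult_pos_pos) auto
      finally show ?thesis .
    qed
    \<comment> \<open>The phase formula is solved for the integral of \<open>w\<close>; the
      hypothesis of slow rotation discards one term, and the contact time bounds the other.\<close>
    have int: "integral {0..T} (\<lambda>t. \<sigma> * w t) \<le> P / \<rho>\<^sup>2"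
    proof -
      have "\<omega> * (\<sigma> * integral {0..T} w) = \<sigma> * (Im (h T) / 2 - Im (h 0) / 2 - \<omega> * T) + \<omega> * (\<sigma> * Q)"
        unfolding Q_def form(3)[OF TT] by (simp add: algebra_simps)
      also have "\<dots> \<le> \<omega> * (\<sigma> * Q)" using slow by simp
      also have "\<dots> \<le> \<omega> * Q"
        using abs_ge_self[of "\<sigma> * Q"] \<sigma> Q0 \<omega> by (intro mult_left_mono) (auto simp: abs_mult)
      finally have "\<sigma> * integral {0..T} w \<le> Q" using \<omega> by simp
      then show ?thesis using Q integral_mult_right[of "{0..T}" \<sigma> w] by simp
    qed
    have low: "- (K1 / \<rho>) \<le> \<sigma> * w t" if t: "t \<in> {0..T}" for t
    proof -
      have "- K \<le> \<sigma> * ?d t"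
        using side[OF l, of "max (x t) 0" t] g_pos[of l t "x t"] by (simp add: dev_def)
      then have "max (x t) 0 / ?E t * (- K) \<le> max (x t) 0 / ?E t * (\<sigma> * ?d t)"
        using Epos[OF t] by (intro mult_left_mono) auto
      moreover have "max (x t) 0 * (1 / ?E t) \<le> a * \<rho> / \<omega> * (a / \<rho>)\<^sup>2"
        using xp[OF t] Einv[OF t] Epos[OF t] a1 \<rho>1 \<omega> by (intro mult_mono) auto
      then have "max (x t) 0 / ?E t * K \<le> a * \<rho> / \<omega> * (a / \<rho>)\<^sup>2 * K"
        using K by (intro mult_right_mono) auto
      moreover have "a * \<rho> / \<omega> * (a / \<rho>)\<^sup>2 * K = K1 / \<rho>"
        using \<rho>1 by (simp add: K1_def power2_eq_square power3_eq_cube field_simps)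
      ultimately show ?thesis by (simp add: w_def algebra_simps)
    qed
    have absw: "integral {0..T} (\<lambda>t. \<bar>w t\<bar>) \<le> K2 / \<rho>"
    proof -
      \<comment> \<open>An absolute value is the number plus twice its negative part, and the
        negative part of \<open>\<sigma> * w\<close> is at most \<open>K1 / \<rho>\<close>.\<close>
      have "\<bar>w t\<bar> \<le> \<sigma> * w t + 2 * K1 / \<rho>" if t: "t \<in> {0..T}" for t
        using low[OF t] \<sigma> K10 \<rho>1 by (cases "\<sigma> = 1") (auto simp: abs_if split: if_splits)
      then have "integral {0..T} (\<lambda>t. \<bar>w t\<bar>) \<le> integral {0..T} (\<lambda>t. \<sigma> * w t + 2 * K1 / \<rho>)"
        by (intro integral_le integrable_continuous_interval continuous_intros cw)
      also have "\<dots> = integral {0..T} (\<lambda>t. \<sigma> * w t) + integral {0..T} (\<lambda>t. 2 * K1 / \<rho>)"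
        by (intro integral_add integrable_continuous_interval continuous_intros cw)
      also have "integral {0..T} (\<lambda>t. 2 * K1 / \<rho>) = T * (2 * K1 / \<rho>)"
        using integral_const_real[of 0 T "2 * K1 / \<rho>"] T by simp
      also have "integral {0..T} (\<lambda>t. \<sigma> * w t) + T * (2 * K1 / \<rho>) \<le> P / \<rho>\<^sup>2 + T * (2 * K1 / \<rho>)"
        using int by (rule add_right_mono)
      also have "\<dots> \<le> P / \<rho> + T * (2 * K1 / \<rho>)"
        using P0 \<rho>1 by (intro add_right_mono divide_left_mono) (auto simp: power2_eq_square)
      finally show ?thesis by (simp add: K2_def add_divide_distrib mult.assoc mult.left_commute)
    qed
    have sub: "integral {0..t} f \<le> integral {0..T} f"
      if "t \<in> {0..T}" "f integrable_on {0..T}" "\<And>s. s \<in> {0..T} \<Longrightarrow> 0 \<le> f s" for t and f :: "real \<Rightarrow> real"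
      using that by (intro integral_subset_le integrable_on_subinterval[OF that(2)]) auto
    have iabsw: "integral {0..t} (\<lambda>t. \<bar>w t\<bar>) \<le> K2 / \<rho>" if "t \<in> {0..T}" for t
      using sub[OF that, of "\<lambda>t. \<bar>w t\<bar>"] absw cw
      by (auto intro!: integrable_continuous_interval continuous_intros intro: order_trans)
    have ph: "\<bar>Im (h t) / 2 - Im (h 0) / 2 - \<omega> * t\<bar> \<le> C / \<rho>" if t: "t \<in> {0..T}" for t
    proof -
      let ?q = "integral {0..t} (\<lambda>t. pressed (x t))"
      have q: "0 \<le> ?q" by (rule integral_nonneg[OF form(2)[OF t]]) (simp add: pressed_def)
      have "?q \<le> Q" unfolding Q_def by (rule sub[OF t form(2)[OF TT]]) (simp add: pressed_def)
      also have "\<dots> \<le> P / \<rho>"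
        using Q P0 \<rho>1 by (rule_tac order_trans[OF Q divide_left_mono]) (auto simp: power2_eq_square)
      finally have "\<bar>?q\<bar> \<le> P / \<rho>" using q by simp
      moreover have "\<bar>integral {0..t} w\<bar> \<le> integral {0..t} (\<lambda>t. \<bar>w t\<bar>)"
        unfolding real_norm_def[symmetric]
        by (rule integral_norm_bound_integral)
          (use t in \<open>auto intro!: integrable_continuous_interval continuous_intros continuous_on_subset[OF cw]\<close>)
      then have "\<bar>integral {0..t} w\<bar> \<le> K2 / \<rho>" using iabsw[OF t] by simp
      ultimately have "\<bar>- ?q + integral {0..t} w\<bar> \<le> (P + K2) / \<rho>" by (simp add: add_divide_distrib)
      then have "\<omega> * \<bar>- ?q + integral {0..t} w\<bar> \<le> \<omega> * ((P + K2) / \<rho>)" using \<omega> by (intro mult_left_mono) auto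
      also have "\<dots> \<le> C / \<rho>" using Ca(2) \<rho>1 by (simp add: divide_right_mono)
      also have "\<omega> * \<bar>- ?q + integral {0..t} w\<bar> = \<bar>\<omega> * (- ?q + integral {0..t} w)\<bar>" using \<omega> by (simp add: abs_mult)
      finally show ?thesis unfolding form(3)[OF t] by (simp add: algebra_simps)
    qed
    have en: "\<bar>ln (?E t) - ln (\<rho>\<^sup>2)\<bar> \<le> C / sqrt \<rho>" if t: "t \<in> {0..T}" for t
    proof -
      \<comment> \<open>Balances the terms of \<open>?k\<close>: one is \<open>\<epsilon>\<close>,
        the others are of order \<open>1 / (\<rho> * \<epsilon>)\<close>, the last of them after
        integration.\<close>
      define \<epsilon> where "\<epsilon> = 1 / sqrt \<rho>"
      have \<epsilon>: "0 < \<epsilon>" using \<rho>1 by (simp add: \<epsilon>_def)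
      let ?f = "\<lambda>s. - 2 * v s * ?d s / ?E s"
      let ?k = "\<lambda>s. \<epsilon> + (B * K3 / \<rho>) / \<epsilon> + B' / \<epsilon> * \<bar>w s\<bar>"
      have cf: "continuous_on {0..T} ?f"
        using Epos cont by (intro continuous_intros continuous_on_dev continuous_on_energy) fastforce+
      have "(?f has_integral ln (?E t) - ln (?E 0)) {0..t}"
      proof (rule fundamental_theorem_of_calculus)
        fix s assume s: "s \<in> {0..t}"
        then have s': "s \<in> {0..T}" using t by auto
        have "((\<lambda>s. ln (?E s)) has_real_derivative 1 / ?E s * (- 2 * v s * (g l s (x s) - \<omega>\<^sup>2 * max (x s) 0))) (at s within {0..T})"
          using Epos[OF s'] by (intro DERIV_ln_divide[THEN DERIV_chain2] energy_derivative[OF pen s'])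
        then show "((\<lambda>s. ln (?E s)) has_vector_derivative ?f s) (at s within {0..t})"
          unfolding has_real_derivative_iff_has_vector_derivative[symmetric]
          using t by (auto simp: dev_def intro: DERIV_subset)
      qed (use t in auto)
      from integral_unique[OF this]
      have "\<bar>ln (?E t) - ln (?E 0)\<bar> = \<bar>integral {0..t} ?f\<bar>" by (simp only:)
      also have "\<dots> \<le> integral {0..t} ?k"
      proof (rule integral_norm_bound_integral[where 'a = real, unfolded real_norm_def])
        show "?f integrable_on {0..t}"
          using t by (intro integrable_continuous_interval continuous_on_subset[OF cf]) auto
        show "?k integrable_on {0..t}"
          using t by (intro integrable_continuous_interval continuous_intros continuous_on_subset[OF cw]) auto
        fix s assume "s \<in> {0..t}"
        then have s: "s \<in> {0..T}" using t by auto
        have dd: "\<bar>?d s\<bar> \<le> B + B' * max (x s) 0"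
          using g_growth[OF l, of s "x s"] abs_triangle_ineq4[of "g l s (x s)" "\<omega>\<^sup>2 * max (x s) 0"]
          by (simp add: dev_def B'_def algebra_simps abs_mult)
        have "\<bar>?d s\<bar> * (1 / ?E s) \<le> (B + B' * (a * \<rho> / \<omega>)) * (a / \<rho>)\<^sup>2"
          using dd xp[OF s] Einv[OF s] Epos[OF s] B B'0 a1 \<rho>1 \<omega>
          by (intro mult_mono order_trans[OF dd] add_left_mono mult_left_mono) auto
        also have "\<dots> \<le> (B * \<rho> + B' * (a * \<rho> / \<omega>)) * (a / \<rho>)\<^sup>2"
          using B \<rho>1 mult_left_mono[of 1 \<rho> B] by (intro mult_right_mono) auto
        also have "\<dots> = K3 / \<rho>" using \<rho>1 by (simp add: K3_def power2_eq_square field_simps)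
        finally have dE: "\<bar>?d s\<bar> / ?E s \<le> K3 / \<rho>" by simp
        \<comment> \<open>One factor of the deviation is replaced by its linear growth bound, which
          turns the square into a term linear in \<open>\<bar>w\<bar>\<close>, whose integral is
          under control.\<close>
        have "(?d s)\<^sup>2 / ?E s = \<bar>?d s\<bar> / ?E s * \<bar>?d s\<bar>" by (simp add: power2_eq_square)
        also have "\<dots> \<le> \<bar>?d s\<bar> / ?E s * (B + B' * max (x s) 0)" using dd Epos[OF s] by (intro mult_left_mono) auto
        also have "\<dots> = B * (\<bar>?d s\<bar> / ?E s) + B' * \<bar>w s\<bar>" using Epos[OF s] by (simp add: w_def abs_mult algebra_simps add_divide_distrib)
        also have "\<dots> \<le> B * (K3 / \<rho>) + B' * \<bar>w s\<bar>" using dE B by (intro add_right_mono mult_left_mono) auto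
        finally have d2: "(?d s)\<^sup>2 / ?E s \<le> B * (K3 / \<rho>) + B' * \<bar>w s\<bar>" .
        have "2 * (\<epsilon> * \<bar>v s\<bar>) * \<bar>?d s\<bar> \<le> (\<epsilon> * \<bar>v s\<bar>)\<^sup>2 + \<bar>?d s\<bar>\<^sup>2" by (rule sum_squares_bound)
        also have "\<dots> = \<epsilon>\<^sup>2 * (v s)\<^sup>2 + (?d s)\<^sup>2" by (simp add: power_mult_distrib)
        also have "\<dots> \<le> \<epsilon>\<^sup>2 * ?E s + (?d s)\<^sup>2"
          using n0 by (intro add_right_mono mult_left_mono) (auto simp: energy_def)
        finally have "2 * (\<epsilon> * \<bar>v s\<bar>) * \<bar>?d s\<bar> / (\<epsilon> * ?E s) \<le> (\<epsilon>\<^sup>2 * ?E s + (?d s)\<^sup>2) / (\<epsilon> * ?E s)"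
          using \<epsilon> Epos[OF s] by (intro divide_right_mono) auto
        also have "\<dots> = \<epsilon> + (?d s)\<^sup>2 / ?E s / \<epsilon>"
          using \<epsilon> Epos[OF s] by (simp add: field_simps power2_eq_square)
        also have "\<dots> \<le> \<epsilon> + (B * (K3 / \<rho>) + B' * \<bar>w s\<bar>) / \<epsilon>"
          using d2 \<epsilon> by (intro add_left_mono divide_right_mono) auto
        also have "\<dots> = ?k s" by (simp add: add_divide_distrib)
        also have "2 * (\<epsilon> * \<bar>v s\<bar>) * \<bar>?d s\<bar> / (\<epsilon> * ?E s) = \<bar>?f s\<bar>"
          using \<epsilon> Epos[OF s] by (simp add: abs_mult)
        finally show "\<bar>?f s\<bar> \<le> ?k s" .
      qed
      also have "\<dots> = integral {0..t} (\<lambda>s. \<epsilon> + (B * K3 / \<rho>) / \<epsilon>) + integral {0..t} (\<lambda>s. B' / \<epsilon> * \<bar>w s\<bar>)"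
        using t by (intro integral_add integrable_continuous_interval continuous_intros continuous_on_subset[OF cw]) auto
      also have "\<dots> = t * (\<epsilon> + (B * K3 / \<rho>) / \<epsilon>) + B' / \<epsilon> * integral {0..t} (\<lambda>s. \<bar>w s\<bar>)"
        using t integral_mult_right[of "{0..t}" "B' / \<epsilon>" "\<lambda>s. \<bar>w s\<bar>"] by simp
      also have "\<dots> \<le> T * (\<epsilon> + (B * K3 / \<rho>) / \<epsilon>) + B' / \<epsilon> * (K2 / \<rho>)"
        using t iabsw[OF t] \<epsilon> B B'0 K30 \<rho>1 by (intro add_mono mult_right_mono mult_left_mono) auto
      also have "\<dots> = K4 / sqrt \<rho>"
      proof -
        have r: "1 / \<rho> / \<epsilon> = 1 / sqrt \<rho>" using \<rho>1 by (simp add: \<epsilon>_def real_sqrt_divide field_simps flip: real_sqrt_mult)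
        have "T * (\<epsilon> + (B * K3 / \<rho>) / \<epsilon>) + B' / \<epsilon> * (K2 / \<rho>) = T * \<epsilon> + (T * B * K3 + B' * K2) * (1 / \<rho> / \<epsilon>)"
          by (simp add: algebra_simps add_divide_distrib)
        then show ?thesis unfolding r by (simp add: K4_def \<epsilon>_def add_divide_distrib)
      qed
      also have "\<dots> \<le> C / sqrt \<rho>" using Ca(3) \<rho>1 by (intro divide_right_mono) auto
      finally show ?thesis unfolding E0 .
    qed
    have lowC: "- (C / \<rho>) \<le> \<sigma> * w t" if "t \<in> {0..T}" for t
    proof -
      have "K1 / \<rho> \<le> C / \<rho>" using Ca \<rho>1 by (intro divide_right_mono) auto
      then show ?thesis using low[OF that] by linarith
    qed
    have EC: "(\<rho> / C)\<^sup>2 \<le> ?E t" if "t \<in> {0..T}" for t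
    proof -
      have "\<rho> / C \<le> \<rho> / a" using Ca a1 C1 \<rho>1 by (intro divide_left_mono) auto
      then have "(\<rho> / C)\<^sup>2 \<le> (\<rho> / a)\<^sup>2" using C1 \<rho>1 by (intro power_mono) auto
      then show ?thesis using band(2)[OF that] by linarith
    qed
    have intC: "integral {0..T} (\<lambda>t. \<sigma> * w t) \<le> C / \<rho>\<^sup>2"
    proof -
      have "P / \<rho>\<^sup>2 \<le> C / \<rho>\<^sup>2" using Ca by (intro divide_right_mono) auto
      then show ?thesis using int by linarith
    qed
    show "(\<forall>t\<in>{0..T}. (\<rho> / C)\<^sup>2 \<le> ?E t \<and> \<bar>Im (h t) / 2 - Im (h 0) / 2 - \<omega> * t\<bar> \<le> C / \<rho> \<and>
         \<bar>ln (?E t) - ln (\<rho>\<^sup>2)\<bar> \<le> C / sqrt \<rho> \<and> - (C / \<rho>) \<le> \<sigma> * (max (x t) 0 * ?d t / ?E t)) \<and>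
      integral {0..T} (\<lambda>t. \<sigma> * (max (x t) 0 * ?d t / ?E t)) \<le> C / \<rho>\<^sup>2"
      using ph en lowC EC intC unfolding w_def by blast
  qed
qed

end

section \<open>Large solutions and the Landesman-Lazer conditions\<close>

text \<open>Fatou's lemma for the nonnegative functions \<open>F m + K\<close>. The integral of
  \<open>H\<close> is compared with that of the measurable \<open>L\<close> by monotonicity of the
  nonnegative integral, for the positive and the negative part separately, so that \<open>H\<close>
  itself may be an arbitrary function below the lower limit.\<close>

lemma ereal_set_integral_nonpos:
  fixes F :: "nat \<Rightarrow> real \<Rightarrow> real" and H :: "real \<Rightarrow> ereal"
  assumes T: "0 \<le> T" and K: "0 \<le> K"
    and cont: "\<And>m. continuous_on {0..T} (F m)"
    and lower: "\<And>m t. t \<in> {0..T} \<Longrightarrow> - K \<le> F m t"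
    and int: "\<And>m. integral {0..T} (F m) \<le> e m" "e \<longlonglongrightarrow> 0"
    and H: "\<And>t. t \<in> {0..T} \<Longrightarrow> H t \<le> liminf (\<lambda>m. ereal (F m t))"
  shows "ereal_set_integral lborel {0..T} H \<le> 0"
proof -
  let ?A = "{0..T}"
  define G where "G m t = indicator ?A t *\<^sub>R F m t" for m t
  define L where "L t = liminf (\<lambda>m. ereal (G m t))" for t
  define u where "u m t = ennreal (indicator ?A t *\<^sub>R (F m t + K))" for m t
  have Gm[measurable]: "G m \<in> borel_measurable borel" for m
    unfolding G_def[abs_def] by (rule borel_measurable_continuous_on_indicator[OF _ cont]) auto
  have Lm[measurable]: "L \<in> borel_measurable borel" unfolding L_def[abs_def] by measurable
  have um[measurable]: "u m \<in> borel_measurable borel" for m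
    unfolding u_def[abs_def]
    by (intro measurable_compose[OF borel_measurable_continuous_on_indicator measurable_ennreal] continuous_intros cont) auto
  have HL: "H t \<le> L t" if "t \<in> ?A" for t using H[OF that] that by (simp add: L_def G_def)
  have LK: "- ereal K \<le> L t" if "t \<in> ?A" for t
    unfolding L_def using lower[OF that] that
    by (intro Liminf_bounded always_eventually) (auto simp: G_def)
  have u: "integral\<^sup>N lborel (u m) \<le> ennreal (e m + K * T)" for m
  proof -
    have "((\<lambda>t. F m t + K) has_integral integral ?A (F m) + K * T) ?A"
      using T cont[of m] has_integral_const_real[of K 0 T]
      by (intro has_integral_add integrable_integral integrable_continuous_interval) (auto simp: mult.commute)
    moreover have "(\<lambda>t. indicator ?A t *\<^sub>R (F m t + K)) = (\<lambda>t. if t \<in> ?A then F m t + K else 0)"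
      by (auto simp: fun_eq_iff indicator_def)
    ultimately have "((\<lambda>t. indicator ?A t *\<^sub>R (F m t + K)) has_integral integral ?A (F m) + K * T) UNIV"
      by (simp only: has_integral_restrict_UNIV)
    moreover have "0 \<le> indicator ?A t *\<^sub>R (F m t + K)" for t
      using lower[of t m] by (cases "t \<in> ?A") auto
    ultimately have "integral\<^sup>N lborel (u m) = ennreal (integral ?A (F m) + K * T)"
      unfolding u_def
      by (intro nn_integral_has_integral_lborel borel_measurable_continuous_on_indicator continuous_intros cont) auto
    also have "\<dots> \<le> ennreal (e m + K * T)" using int(1)[of m] by (intro ennreal_leI) simp
    finally show ?thesis .
  qed
  have "(\<integral>\<^sup>+ t. liminf (\<lambda>m. u m t) \<partial>lborel) \<le> liminf (\<lambda>m. integral\<^sup>N lborel (u m))"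
    by (rule nn_integral_liminf) simp
  also have "\<dots> \<le> liminf (\<lambda>m. ennreal (e m + K * T))"
    by (intro Liminf_mono always_eventually allI u)
  also have "\<dots> = ennreal (0 + K * T)"
    by (intro lim_imp_Liminf tendsto_ennrealI tendsto_intros int) simp
  finally have fatou: "(\<integral>\<^sup>+ t. liminf (\<lambda>m. u m t) \<partial>lborel) \<le> ennreal (K * T)" by simp
  define P where "P = (\<integral>\<^sup>+t\<in>?A. e2ennreal (L t) \<partial>lborel)"
  define M where "M = (\<integral>\<^sup>+t\<in>?A. e2ennreal (- L t) \<partial>lborel)"
  \<comment> \<open>The identity between \<open>L + K\<close>, \<open>K\<close> and the two parts of
    \<open>L\<close>, written as an equation of sums: both sides can be integrated with no
    subtraction of infinite values.\<close>
  have pw: "e2ennreal (L t) * indicator ?A t + ennreal K * indicator ?A t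
      = liminf (\<lambda>m. u m t) + e2ennreal (- L t) * indicator ?A t" for t
  proof (cases "t \<in> ?A")
    case True
    have "liminf (\<lambda>m. u m t) = liminf (\<lambda>m. e2ennreal (ereal K + ereal (G m t)))"
      using True by (simp add: u_def G_def add.commute)
    also have "\<dots> = e2ennreal (liminf (\<lambda>m. ereal K + ereal (G m t)))"
      by (rule Liminf_compose_continuous_mono)
        (auto simp: mono_def intro: e2ennreal_mono continuous_on_e2ennreal)
    also have "liminf (\<lambda>m. ereal K + ereal (G m t)) = ereal K + L t"
      unfolding L_def by (rule Liminf_add_ereal_left) auto
    finally have "liminf (\<lambda>m. u m t) = e2ennreal (ereal K + L t)" .
    moreover have "e2ennreal (L t) + ennreal K = e2ennreal (ereal K + L t) + e2ennreal (- L t)"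
    proof (cases "L t")
      case (real r)
      then have "- K \<le> r" using LK[OF True] by simp
      then show ?thesis using K real
        by (cases "0 \<le> r") (auto simp: ennreal_neg ennreal_plus[symmetric] add.commute simp del: ennreal_plus)
    next
      case PInf then show ?thesis by simp
    next
      case MInf then show ?thesis using LK[OF True] by simp
    qed
    ultimately show ?thesis using True by simp
  qed (simp add: u_def Liminf_const)
  have "P + ennreal (K * T) = (\<integral>\<^sup>+t. e2ennreal (L t) * indicator ?A t + ennreal K * indicator ?A t \<partial>lborel)"
    unfolding P_def using T K by (subst nn_integral_add) (auto simp: nn_integral_cmult ennreal_mult)
  also have "\<dots> = (\<integral>\<^sup>+ t. liminf (\<lambda>m. u m t) \<partial>lborel) + M"
    unfolding pw M_def by (subst nn_integral_add) auto
  also have "\<dots> \<le> ennreal (K * T) + M" using fatou by (rule add_right_mono)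
  finally have PM: "P \<le> M" by (simp add: add.commute[of P])
  have P1: "(\<integral>\<^sup>+t\<in>?A. e2ennreal (H t) \<partial>lborel) \<le> P"
    unfolding P_def using HL by (intro nn_integral_mono) (auto simp: indicator_def intro: e2ennreal_mono)
  have M1: "M \<le> (\<integral>\<^sup>+t\<in>?A. e2ennreal (- H t) \<partial>lborel)"
    unfolding M_def using HL by (intro nn_integral_mono) (auto simp: indicator_def intro!: e2ennreal_mono)
  \<comment> \<open>Finiteness of \<open>M\<close>, from \<open>L \<ge> - K\<close>, rules out a
    difference of two infinities at the end.\<close>
  have "M \<le> (\<integral>\<^sup>+t. ennreal K * indicator ?A t \<partial>lborel)"
    unfolding M_def
  proof (intro nn_integral_mono)
    fix t
    have "e2ennreal (- L t) \<le> e2ennreal (ereal K)" if "t \<in> ?A"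
      using LK[OF that] by (intro e2ennreal_mono) (metis ereal_minus_le_minus ereal_uminus_uminus)
    then show "e2ennreal (- L t) * indicator ?A t \<le> ennreal K * indicator ?A t"
      by (auto simp: indicator_def)
  qed
  also have "\<dots> < \<infinity>" using T K by (simp add: nn_integral_cmult ennreal_mult_less_top)
  finally have fin: "M < \<infinity>" .
  have "enn2ereal (\<integral>\<^sup>+t\<in>?A. e2ennreal (H t) \<partial>lborel) \<le> enn2ereal M"
    using P1 PM by (simp add: less_eq_ennreal.rep_eq[symmetric])
  moreover have "enn2ereal M \<le> enn2ereal (\<integral>\<^sup>+t\<in>?A. e2ennreal (- H t) \<partial>lborel)"
    using M1 by (simp add: less_eq_ennreal.rep_eq[symmetric])
  moreover have "\<bar>enn2ereal M\<bar> \<noteq> \<infinity>" using fin by (cases M) auto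
  ultimately show ?thesis
    unfolding ereal_set_integral_def
    by (cases "enn2ereal M"; cases "enn2ereal (\<integral>\<^sup>+t\<in>?A. e2ennreal (H t) \<partial>lborel)";
        cases "enn2ereal (\<integral>\<^sup>+t\<in>?A. e2ennreal (- H t) \<partial>lborel)") auto
qed

lemma abs_sin_minus_pi_int: "\<bar>sin (x - pi * of_int k)\<bar> = \<bar>sin x\<bar>"
proof -
  have s: "sin (pi * of_int k) = 0" using sin_times_pi_eq_0[of "of_int k"] by (simp add: mult.commute)
  then have "(cos (pi * of_int k))\<^sup>2 = 1" using sin_cos_squared_add[of "pi * of_int k"] by simp
  then have "\<bar>cos (pi * of_int k)\<bar> = 1" by (metis abs_one one_power2 power2_eq_iff abs_minus_cancel)
  then show ?thesis by (simp add: sin_diff s abs_mult)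
qed


context impact
begin

text \<open>Otherwise there are orbits of amplitude \<open>\<rho> m\<close> tending to infinity that
  rotate too slowly. Their initial phases converge modulo \<pi> to some \<open>\<phi>\<close>, their
  rescaled positions to \<open>\<bar>sin (\<phi> + \<omega> * t)\<bar>\<close>, and Fatou's lemma
  yields a nonpositive integral, contrary to \<open>LL\<close>. \<open>F\<close> is the force
  without the angular momentum, which fades at infinity by \<open>lim\<close>.\<close>

lemma winding_estimate:
  assumes \<omega>: "0 < \<omega>" and \<sigma>: "\<bar>\<sigma>\<bar> = 1" and K: "0 \<le> K"
    and side: "\<And>l t x. l \<in> {0..1} \<Longrightarrow> 0 \<le> x \<Longrightarrow> - K \<le> \<sigma> * (g l t x - \<omega>\<^sup>2 * x)"
    and lim: "\<And>t e. 0 < e \<Longrightarrow> \<forall>\<^sub>F x in at_top. \<forall>l\<in>{0..1}. \<bar>g l t x - F t x\<bar> \<le> e"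
    and LL: "\<And>\<phi>. \<phi> \<in> {0..pi} \<Longrightarrow> 0 < ereal_set_integral lborel {0..T}
      (\<lambda>t. Liminf at_top (\<lambda>x. ereal (\<sigma> * (F t x - \<omega>\<^sup>2 * x))) * ereal \<bar>sin (\<phi> + \<omega> * t)\<bar>)"
  obtains r where "1 \<le> r" and "\<And>n l x v h \<rho>. penalized n l x v \<Longrightarrow> l \<in> {0..1} \<Longrightarrow> r \<le> \<rho> \<Longrightarrow>
      energy \<omega> n (x 0) (v 0) = \<rho>\<^sup>2 \<Longrightarrow> \<rho> ^ 4 \<le> n \<Longrightarrow>
      continuous_on {0..T} h \<Longrightarrow> (\<And>t. t \<in> {0..T} \<Longrightarrow> exp (h t) = phase_point \<omega> n (x t) (v t)) \<Longrightarrow>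
      0 < \<sigma> * (Im (h T) / 2 - Im (h 0) / 2 - \<omega> * T)"
proof -
  define Good where "Good \<rho> \<longleftrightarrow> (\<forall>n l x v h. penalized n l x v \<longrightarrow> l \<in> {0..1} \<longrightarrow>
      energy \<omega> n (x 0) (v 0) = \<rho>\<^sup>2 \<longrightarrow> \<rho> ^ 4 \<le> n \<longrightarrow>
      continuous_on {0..T} h \<longrightarrow> (\<forall>t\<in>{0..T}. exp (h t) = phase_point \<omega> n (x t) (v t)) \<longrightarrow>
      0 < \<sigma> * (Im (h T) / 2 - Im (h 0) / 2 - \<omega> * T))" for \<rho>
  have "\<exists>r\<ge>1. \<forall>\<rho>\<ge>r. Good \<rho>"
  proof (rule ccontr)
    assume no: "\<not> (\<exists>r\<ge>1. \<forall>\<rho>\<ge>r. Good \<rho>)"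
    obtain C where C1: "1 \<le> C" and est: "\<And>n l x v h \<rho>. penalized n l x v \<Longrightarrow> l \<in> {0..1} \<Longrightarrow> C \<le> \<rho> \<Longrightarrow>
        energy \<omega> n (x 0) (v 0) = \<rho>\<^sup>2 \<Longrightarrow> \<rho> ^ 4 \<le> n \<Longrightarrow>
        continuous_on {0..T} h \<Longrightarrow> (\<And>t. t \<in> {0..T} \<Longrightarrow> exp (h t) = phase_point \<omega> n (x t) (v t)) \<Longrightarrow>
        \<sigma> * (Im (h T) / 2 - Im (h 0) / 2 - \<omega> * T) \<le> 0 \<Longrightarrow>
        (\<forall>t\<in>{0..T}. (\<rho> / C)\<^sup>2 \<le> energy \<omega> n (x t) (v t) \<and>
           \<bar>Im (h t) / 2 - Im (h 0) / 2 - \<omega> * t\<bar> \<le> C / \<rho> \<and>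
           \<bar>ln (energy \<omega> n (x t) (v t)) - ln (\<rho>\<^sup>2)\<bar> \<le> C / sqrt \<rho> \<and>
           - (C / \<rho>) \<le> \<sigma> * (max (x t) 0 * dev \<omega> l t (x t) / energy \<omega> n (x t) (v t))) \<and>
        integral {0..T} (\<lambda>t. \<sigma> * (max (x t) 0 * dev \<omega> l t (x t) / energy \<omega> n (x t) (v t))) \<le> C / \<rho>\<^sup>2"
      using slow_rotation_estimates[OF \<omega> \<sigma> K side] by blast
    have "\<exists>\<rho> n l x v h. C + real m \<le> \<rho> \<and> penalized n l x v \<and> l \<in> {0..1} \<and>
      energy \<omega> n (x 0) (v 0) = \<rho>\<^sup>2 \<and> \<rho> ^ 4 \<le> n \<and>
      continuous_on {0..T} h \<and> (\<forall>t\<in>{0..T}. exp (h t) = phase_point \<omega> n (x t) (v t)) \<and>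
      \<sigma> * (Im (h T) / 2 - Im (h 0) / 2 - \<omega> * T) \<le> 0" for m
    proof -
      have "1 \<le> C + real m" using C1 by simp
      then obtain \<rho> where "C + real m \<le> \<rho>" "\<not> Good \<rho>" using no by blast
      then show ?thesis unfolding Good_def not_less[symmetric] by blast
    qed
    then obtain \<rho>' n' l' x' v' h' where seq: "\<And>m. C + real m \<le> \<rho>' m" "\<And>m. penalized (n' m) (l' m) (x' m) (v' m)"
        "\<And>m. l' m \<in> {0..1}" "\<And>m. energy \<omega> (n' m) (x' m 0) (v' m 0) = (\<rho>' m)\<^sup>2" "\<And>m. \<rho>' m ^ 4 \<le> n' m"
        "\<And>m. continuous_on {0..T} (h' m)" "\<And>m t. t \<in> {0..T} \<Longrightarrow> exp (h' m t) = phase_point \<omega> (n' m) (x' m t) (v' m t)"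
        "\<And>m. \<sigma> * (Im (h' m T) / 2 - Im (h' m 0) / 2 - \<omega> * T) \<le> 0"
      by metis
    \<comment> \<open>Reduces half the initial argument to the compact interval
      \<open>{0..pi}\<close>; subtracting multiples of \<pi> does not affect the absolute
      sine.\<close>
    define k' where "k' m = \<lfloor>Im (h' m 0) / 2 / pi\<rfloor>" for m
    define p' where "p' m = Im (h' m 0) / 2 - pi * of_int (k' m)" for m
    have p': "p' m \<in> {0..pi}" for m
    proof -
      have "of_int (k' m) \<le> Im (h' m 0) / 2 / pi" "Im (h' m 0) / 2 / pi \<le> of_int (k' m) + 1"
        unfolding k'_def by linarith+
      then show ?thesis by (simp add: p'_def field_simps)
    qed
    obtain \<phi> r where \<phi>: "\<phi> \<in> {0..pi}" and r: "strict_mono (r :: nat \<Rightarrow> nat)" and limp: "(p' \<circ> r) \<longlonglongrightarrow> \<phi>"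
      using compact_Icc[of 0 pi] p' unfolding compact_def by metis
    define \<rho> n l x v h where defs: "\<rho> m = \<rho>' (r m)" "n m = n' (r m)" "l m = l' (r m)" "x m = x' (r m)"
      "v m = v' (r m)" "h m = h' (r m)" for m
    define E where "E m t = energy \<omega> (n m) (x m t) (v m t)" for m t
    define d where "d m t = dev \<omega> (l m) t (x m t)" for m t
    define w where "w m t = max (x m t) 0 * d m t / E m t" for m t
    have \<rho>m: "C + real m \<le> \<rho> m" for m
      using seq(1)[of "r m"] seq_suble[OF r, of m] by (simp add: defs)
    have \<rho>1: "1 \<le> \<rho> m" for m using \<rho>m[of m] C1 by linarith
    have n0: "0 < n m" for m
      using seq(5)[of "r m"] \<rho>1[of m] unfolding defs by (rule_tac less_le_trans[rotated]) auto
    note pen = seq(2)[of "r m" for m, folded defs]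
    have l: "l m \<in> {0..1}" for m using seq(3) by (simp add: defs)
    have est: "(\<forall>t\<in>{0..T}. (\<rho> m / C)\<^sup>2 \<le> E m t \<and>
           \<bar>Im (h m t) / 2 - Im (h m 0) / 2 - \<omega> * t\<bar> \<le> C / \<rho> m \<and>
           \<bar>ln (E m t) - ln ((\<rho> m)\<^sup>2)\<bar> \<le> C / sqrt (\<rho> m) \<and>
           - (C / \<rho> m) \<le> \<sigma> * w m t) \<and> integral {0..T} (\<lambda>t. \<sigma> * w m t) \<le> C / (\<rho> m)\<^sup>2" for m
      unfolding E_def w_def d_def
      by (rule est[of "n m" "l m" "x m" "v m" "\<rho> m" "h m"])
        (use seq(1-6,8)[of "r m"] seq(7) l[of m] \<rho>m[of m] in \<open>auto simp: defs\<close>)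
    have Epos: "0 < E m t" if "t \<in> {0..T}" for m t
      using est[of m] that \<rho>1[of m] C1 by (rule_tac less_le_trans[of 0 "(\<rho> m / C)\<^sup>2"]) auto
    have \<rho>inf: "filterlim \<rho> at_top sequentially"
    proof (rule filterlim_at_top_mono[OF filterlim_real_sequentially], intro always_eventually allI)
      show "real m \<le> \<rho> m" for m using \<rho>m[of m] C1 by linarith
    qed
    have C\<rho>: "(\<lambda>m. C / \<rho> m) \<longlonglongrightarrow> 0" 
      by (rule tendsto_divide_0[OF tendsto_const filterlim_at_top_imp_at_infinity[OF \<rho>inf]])
    have Cs\<rho>: "(\<lambda>m. C / sqrt (\<rho> m)) \<longlonglongrightarrow> 0"
      by (rule tendsto_divide_0[OF tendsto_const filterlim_at_top_imp_at_infinity[OF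
            filterlim_compose[OF sqrt_at_top \<rho>inf]]])
    \<comment> \<open>Since the energy is asymptotic to the square of \<open>\<rho> m\<close>, this
      behaves like \<open>\<omega> * max (x m t) 0 / \<rho> m\<close>. Dividing by the energy makes
      \<open>S\<close> below factor exactly into \<open>q\<close> and the deviation.\<close>
    define q where "q m t = \<omega> * \<rho> m * max (x m t) 0 / E m t" for m t
    have q0: "0 \<le> q m t" if "t \<in> {0..T}" for m t
      using \<omega> \<rho>1[of m] Epos[OF that, of m] by (simp add: q_def)
    have q_lim: "(\<lambda>m. q m t) \<longlonglongrightarrow> \<bar>sin (\<phi> + \<omega> * t)\<bar>" if t: "t \<in> {0..T}" for t
    proof -
      have q_eq: "q m t = \<bar>sin (Im (h m t) / 2 - pi * of_int (k' (r m)))\<bar> * exp ((ln ((\<rho> m)\<^sup>2) - ln (E m t)) / 2)" for m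
      proof -
        let ?y = "exp ((ln ((\<rho> m)\<^sup>2) - ln (E m t)) / 2)"
        have "?y\<^sup>2 = exp (ln ((\<rho> m)\<^sup>2) - ln (E m t))" by (simp add: exp_double[symmetric])
        also have "\<dots> = (\<rho> m)\<^sup>2 / E m t" using \<rho>1[of m] Epos[OF t, of m] by (simp add: exp_diff)
        finally have y: "?y\<^sup>2 = (\<rho> m)\<^sup>2 / E m t" .
        have sE: "(sin (Im (h m t) / 2))\<^sup>2 * E m t = \<omega>\<^sup>2 * (max (x m t) 0)\<^sup>2"
          unfolding E_def by (rule phase_sin) (use seq(7)[OF t, of "r m"] n0[of m] in \<open>auto simp: defs\<close>)
        have "(q m t)\<^sup>2 = \<omega>\<^sup>2 * (max (x m t) 0)\<^sup>2 / E m t * ((\<rho> m)\<^sup>2 / E m t)"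
          by (simp add: q_def power_mult_distrib power_divide power2_eq_square)
        also have "\<omega>\<^sup>2 * (max (x m t) 0)\<^sup>2 / E m t = (sin (Im (h m t) / 2))\<^sup>2"
          using sE Epos[OF t, of m] by (simp add: field_simps)
        finally have "(q m t)\<^sup>2 = (\<bar>sin (Im (h m t) / 2)\<bar> * ?y)\<^sup>2" by (simp add: power_mult_distrib y)
        then show ?thesis
          unfolding abs_sin_minus_pi_int using q0[OF t, of m]
          by (rule_tac power2_eq_imp_eq) auto
      qed
      have "(\<lambda>m. Im (h m t) / 2 - Im (h m 0) / 2 - \<omega> * t) \<longlonglongrightarrow> 0"
        by (rule Lim_null_comparison[OF _ C\<rho>]) (use est t in \<open>auto intro!: always_eventually\<close>)
      from tendsto_add[OF this tendsto_add[OF limp tendsto_const[of "\<omega> * t"]]]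
      have "(\<lambda>m. Im (h m t) / 2 - pi * of_int (k' (r m))) \<longlonglongrightarrow> \<phi> + \<omega> * t"
        by (simp add: p'_def defs o_def)
      moreover have "(\<lambda>m. ln (E m t) - ln ((\<rho> m)\<^sup>2)) \<longlonglongrightarrow> 0"
        by (rule Lim_null_comparison[OF _ Cs\<rho>]) (use est t in \<open>auto intro!: always_eventually\<close>)
      then have "(\<lambda>m. ln ((\<rho> m)\<^sup>2) - ln (E m t)) \<longlonglongrightarrow> 0"
        using tendsto_minus_cancel_left[of _ 0] by fastforce
      ultimately have "(\<lambda>m. q m t) \<longlonglongrightarrow> \<bar>sin (\<phi> + \<omega> * t)\<bar> * exp (0 / 2)"
        unfolding q_eq by (intro tendsto_intros) auto
      then show ?thesis by simp
    qed
    \<comment> \<open>The rescaling by \<open>\<rho> m\<close> brings the integrand to order one;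
      its integral is still at most of order \<open>1 / \<rho> m\<close>.\<close>
    define S where "S m t = \<omega> * \<rho> m * (\<sigma> * w m t)" for m t
    have S_q: "S m t = q m t * (\<sigma> * d m t)" for m t by (simp add: S_def q_def w_def)
    have dK: "- K \<le> \<sigma> * d m t" for m t
      using side[OF l, of "max (x m t) 0" m t] g_pos[of "l m" t "x m t"] by (simp add: d_def dev_def)
    define Lm where "Lm t = Liminf at_top (\<lambda>x. ereal (\<sigma> * (F t x - \<omega>\<^sup>2 * x)))" for t
    have "ereal_set_integral lborel {0..T} (\<lambda>t. Lm t * ereal \<bar>sin (\<phi> + \<omega> * t)\<bar>) \<le> 0"
    proof (rule ereal_set_integral_nonpos[where F = S and K = "\<omega> * C" and e = "\<lambda>m. \<omega> * (C / \<rho> m)"])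
      show "continuous_on {0..T} (S m)" for m
      proof -
        note c = penalized_continuous[OF pen, of m]
        have "continuous_on {0..T} (w m)"
          unfolding w_def[abs_def] d_def E_def using Epos[of _ m] c
          by (intro continuous_intros continuous_on_dev continuous_on_energy) (fastforce simp: E_def)+
        then show ?thesis unfolding S_def[abs_def] by (intro continuous_intros)
      qed
      show "- (\<omega> * C) \<le> S m t" if t: "t \<in> {0..T}" for m t
      proof -
        have "\<omega> * \<rho> m * (- (C / \<rho> m)) \<le> S m t"
          unfolding S_def using est[of m] t \<omega> \<rho>1[of m] by (intro mult_left_mono) auto
        then show ?thesis using \<rho>1[of m] by (cases "\<rho> m = 0") auto
      qed
      show "integral {0..T} (S m) \<le> \<omega> * (C / \<rho> m)" for m
      proof -
        have "integral {0..T} (S m) = \<omega> * \<rho> m * integral {0..T} (\<lambda>t. \<sigma> * w m t)"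
          unfolding S_def[abs_def] by (rule integral_mult_right)
        also have "\<dots> \<le> \<omega> * \<rho> m * (C / (\<rho> m)\<^sup>2)"
          using est[of m] \<omega> \<rho>1[of m] by (intro mult_left_mono) auto
        also have "\<dots> = \<omega> * (C / \<rho> m)" using \<rho>1[of m] by (simp add: power2_eq_square)
        finally show ?thesis .
      qed
      show "(\<lambda>m. \<omega> * (C / \<rho> m)) \<longlonglongrightarrow> 0" using tendsto_mult_right_zero[OF C\<rho>] .
      fix t assume t: "t \<in> {0..T}"
      define s where "s = \<bar>sin (\<phi> + \<omega> * t)\<bar>"
      note ql = q_lim[OF t, folded s_def]
      show "Lm t * ereal s \<le> liminf (\<lambda>m. ereal (S m t))"
      proof (cases "s = 0")
        case True
        \<comment> \<open>At a zero of the limiting sine the positions need not tend to infinity.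
          The bound \<open>dK\<close> suffices, as the left side is 0 in \<open>ereal\<close> even
          where \<open>Lm t\<close> is infinite.\<close>
        have "(\<lambda>m. q m t * (- K)) \<longlonglongrightarrow> s * (- K)" by (intro tendsto_intros ql)
        then have "liminf (\<lambda>m. ereal (q m t * (- K))) = ereal (s * (- K))"
          by (intro lim_imp_Liminf) auto
        moreover have "liminf (\<lambda>m. ereal (q m t * (- K))) \<le> liminf (\<lambda>m. ereal (S m t))"
          unfolding S_q using q0[OF t] dK
          by (intro Liminf_mono always_eventually allI ereal_less_eq(3)[THEN iffD2] mult_left_mono)
        ultimately show ?thesis using True by (simp add: zero_ereal_def[symmetric])
      next
        case False
        then have s: "0 < s" by (simp add: s_def)
        show ?thesis
        \<comment> \<open>\<open>Lm t\<close> may be infinite, so the inequality is tested against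
          every smaller value.\<close>
        proof (rule dense_le)
          fix y' assume y': "y' < Lm t * ereal s"
          show "y' \<le> liminf (\<lambda>m. ereal (S m t))"
          proof (cases y')
            case PInf then show ?thesis using y' by simp
          next
            case MInf then show ?thesis by simp
          next
            case (real y)
            have "ereal (y / s) < Lm t"
              using y' s real by (cases "Lm t") (auto simp: field_simps)
            then obtain c where c: "ereal (y / s) < ereal c" "ereal c < Lm t"
              using ereal_dense2 by blast
            \<comment> \<open>Half of the gap: it pays for replacing \<open>F\<close> by
              \<open>g\<close> and still leaves \<open>s * (c - e)\<close> above
              \<open>y\<close>.\<close>
            define e where "e = (c - y / s) / 2"
            have e: "0 < e" "y < s * (c - e)"
              using c s by (auto simp: e_def field_simps)
            have "\<forall>\<^sub>F x in at_top. ereal c < ereal (\<sigma> * (F t x - \<omega>\<^sup>2 * x))"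
              using less_LiminfD c(2) unfolding Lm_def by blast
            then have ev: "\<forall>\<^sub>F x in at_top. \<forall>l\<in>{0..1}. c - e \<le> \<sigma> * (g l t x - \<omega>\<^sup>2 * x)"
              using lim[OF e(1), of t]
            proof eventually_elim
              case (elim x)
              show ?case
              proof
                fix l :: real assume "l \<in> {0..1}"
                then have "\<bar>\<sigma> * (g l t x - F t x)\<bar> \<le> e" using elim(2) \<sigma> by (simp add: abs_mult)
                then show "c - e \<le> \<sigma> * (g l t x - \<omega>\<^sup>2 * x)" using elim(1) by (simp add: algebra_simps abs_le_iff)
              qed
            qed
            \<comment> \<open>Where the limiting sine is positive, the position exceeds a multiple
              of \<open>q m t * \<rho> m\<close>, by the lower energy bound, and therefore tends to
              infinity.\<close>
            have xinf: "filterlim (\<lambda>m. max (x m t) 0) at_top sequentially"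
            proof (rule filterlim_at_top_mono)
              have "filterlim (\<lambda>m. q m t * \<rho> m) at_top sequentially"
                by (rule filterlim_tendsto_pos_mult_at_top[OF ql s \<rho>inf])
              then show "filterlim (\<lambda>m. 1 / (\<omega> * C\<^sup>2) * (q m t * \<rho> m)) at_top sequentially"
                using \<omega> C1 by (intro filterlim_tendsto_pos_mult_at_top[OF tendsto_const]) auto
              show "\<forall>\<^sub>F m in sequentially. 1 / (\<omega> * C\<^sup>2) * (q m t * \<rho> m) \<le> max (x m t) 0"
              proof (intro always_eventually allI)
                fix m
                have "(\<rho> m / C)\<^sup>2 \<le> E m t" using est[of m] t by blast
                then have "(\<rho> m)\<^sup>2 / (C\<^sup>2 * E m t) \<le> 1" using Epos[OF t, of m] C1 by (simp add: power_divide field_simps)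
                then have "max (x m t) 0 * ((\<rho> m)\<^sup>2 / (C\<^sup>2 * E m t)) \<le> max (x m t) 0 * 1" by (intro mult_left_mono) auto
                then show "1 / (\<omega> * C\<^sup>2) * (q m t * \<rho> m) \<le> max (x m t) 0"
                  using \<omega> by (simp add: q_def power2_eq_square field_simps)
              qed
            qed
            have "\<forall>\<^sub>F m in sequentially. c - e \<le> \<sigma> * d m t"
              using filterlim_iff[THEN iffD1, OF xinf, rule_format, OF ev]
            proof eventually_elim
              case (elim m)
              then show ?case using l[of m] g_pos[of "l m" t "x m t"] by (simp add: d_def dev_def)
            qed
            moreover have "(\<lambda>m. q m t * (c - e)) \<longlonglongrightarrow> s * (c - e)" by (intro tendsto_intros ql)
            then have "\<forall>\<^sub>F m in sequentially. y < q m t * (c - e)" by (rule order_tendstoD(1)[OF _ e(2)])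
            ultimately have "\<forall>\<^sub>F m in sequentially. y' \<le> ereal (S m t)"
            proof eventually_elim
              case (elim m)
              have "q m t * (c - e) \<le> q m t * (\<sigma> * d m t)" using elim(1) q0[OF t, of m] by (rule mult_left_mono)
              then show ?case using elim(2) by (simp add: S_q real)
            qed
            then show ?thesis by (rule Liminf_bounded)
          qed
        qed
      qed
    qed (use T \<omega> C1 in auto)
    then show False using LL[OF \<phi>] unfolding Lm_def by simp
  qed
  then show thesis using that unfolding Good_def by blast
qed

end

section \<open>Periodic solutions of the penalised equation\<close>

context impact
begin

text \<open>An orbit returning to its own ray has the same number \<open>j\<close> of half turns for
  both frequencies. One estimate gives \<open>N < j\<close>, the other
  \<open>j < N + 1\<close>.\<close>

lemma no_aligned:
  fixes N :: nat
  assumes \<omega>: "0 < \<omega>1" "\<omega>1 \<le> \<omega>2" "\<omega>1 * T = pi * real N" "\<omega>2 * T = pi * (real N + 1)"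
    and est1: "\<And>n l x v h \<rho>. penalized n l x v \<Longrightarrow> l \<in> {0..1} \<Longrightarrow> r1 \<le> \<rho> \<Longrightarrow>
      energy \<omega>1 n (x 0) (v 0) = \<rho>\<^sup>2 \<Longrightarrow> \<rho> ^ 4 \<le> n \<Longrightarrow>
      continuous_on {0..T} h \<Longrightarrow> (\<And>t. t \<in> {0..T} \<Longrightarrow> exp (h t) = phase_point \<omega>1 n (x t) (v t)) \<Longrightarrow>
      \<omega>1 * T < Im (h T) / 2 - Im (h 0) / 2"
    and est2: "\<And>n l x v h \<rho>. penalized n l x v \<Longrightarrow> l \<in> {0..1} \<Longrightarrow> r2 \<le> \<rho> \<Longrightarrow>
      energy \<omega>2 n (x 0) (v 0) = \<rho>\<^sup>2 \<Longrightarrow> \<rho> ^ 4 \<le> n \<Longrightarrow>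
      continuous_on {0..T} h \<Longrightarrow> (\<And>t. t \<in> {0..T} \<Longrightarrow> exp (h t) = phase_point \<omega>2 n (x t) (v t)) \<Longrightarrow>
      Im (h T) / 2 - Im (h 0) / 2 < \<omega>2 * T"
  obtains R n0 where "1 \<le> R" "1 \<le> n0" "\<And>n l x v c. n0 \<le> n \<Longrightarrow> penalized n l x v \<Longrightarrow> l \<in> {0..1} \<Longrightarrow>
      energy \<omega>1 n (x 0) (v 0) = R\<^sup>2 \<Longrightarrow> x T = c * x 0 \<Longrightarrow> v T = c * v 0 \<Longrightarrow> 0 < c \<Longrightarrow> False"
proof -
  define a where "a = sqrt (2 * exp (rate \<omega>1 * T))"
  define R where "R = Max {1, r1, r2, a}"
  have R: "1 \<le> R" "r1 \<le> R" "r2 \<le> R" "a \<le> R" by (auto simp: R_def)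
  \<comment> \<open>The circle is measured by the energy of \<open>\<omega>1\<close>, whereas the
    second estimate refers to that of \<open>\<omega>2\<close>. The two radii differ by a factor of
    at most \<open>\<kappa>\<close>, which explains the power of \<open>\<kappa> * R\<close> in
    \<open>n0\<close>.\<close>
  define \<kappa> where "\<kappa> = \<omega>2 / \<omega>1"
  have \<kappa>: "1 \<le> \<kappa>" using \<omega> by (simp add: \<kappa>_def)
  define n0 where "n0 = (\<kappa> * R) ^ 4"
  have \<kappa>R: "R \<le> \<kappa> * R" using \<kappa> R by simp
  then have "1 \<le> \<kappa> * R" using R by linarith
  then have n0: "1 \<le> n0" unfolding n0_def by (rule one_le_power)
  show ?thesis
  proof (rule that[OF R(1) n0])
    fix n l x v c
    assume n: "n0 \<le> n" and pen: "penalized n l x v" and l: "l \<in> {0..1}"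
      and E: "energy \<omega>1 n (x 0) (v 0) = R\<^sup>2" and al: "x T = c * x 0" "v T = c * v 0" "0 < c"
    have npos: "0 < n" using n n0 by linarith
    have a0: "0 < a" by (simp add: a_def)
    have nz: "x t \<noteq> 0 \<or> v t \<noteq> 0" if "t \<in> {0..T}" for t
    proof -
      have "0 < (R / a)\<^sup>2" using R a0 by simp
      also have "\<dots> \<le> energy \<omega>1 n (x t) (v t)"
        using energy_band(2)[OF pen l \<omega>(1) _ a_def R(4) E that] npos by simp
      finally show ?thesis using energy_pos_iff[OF npos \<omega>(1)] by blast
    qed
    have \<omega>2: "0 < \<omega>2" using \<omega> by linarith
    obtain h1 h2 j where h:
      "continuous_on {0..T} h1" "\<And>t. t \<in> {0..T} \<Longrightarrow> exp (h1 t) = phase_point \<omega>1 n (x t) (v t)"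
      "continuous_on {0..T} h2" "\<And>t. t \<in> {0..T} \<Longrightarrow> exp (h2 t) = phase_point \<omega>2 n (x t) (v t)"
      "Im (h1 T) / 2 - Im (h1 0) / 2 = pi * of_int j" "Im (h2 T) / 2 - Im (h2 0) / 2 = pi * of_int j"
      using winding_number_exists[OF pen npos \<omega>(1) \<omega>2 nz al] by blast
    have "R ^ 4 \<le> n0" unfolding n0_def using \<kappa>R R by (intro power_mono) auto
    then have "\<omega>1 * T < pi * of_int j"
      using est1[OF pen l R(2) E _ h(1,2)] n h(5) by simp
    then have j1: "real N < of_int j" using \<omega>(3) by simp
    define \<rho> where "\<rho> = sqrt (energy \<omega>2 n (x 0) (v 0))"
    have \<rho>2: "energy \<omega>2 n (x 0) (v 0) = \<rho>\<^sup>2" using energy_nonneg npos by (simp add: \<rho>_def)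
    have "\<omega>1\<^sup>2 \<le> \<omega>2\<^sup>2" using \<omega> by (intro power_mono) auto
    then have "R\<^sup>2 \<le> \<rho>\<^sup>2" unfolding E[symmetric] \<rho>2[symmetric] energy_def by (auto intro: mult_right_mono)
    then have R\<rho>: "R \<le> \<rho>" by (rule power2_le_imp_le) (simp add: \<rho>_def energy_nonneg less_imp_le[OF npos])
    have "\<rho>\<^sup>2 \<le> (\<kappa> * R)\<^sup>2"
    proof -
      have "energy \<omega>2 n (x 0) (v 0) \<le> \<kappa>\<^sup>2 * energy \<omega>1 n (x 0) (v 0)"
      proof -
        have k1: "1 \<le> \<kappa>\<^sup>2" using \<kappa> by simp
        have "\<omega>2\<^sup>2 * (max (x 0) 0)\<^sup>2 = \<kappa>\<^sup>2 * (\<omega>1\<^sup>2 * (max (x 0) 0)\<^sup>2)"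
          using \<omega> by (simp add: \<kappa>_def power_divide)
        moreover have "1 * (v 0)\<^sup>2 \<le> \<kappa>\<^sup>2 * (v 0)\<^sup>2" using k1 by (rule mult_right_mono) simp
        moreover have "1 * (n * (max (- x 0) 0)\<^sup>2) \<le> \<kappa>\<^sup>2 * (n * (max (- x 0) 0)\<^sup>2)"
          using k1 npos by (intro mult_right_mono) auto
        ultimately show ?thesis unfolding energy_def distrib_left by linarith
      qed
      then show ?thesis unfolding E \<rho>2 by (simp add: power_mult_distrib)
    qed
    then have "\<rho> \<le> \<kappa> * R" by (rule power2_le_imp_le) (use \<kappa> R in auto)
    then have "\<rho> ^ 4 \<le> n0" unfolding n0_def using R\<rho> R by (intro power_mono) auto
    then have "pi * of_int j < \<omega>2 * T"
      using est2[OF pen l _ \<rho>2 _ h(3,4)] n h(6) R R\<rho> by simp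
    then have "of_int j < real N + 1" unfolding \<omega>(4) by simp
    then have "j < int N + 1" by linarith
    moreover have "int N < j" using j1 by linarith
    ultimately show False by linarith
  qed
qed

text \<open>The shooting parameter is the initial state together with \<open>l\<close>. Radial
  retraction onto the disc makes the map a self-map; at a fixed point the end state is
  \<open>k\<close> times the initial one with \<open>1 \<le> k\<close>, and \<open>k > 1\<close> can
  occur only on the boundary circle, where \<open>no\<close> forbids it.\<close>

lemma penalized_periodic_exists:
  assumes n: "0 < n" and \<omega>: "0 < \<omega>" and R: "0 < R" and c: "0 < c"
    and Q: "continuous_on UNIV Q" "\<And>x. \<bar>Q x\<bar> \<le> Qm"
    and no: "\<And>l x v c. penalized n l x v \<Longrightarrow> l \<in> {0..1} \<Longrightarrow>
      energy \<omega> n (x 0) (v 0) = R\<^sup>2 \<Longrightarrow> x T = c * x 0 \<Longrightarrow> v T = c * v 0 \<Longrightarrow> 0 < c \<Longrightarrow> False"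
  obtains l x v where "l \<in> {0..1}" "penalized n l x v" "x T = x 0" "v T = v 0"
    "energy \<omega> n (x 0) (v 0) \<le> R\<^sup>2" "l = 1 / max 1 ((integral {0..T} (\<lambda>t. Q (x t))) / c)"
proof -
  \<comment> \<open>A change of the position variable after which the energy is the squared
    Euclidean norm of \<open>(\<zeta> x, v)\<close>, so energy discs become round;
    \<open>\<xi>\<close> is its inverse. Both are positively homogeneous and preserve rays.\<close>
  define \<zeta> where "\<zeta> x = \<omega> * max x 0 - sqrt n * max (- x) 0" for x :: real
  define \<xi> where "\<xi> X = max X 0 / \<omega> - max (- X) 0 / sqrt n" for X :: real
  define ret where "ret z = (1 / max 1 (norm z / R)) *\<^sub>R z" for z :: "real \<times> real"
  define D where "D = cball (0 :: real \<times> real) R \<times> {0..1::real}"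
  \<comment> \<open>The third component accumulates \<open>Q\<close> along the orbit, so that the
    nonlocal formula for \<open>l\<close> becomes a condition on the end state.\<close>
  define F where "F p t z = (fst (snd z), n * max (- fst z) 0 - g (snd p) t (fst z), Q (fst z))"
    for p :: "(real \<times> real) \<times> real" and t and z :: "real \<times> real \<times> real"
  define \<iota> where "\<iota> p = (\<xi> (fst (fst p)), snd (fst p), 0 :: real)" for p :: "(real \<times> real) \<times> real"
  define \<pi> where "\<pi> p z = (ret (\<zeta> (fst z), fst (snd z)), 1 / max 1 (snd (snd z) / c))"
    for p :: "(real \<times> real) \<times> real" and z :: "real \<times> real \<times> real"
  have \<zeta>\<xi>: "\<zeta> (\<xi> X) = X" for X
    using \<omega> n by (cases "X \<ge> 0") (auto simp: \<zeta>_def \<xi>_def max_def divide_nonneg_pos zero_le_divide_iff divide_le_0_iff)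
  have \<zeta>E: "(norm (\<zeta> x, v))\<^sup>2 = energy \<omega> n x v" for x v
    using n by (cases "x \<ge> 0") (auto simp: norm_Pair \<zeta>_def energy_def max_def power_mult_distrib)
  have \<zeta>inj: "x = k * y" if "\<zeta> x = k * \<zeta> y" "0 < k" for x y k
  proof -
    have sc: "\<zeta> (k * y) = k * \<zeta> y"
      using that(2) by (cases "y \<ge> 0") (auto simp: \<zeta>_def max_def algebra_simps mult_le_0_iff zero_le_mult_iff)
    have \<xi>\<zeta>: "\<xi> (\<zeta> x) = x" for x
    proof (cases "x \<ge> 0")
      case True
      then show ?thesis using \<omega> by (simp add: \<zeta>_def \<xi>_def)
    next
      case False
      then have "sqrt n * x < 0" using n by (simp add: mult_less_0_iff)
      then show ?thesis using False n by (simp add: \<zeta>_def \<xi>_def max_def)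
    qed
    show ?thesis using that(1) sc \<xi>\<zeta> by metis
  qed
  have Qm: "0 \<le> Qm" using Q(2)[of 0] by linarith
  obtain p z where pz: "p \<in> D" "z 0 = \<iota> p" "\<pi> p (z T) = p"
    "\<And>t. t \<in> {0..T} \<Longrightarrow> (z has_vector_derivative F p t (z t)) (at t within {0..T})"
  proof (rule shooting_fixed_point[of D T "1 + n + B + Qm" F \<iota> \<pi>])
    show "compact D" "convex D" "D \<noteq> {}"
      using R by (auto simp: D_def intro!: compact_Times convex_Times)
    show "0 < T" by (rule T)
    show "0 \<le> 1 + n + B + Qm" using n B Qm by simp
    have "continuous_on UNIV (\<lambda>(p, t, z). F p t z)"
      unfolding F_def split_beta
      by (intro continuous_intros continuous_on_g continuous_on_compose2[OF Q(1)]) auto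
    then show "continuous_on (D \<times> {0..T} \<times> UNIV) (\<lambda>(p, t, z). F p t z)"
      by (rule continuous_on_subset) auto
    show "norm (F p t z) \<le> (1 + n + B + Qm) * (1 + norm z)" if "p \<in> D" "t \<in> {0..T}" for p t z
    proof -
      have l: "snd p \<in> {0..1}" using that by (auto simp: D_def)
      obtain x v q where z: "z = (x, v, q)" by (cases z)
      have nz: "\<bar>x\<bar> \<le> norm z" "\<bar>v\<bar> \<le> norm z"
        using norm_fst_le[of x "(v, q)"] norm_snd_le[of "(v, q)" x] norm_fst_le[of v q] by (auto simp: z)
      have "norm (F p t z) \<le> \<bar>v\<bar> + (\<bar>n * max (- x) 0 - g (snd p) t x\<bar> + \<bar>Q x\<bar>)"
      proof -
        have "norm (F p t z) = dist (v, n * max (- x) 0 - g (snd p) t x, Q x) (0, 0, 0)"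
          by (simp add: F_def z dist_norm zero_prod_def[symmetric])
        also have "\<dots> \<le> dist v 0 + (dist (n * max (- x) 0 - g (snd p) t x) 0 + dist (Q x) 0)"
          by (rule dist_triple_le)
        finally show ?thesis by (simp add: dist_norm)
      qed
      also have "\<dots> \<le> norm z + ((n * norm z + B * (1 + norm z)) + Qm)"
      proof (intro add_mono nz Q(2))
        have "\<bar>n * max (- x) 0 - g (snd p) t x\<bar> \<le> \<bar>n * max (- x) 0\<bar> + \<bar>g (snd p) t x\<bar>" by (rule abs_triangle_ineq4)
        also have "\<dots> \<le> n * norm z + B * (1 + norm z)"
        proof (rule add_mono)
          show "\<bar>n * max (- x) 0\<bar> \<le> n * norm z" using n nz(1) by (simp add: abs_mult)
          have "B * (1 + max x 0) \<le> B * (1 + norm z)" using B nz(1) by (intro mult_left_mono) auto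
          then show "\<bar>g (snd p) t x\<bar> \<le> B * (1 + norm z)" using g_growth[OF l, of t x] by linarith
        qed
        finally show "\<bar>n * max (- x) 0 - g (snd p) t x\<bar> \<le> n * norm z + B * (1 + norm z)" .
      qed
      also have "\<dots> \<le> (1 + n + B + Qm) * (1 + norm z)"
        using n Qm by (simp add: algebra_simps)
      finally show ?thesis .
    qed
    show "continuous_on D \<iota>"
      unfolding \<iota>_def \<xi>_def using \<omega> n by (intro continuous_intros) auto
    have "continuous_on UNIV (\<lambda>z. ret z)"
      unfolding ret_def using R by (intro continuous_intros) (auto simp: max_def)
    then have "continuous_on (D \<times> UNIV) (\<lambda>pz. ret (\<zeta> (fst (snd pz)), fst (snd (snd pz))))"
      unfolding \<zeta>_def by (rule continuous_on_compose2) (auto intro!: continuous_intros)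
    then show "continuous_on (D \<times> UNIV) (\<lambda>(p, z). \<pi> p z)"
      unfolding \<pi>_def split_beta using c by (intro continuous_intros) (auto simp: max_def)
    show "\<pi> p z \<in> D" for p z
    proof -
      have "norm (ret y) \<le> R" for y
        using R by (simp add: ret_def max_def field_simps)
      then show ?thesis by (simp add: \<pi>_def D_def)
    qed
  qed blast
  define l where "l = snd p"
  define x where "x t = fst (z t)" for t
  define v where "v t = fst (snd (z t))" for t
  define q where "q t = snd (snd (z t))" for t
  have l: "l \<in> {0..1}" using pz(1) by (auto simp: l_def D_def)
  have d: "(x has_vector_derivative v t) (at t within {0..T})"
    "(v has_vector_derivative n * max (- x t) 0 - g l t (x t)) (at t within {0..T})"
    "(q has_vector_derivative Q (x t)) (at t within {0..T})" if "t \<in> {0..T}" for t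
  proof -
    note D = pz(4)[OF that, unfolded F_def]
    note b = bounded_linear.has_vector_derivative
    note D1 = b[OF bounded_linear_fst D] b[OF bounded_linear_snd D]
    note D2 = b[OF bounded_linear_fst D1(2)] b[OF bounded_linear_snd D1(2)]
    show "(x has_vector_derivative v t) (at t within {0..T})"
      using D1(1) by (simp add: x_def[abs_def] v_def)
    show "(v has_vector_derivative n * max (- x t) 0 - g l t (x t)) (at t within {0..T})"
      using D2(1) by (simp add: x_def v_def[abs_def] l_def)
    show "(q has_vector_derivative Q (x t)) (at t within {0..T})"
      using D2(2) by (simp add: x_def q_def[abs_def])
  qed
  have pen: "penalized n l x v"
    using d by (auto simp: penalized_def has_real_derivative_iff_has_vector_derivative)
  have "((\<lambda>t. Q (x t)) has_integral q T - q 0) {0..T}"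
    using T d(3) by (intro fundamental_theorem_of_calculus) auto
  moreover have "q 0 = 0" using pz(2) by (simp add: q_def \<iota>_def)
  ultimately have qT: "q T = integral {0..T} (\<lambda>t. Q (x t))" by (simp add: integral_unique)
  have l_eq: "l = 1 / max 1 ((integral {0..T} (\<lambda>t. Q (x t))) / c)"
    using pz(3) unfolding l_def qT[symmetric] by (metis \<pi>_def q_def snd_conv)
  have p0: "fst p = (\<zeta> (x 0), v 0)"
    using pz(2) by (simp add: x_def v_def \<iota>_def \<zeta>\<xi>)
  have pT: "ret (\<zeta> (x T), v T) = fst p"
    using pz(3) by (metis \<pi>_def fst_conv x_def v_def)
  define k where "k = max 1 (norm (\<zeta> (x T), v T) / R)"
  have k1: "1 \<le> k" by (simp add: k_def)
  have e: "(\<zeta> (x T), v T) = k *\<^sub>R fst p"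
    using k1 by (simp add: pT[symmetric] ret_def k_def[symmetric])
  have al: "x T = k * x 0" "v T = k * v 0"
    using e k1 \<zeta>inj[of "x T" k "x 0"] by (auto simp: p0)
  have nR: "norm (fst p) \<le> R" using pz(1) by (auto simp: D_def)
  have E0: "energy \<omega> n (x 0) (v 0) = (norm (fst p))\<^sup>2" by (simp add: p0 \<zeta>E)
  \<comment> \<open>If the retraction acted, its image has norm \<open>R\<close>; the start is then
    on the boundary circle and the end on the same ray.\<close>
  have "k = 1"
  proof (rule ccontr)
    assume "k \<noteq> 1"
    then have "k = norm (\<zeta> (x T), v T) / R" unfolding k_def by (metis max_def)
    then have "k = k * norm (fst p) / R" unfolding e using k1 by simp
    then have "k * norm (fst p) = k * R" using R by (metis nonzero_eq_divide_eq less_irrefl)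
    then have "norm (fst p) = R" using k1 mult_left_cancel[of k] by auto
    then show False using no[OF pen l _ al] E0 k1 by simp
  qed
  then show ?thesis
    using that[OF l pen _ _ _ l_eq] al E0 nR by (simp add: power_mono)
qed

end

section \<open>The limit of infinite stiffness\<close>

lemma mvt_real:
  fixes f :: "real \<Rightarrow> real"
  assumes "a < b" "continuous_on {a..b} f" "\<And>t. a < t \<Longrightarrow> t < b \<Longrightarrow> (f has_real_derivative f' t) (at t)"
  obtains \<xi> where "a < \<xi>" "\<xi> < b" "f b - f a = (b - a) * f' \<xi>"
proof -
  obtain l z where z: "a < z" "z < b" "(f has_real_derivative l) (at z)" "f b - f a = (b - a) * l"
    using MVT[OF assms(1,2)] assms(3) real_differentiable_def by blast
  then have "l = f' z" using assms(3) DERIV_unique by blast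
  then show ?thesis using that z by blast
qed

lemma mvt_everywhere:
  fixes f :: "real \<Rightarrow> real"
  assumes "\<And>t. (f has_real_derivative f' t) (at t)"
  obtains \<xi> where "\<bar>\<xi> - s\<bar> \<le> \<bar>t - s\<bar>" "\<xi> \<in> {min s t..max s t}" "f t - f s = (t - s) * f' \<xi>"
proof -
  have c: "continuous_on S f" for S
    using assms by (intro DERIV_continuous_on[of S f f']) (auto intro: has_field_derivative_at_within)
  consider "s < t" | "t < s" | "s = t" by linarith
  then show ?thesis
  proof cases
    case 1
    from mvt_real[OF 1 c assms] obtain \<xi> where "s < \<xi>" "\<xi> < t" "f t - f s = (t - s) * f' \<xi>" by blast
    then show ?thesis by (intro that[of \<xi>]) auto
  next
    case 2
    from mvt_real[OF 2 c assms] obtain \<xi> where "t < \<xi>" "\<xi> < s" "f s - f t = (s - t) * f' \<xi>" by blast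
    then show ?thesis by (intro that[of \<xi>]) (auto simp: algebra_simps)
  next
    case 3
    then show ?thesis by (intro that[of s]) auto
  qed
qed

text \<open>A sequence of penalised motions on the whole line with stiffness tending to infinity.
  Uniform convergence is asked of positions and of the energies with frequency 0, that is kinetic
  plus elastic energy, since velocities become discontinuous at impacts. The penetration depth
  vanishes by \<open>pen_bound\<close>.\<close>

locale impact_limit = impact +
  fixes n l :: "nat \<Rightarrow> real" and X V :: "nat \<Rightarrow> real \<Rightarrow> real" and x E :: "real \<Rightarrow> real" and l0 M :: real
  assumes n_pos: "\<And>i. 0 < n i" and n_inf: "filterlim n at_top sequentially"
    and l_range: "\<And>i. l i \<in> {0..1}" and l_lim: "l \<longlonglongrightarrow> l0"
    and dX: "\<And>i t. (X i has_real_derivative V i t) (at t)"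
    and dV: "\<And>i t. (V i has_real_derivative n i * max (- X i t) 0 - g (l i) t (X i t)) (at t)"
    and V_bound: "\<And>i t. \<bar>V i t\<bar> \<le> M" and X_bound: "\<And>i t. X i t \<le> M"
    and pen_bound: "\<And>i t. max (- X i t) 0 \<le> M / sqrt (n i)"
    and X_lim: "uniform_limit UNIV X x sequentially"
    and E_lim: "uniform_limit UNIV (\<lambda>i t. energy 0 (n i) (X i t) (V i t)) E sequentially"
begin

section \<open>Limits of positions, energies and forces; motion away from the wall\<close>

lemma M_nonneg: "0 \<le> M" using V_bound[of 0 0] by linarith

lemma X_lim_at: "(\<lambda>i. X i t) \<longlonglongrightarrow> x t"
  using X_lim by (rule tendsto_uniform_limitI) simp

lemma E_lim_at: "(\<lambda>i. energy 0 (n i) (X i t) (V i t)) \<longlonglongrightarrow> E t"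
  using E_lim by (rule tendsto_uniform_limitI) simp

lemma l0_range: "l0 \<in> {0..1}"
  using l_lim by (rule closed_sequentially[OF closed_atLeastAtMost, rotated]) (use l_range in blast)

lemma slack_lim: "(\<lambda>i. M / sqrt (n i)) \<longlonglongrightarrow> 0"
  by (rule tendsto_divide_0[OF tendsto_const filterlim_at_top_imp_at_infinity[OF filterlim_compose[OF sqrt_at_top n_inf]]])

lemma x_nonneg: "0 \<le> x t"
proof -
  have "(\<lambda>i. - (M / sqrt (n i))) \<longlonglongrightarrow> - 0" by (intro tendsto_minus slack_lim)
  then show ?thesis
    using X_lim_at[of t] by (rule_tac LIMSEQ_le[of "\<lambda>i. - (M / sqrt (n i))" _ "\<lambda>i. X i t"]) (use pen_bound[of _ t] in \<open>auto intro!: exI[of _ 0] simp: max_def split: if_splits\<close>, smt (verit))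
qed

lemma X_cont: "continuous_on S (X i)" and V_cont: "continuous_on S (V i)"
  by (rule DERIV_continuous_on, rule has_field_derivative_at_within[OF dX])
    (rule DERIV_continuous_on, rule has_field_derivative_at_within[OF dV])

lemma x_cont: "continuous_on S x"
  using uniform_limit_theorem[OF _ X_lim] X_cont by (auto intro: continuous_on_subset)

lemma E_cont: "continuous_on S E"
proof -
  have "continuous_on UNIV (\<lambda>t. energy 0 (n i) (X i t) (V i t))" for i
    by (intro continuous_on_energy X_cont V_cont)
  then have "continuous_on UNIV E" using uniform_limit_theorem[OF _ E_lim] by auto
  then show ?thesis by (rule continuous_on_subset) simp
qed

lemma E_nonneg: "0 \<le> E t"
  by (rule tendsto_lowerbound[OF E_lim_at]) (auto intro!: always_eventually energy_nonneg less_imp_le[OF n_pos])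

lemma x_le: "x t \<le> M"
  by (rule tendsto_upperbound[OF X_lim_at]) (auto intro!: always_eventually X_bound)

lemma g_lim:
  "uniform_limit {a..b} (\<lambda>i t. g (l i) t (X i t)) (\<lambda>t. g l0 t (x t)) sequentially"
proof (rule uniform_limitI)
  fix e :: real assume e: "0 < e"
  let ?K = "{0..1} \<times> {a..b} \<times> {0..M}"
  have "uniformly_continuous_on ?K (\<lambda>(l, t, x). g l t x)"
    by (intro compact_uniformly_continuous compact_Times continuous_on_subset[OF g_cont]) auto
  then obtain d where d: "0 < d" and D: "\<And>l t y l' t' y'. (l, t, y) \<in> ?K \<Longrightarrow> (l', t', y') \<in> ?K \<Longrightarrow>
      dist (l', t', y') (l, t, y) < d \<Longrightarrow> dist (g l' t' y') (g l t y) < e"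
    unfolding uniformly_continuous_on_def using e by (force simp: split_beta)
  have "\<forall>\<^sub>F i in sequentially. \<forall>t\<in>UNIV. dist (X i t) (x t) < d / 2"
    using d by (intro uniform_limitD[OF X_lim]) auto
  moreover have "\<forall>\<^sub>F i in sequentially. dist (l i) l0 < d / 2"
    using d by (intro tendstoD[OF l_lim]) auto
  ultimately show "\<forall>\<^sub>F i in sequentially. \<forall>t\<in>{a..b}. dist (g (l i) t (X i t)) (g l0 t (x t)) < e"
  proof eventually_elim
    case (elim i)
    show ?case
    proof
      fix t assume t: "t \<in> {a..b}"
      \<comment> \<open>\<open>X i t\<close> may be slightly negative and leave \<open>?K\<close>.
        Its positive part is no farther from the nonnegative \<open>x t\<close>, and
        \<open>g\<close> does not distinguish the two.\<close>
      have "dist (max (X i t) 0) (x t) \<le> dist (X i t) (x t)"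
        using x_nonneg[of t] by (auto simp: dist_real_def max_def)
      then have "dist (l i, t, max (X i t) 0) (l0, t, x t) < d"
        using elim dist_triple_le[of "l i" t "max (X i t) 0" l0 t "x t"] by (smt (verit) UNIV_I dist_self field_sum_of_halves)
      then have "dist (g (l i) t (max (X i t) 0)) (g l0 t (x t)) < e"
        using t l_range[of i] l0_range x_nonneg[of t] x_le[of t] X_bound[of i t] M_nonneg by (intro D) auto
      then show "dist (g (l i) t (X i t)) (g l0 t (x t)) < e" using g_pos by metis
    qed
  qed
qed

lemma g_abs: "\<bar>g (l i) t (X i t)\<bar> \<le> B * (1 + M)"
proof -
  have "B * (1 + max (X i t) 0) \<le> B * (1 + M)" using B X_bound[of i t] M_nonneg by (intro mult_left_mono) auto
  then show ?thesis using g_growth[OF l_range, of i t "X i t"] by linarith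
qed

lemma gx_cont: "continuous_on S (\<lambda>t. g l0 t (x t))"
  by (intro continuous_on_g continuous_intros x_cont)

text \<open>Around a time with \<open>x t0 > 0\<close> the approximations eventually do not touch
  the spring, so their velocities are equi-Lipschitz there. Limits of velocities along subsequences
  are derivatives of \<open>x\<close>; the equation follows by the mean value theorem, and the
  energy reduces to the squared velocity.\<close>

lemma free_motion:
  assumes pos: "0 < x t0"
  shows "(x has_real_derivative deriv x t0) (at t0)"
    "(deriv x has_real_derivative - g l0 t0 (x t0)) (at t0)" "(deriv x t0)\<^sup>2 = E t0"
proof -
  define \<eta> where "\<eta> = x t0 / 2"
  have \<eta>: "0 < \<eta>" using pos by (simp add: \<eta>_def)
  obtain e where e: "0 < e" "\<And>t. \<bar>t - t0\<bar> < e \<Longrightarrow> \<bar>x t - x t0\<bar> < \<eta>"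
    using x_cont[of UNIV, unfolded continuous_on_iff, rule_format, of t0 \<eta>] \<eta> by (auto simp: dist_real_def)
  define a b where "a = t0 - e / 2" and "b = t0 + e / 2"
  have ab: "a < t0" "t0 < b" using e by (auto simp: a_def b_def)
  have x\<eta>: "\<eta> < x t" if "t \<in> {a..b}" for t
  proof -
    have "\<bar>t - t0\<bar> < e" using e(1) that unfolding a_def b_def atLeastAtMost_iff abs_less_iff by linarith
    from e(2)[OF this] show ?thesis unfolding \<eta>_def by linarith
  qed
  have ev: "\<forall>\<^sub>F i in sequentially. \<forall>t\<in>{a..b}. 0 < X i t"
    using uniform_limitD[OF X_lim \<eta>]
  proof eventually_elim
    case (elim i)
    show ?case
    proof
      fix t assume "t \<in> {a..b}"
      moreover have "dist (X i t) (x t) < \<eta>" using elim by blast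
      ultimately show "0 < X i t" using x\<eta>[of t] unfolding dist_real_def by linarith
    qed
  qed
  let ?G = "B * (1 + M)"
  \<comment> \<open>With the spring inactive the acceleration is bounded by \<open>?G\<close>
    whatever \<open>n i\<close> is, so the remainder is uniform in \<open>i\<close>.\<close>
  have taylor: "\<forall>\<^sub>F i in sequentially. \<bar>X i t - X i s - (t - s) * V i s\<bar> \<le> ?G * (t - s)\<^sup>2"
    if st: "s \<in> {a..b}" "t \<in> {a..b}" for s t
    using ev
  proof eventually_elim
    case (elim i)
    obtain \<xi> where \<xi>: "\<bar>\<xi> - s\<bar> \<le> \<bar>t - s\<bar>" "\<xi> \<in> {min s t..max s t}" "X i t - X i s = (t - s) * V i \<xi>"
      using mvt_everywhere[OF dX] by blast
    obtain \<zeta> where \<zeta>: "\<zeta> \<in> {min s \<xi>..max s \<xi>}" "V i \<xi> - V i s = (\<xi> - s) * (n i * max (- X i \<zeta>) 0 - g (l i) \<zeta> (X i \<zeta>))"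
      using mvt_everywhere[OF dV, of s \<xi> i] by metis
    have "\<zeta> \<in> {a..b}" using \<zeta>(1) \<xi>(2) st by auto
    then have "max (- X i \<zeta>) 0 = 0" using elim by (simp add: max_def less_imp_le not_le)
    then have "V i \<xi> - V i s = - ((\<xi> - s) * g (l i) \<zeta> (X i \<zeta>))" using \<zeta>(2) by simp
    then have "\<bar>V i \<xi> - V i s\<bar> \<le> \<bar>t - s\<bar> * ?G"
      using \<xi>(1) g_abs[of i \<zeta>] by (simp add: abs_mult mult_mono)
    then have "\<bar>t - s\<bar> * \<bar>V i \<xi> - V i s\<bar> \<le> \<bar>t - s\<bar> * (\<bar>t - s\<bar> * ?G)" by (rule mult_left_mono) simp
    also have "\<dots> = ?G * (t - s)\<^sup>2" by (simp add: power2_eq_square abs_mult_self_eq mult.commute mult.left_commute)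
    also have "\<bar>t - s\<bar> * \<bar>V i \<xi> - V i s\<bar> = \<bar>X i t - X i s - (t - s) * V i s\<bar>"
      unfolding \<xi>(3) abs_mult[symmetric] by (simp add: algebra_simps)
    finally show ?case .
  qed
  have dx: "(x has_real_derivative v) (at s)"
    if s: "a < s" "s < b" and r: "strict_mono (r :: nat \<Rightarrow> nat)" and v: "(\<lambda>i. V (r i) s) \<longlonglongrightarrow> v" for s v r
  proof -
    have bnd: "\<bar>x t - x s - (t - s) * v\<bar> \<le> ?G * (t - s)\<^sup>2" if "t \<in> {a..b}" for t
    proof (rule tendsto_upperbound)
      have "(\<lambda>i. X (r i) t) \<longlonglongrightarrow> x t" for t
        using LIMSEQ_subseq_LIMSEQ[OF X_lim_at r] by (simp add: o_def)
      then show "(\<lambda>i. \<bar>X (r i) t - X (r i) s - (t - s) * V (r i) s\<bar>) \<longlonglongrightarrow> \<bar>x t - x s - (t - s) * v\<bar>"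
        by (intro tendsto_intros v)
      show "\<forall>\<^sub>F i in sequentially. \<bar>X (r i) t - X (r i) s - (t - s) * V (r i) s\<bar> \<le> ?G * (t - s)\<^sup>2"
        using eventually_subseq[OF r taylor] s that by auto
    qed simp
    have "((\<lambda>t. (x t - x s) / (t - s) - v) \<longlongrightarrow> 0) (at s)"
    proof (rule Lim_null_comparison)
      have "\<forall>\<^sub>F t in at s. t \<in> {a<..<b}" using s by (intro eventually_at_in_open') auto
      then show "\<forall>\<^sub>F t in at s. norm ((x t - x s) / (t - s) - v) \<le> ?G * \<bar>t - s\<bar>"
        using eventually_neq_at_within[of s s UNIV]
      proof eventually_elim
        case (elim t)
        have sq: "(t - s)\<^sup>2 = \<bar>t - s\<bar> * \<bar>t - s\<bar>" by (simp add: power2_eq_square)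
        have "(x t - x s) / (t - s) - v = (x t - x s - (t - s) * v) / (t - s)"
          using elim by (simp add: diff_divide_distrib)
        then have "\<bar>(x t - x s) / (t - s) - v\<bar> = \<bar>x t - x s - (t - s) * v\<bar> / \<bar>t - s\<bar>"
          by (simp only: abs_divide)
        also have "\<dots> \<le> ?G * (t - s)\<^sup>2 / \<bar>t - s\<bar>" using bnd[of t] elim by (intro divide_right_mono) auto
        also have "\<dots> = ?G * \<bar>t - s\<bar>"
          unfolding sq mult.assoc[symmetric] by (rule nonzero_mult_div_cancel_right) (use elim in simp)
        finally show ?case by simp
      qed
      have "((\<lambda>t. ?G * \<bar>t - s\<bar>) \<longlongrightarrow> ?G * \<bar>s - s\<bar>) (at s)" by (intro tendsto_intros)
      then show "((\<lambda>t. ?G * \<bar>t - s\<bar>) \<longlongrightarrow> 0) (at s)" by simp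
    qed
    then show ?thesis by (simp add: has_field_derivative_iff LIM_zero_iff)
  qed
  \<comment> \<open>Any two times share a subsequence along which the bounded velocities converge;
    \<open>dx\<close> identifies the limits, so they are the derivatives of
    \<open>x\<close>.\<close>
  have sub: "\<exists>r. strict_mono (r :: nat \<Rightarrow> nat) \<and> (\<lambda>i. V (r i) s) \<longlonglongrightarrow> deriv x s \<and> (\<lambda>i. V (r i) t) \<longlonglongrightarrow> deriv x t \<and>
      (x has_real_derivative deriv x s) (at s)"
    if st: "a < s" "s < b" "a < t" "t < b" for s t
  proof -
    have "compact ({- M..M} \<times> {- M..M})" by (intro compact_Times compact_Icc)
    moreover have "(V i s, V i t) \<in> {- M..M} \<times> {- M..M}" for i
      using V_bound[of i s] V_bound[of i t] by (auto simp: abs_le_iff)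
    ultimately obtain w r where r: "strict_mono (r :: nat \<Rightarrow> nat)" and w: "((\<lambda>i. (V i s, V i t)) \<circ> r) \<longlonglongrightarrow> w"
      unfolding compact_def by meson
    have 1: "(\<lambda>i. V (r i) s) \<longlonglongrightarrow> fst w" "(\<lambda>i. V (r i) t) \<longlonglongrightarrow> snd w"
      using tendsto_fst[OF w] tendsto_snd[OF w] by (simp_all add: o_def)
    then have "(x has_real_derivative fst w) (at s)" "(x has_real_derivative snd w) (at t)"
      using dx st r by auto
    then show ?thesis using 1 r DERIV_imp_deriv by metis
  qed
  show "(x has_real_derivative deriv x t0) (at t0)" using sub[OF ab ab] by blast
  obtain r where r: "strict_mono (r :: nat \<Rightarrow> nat)" "(\<lambda>i. V (r i) t0) \<longlonglongrightarrow> deriv x t0" using sub[OF ab ab] by blast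
  show "(deriv x t0)\<^sup>2 = E t0"
  proof (rule LIMSEQ_unique)
    show "(\<lambda>i. (V (r i) t0)\<^sup>2) \<longlonglongrightarrow> (deriv x t0)\<^sup>2" by (intro tendsto_intros r)
    have "(\<lambda>i. energy 0 (n (r i)) (X (r i) t0) (V (r i) t0)) \<longlonglongrightarrow> E t0"
      using LIMSEQ_subseq_LIMSEQ[OF E_lim_at r(1)] by (simp add: o_def)
    moreover have "\<forall>\<^sub>F i in sequentially. energy 0 (n (r i)) (X (r i) t0) (V (r i) t0) = (V (r i) t0)\<^sup>2"
      using eventually_subseq[OF r(1) ev]
    proof eventually_elim
      case (elim i)
      then have "0 < X (r i) t0" using ab by auto
      then show ?case by (simp add: energy_def)
    qed
    ultimately show "(\<lambda>i. (V (r i) t0)\<^sup>2) \<longlonglongrightarrow> E t0" by (rule Lim_transform_eventually)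
  qed
  show "(deriv x has_real_derivative - g l0 t0 (x t0)) (at t0)"
    unfolding has_field_derivative_def has_derivative_within_alt
  proof (intro conjI allI impI)
    show "bounded_linear ((*) (- g l0 t0 (x t0)))" by (rule bounded_linear_mult_right)
    fix \<epsilon> :: real assume \<epsilon>: "0 < \<epsilon>"
    obtain d where d: "0 < d" "\<And>t. \<bar>t - t0\<bar> < d \<Longrightarrow> \<bar>g l0 t (x t) - g l0 t0 (x t0)\<bar> < \<epsilon> / 2"
      using gx_cont[of UNIV, unfolded continuous_on_iff, rule_format, of t0 "\<epsilon> / 2"] \<epsilon> by (auto simp: dist_real_def)
    have evg: "\<forall>\<^sub>F i in sequentially. \<forall>t\<in>{a..b}. dist (g (l i) t (X i t)) (g l0 t (x t)) < \<epsilon> / 2"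
      using \<epsilon> by (intro uniform_limitD[OF g_lim]) auto
    show "\<exists>d>0. \<forall>y\<in>UNIV. norm (y - t0) < d \<longrightarrow>
        norm (deriv x y - deriv x t0 - - g l0 t0 (x t0) * (y - t0)) \<le> \<epsilon> * norm (y - t0)"
    proof (intro exI[of _ "min d (e / 2)"] conjI ballI impI)
      show "0 < min d (e / 2)" using d e by simp
      fix y assume y: "norm (y - t0) < min d (e / 2)"
      then have yab: "a < y" "y < b" by (auto simp: a_def b_def abs_if split: if_splits)
      obtain r where r: "strict_mono (r :: nat \<Rightarrow> nat)" "(\<lambda>i. V (r i) t0) \<longlonglongrightarrow> deriv x t0" "(\<lambda>i. V (r i) y) \<longlonglongrightarrow> deriv x y"
        using sub[OF ab yab] by blast
      show "norm (deriv x y - deriv x t0 - - g l0 t0 (x t0) * (y - t0)) \<le> \<epsilon> * norm (y - t0)"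
      proof (rule tendsto_upperbound)
        show "(\<lambda>i. norm (V (r i) y - V (r i) t0 - - g l0 t0 (x t0) * (y - t0)))
            \<longlonglongrightarrow> norm (deriv x y - deriv x t0 - - g l0 t0 (x t0) * (y - t0))"
          by (intro tendsto_intros r)
        show "\<forall>\<^sub>F i in sequentially. norm (V (r i) y - V (r i) t0 - - g l0 t0 (x t0) * (y - t0)) \<le> \<epsilon> * norm (y - t0)"
          using eventually_subseq[OF r(1) ev] eventually_subseq[OF r(1) evg]
        proof eventually_elim
          case (elim i)
          obtain \<zeta> where \<zeta>: "\<bar>\<zeta> - t0\<bar> \<le> \<bar>y - t0\<bar>" "\<zeta> \<in> {min t0 y..max t0 y}"
            "V (r i) y - V (r i) t0 = (y - t0) * (n (r i) * max (- X (r i) \<zeta>) 0 - g (l (r i)) \<zeta> (X (r i) \<zeta>))"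
            using mvt_everywhere[OF dV, of t0 y "r i"] by metis
          have \<zeta>ab: "\<zeta> \<in> {a..b}" using \<zeta>(2) ab yab by auto
          then have "max (- X (r i) \<zeta>) 0 = 0" using elim(1) by (simp add: max_def less_imp_le not_le)
          then have "V (r i) y - V (r i) t0 - - g l0 t0 (x t0) * (y - t0) = (y - t0) * (g l0 t0 (x t0) - g (l (r i)) \<zeta> (X (r i) \<zeta>))"
            using \<zeta>(3) by (simp add: algebra_simps)
          moreover have "\<bar>g l0 t0 (x t0) - g (l (r i)) \<zeta> (X (r i) \<zeta>)\<bar> \<le> \<epsilon>"
          proof -
            have "\<bar>g l0 \<zeta> (x \<zeta>) - g l0 t0 (x t0)\<bar> < \<epsilon> / 2" using d(2)[of \<zeta>] \<zeta>(1) y by simp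
            moreover have "\<bar>g (l (r i)) \<zeta> (X (r i) \<zeta>) - g l0 \<zeta> (x \<zeta>)\<bar> < \<epsilon> / 2" using elim(2) \<zeta>ab by (auto simp: dist_real_def)
            ultimately show ?thesis by linarith
          qed
          then have "\<bar>y - t0\<bar> * \<bar>g l0 t0 (x t0) - g (l (r i)) \<zeta> (X (r i) \<zeta>)\<bar> \<le> \<bar>y - t0\<bar> * \<epsilon>"
            by (rule mult_left_mono) simp
          ultimately show ?case by (simp add: abs_mult mult.commute)
        qed
      qed simp
    qed
  qed
qed

section \<open>Impacts and rest at the wall\<close>

lemma sqrt_E_close:
  assumes "0 < \<epsilon>"
  obtains d where "0 < d" "\<And>t. \<bar>t - t0\<bar> < d \<Longrightarrow> \<bar>sqrt (E t) - sqrt (E t0)\<bar> < \<epsilon>"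
proof -
  have "continuous_on UNIV (\<lambda>t. sqrt (E t))" by (intro continuous_intros E_cont)
  then show ?thesis
    using assms that unfolding continuous_on_iff dist_real_def by (metis UNIV_I)
qed

text \<open>On \<open>x > 0\<close> the speed is \<open>sqrt (E t)\<close> with \<open>E\<close> continuous across impacts, so by the mean value
  theorem the difference quotients at an impact converge to \<open>\<plusminus> sqrt (E t0)\<close>.\<close>
lemma right_derivative:
  assumes x0: "x t0 = 0" and pos: "\<forall>\<^sub>F t in at_right t0. 0 < x t"
  shows "(x has_real_derivative sqrt (E t0)) (at_right t0)"
  unfolding has_field_derivative_iff
proof (rule tendstoI)
  fix \<epsilon> :: real assume "0 < \<epsilon>"
  then obtain d where d: "0 < d" "\<And>t. \<bar>t - t0\<bar> < d \<Longrightarrow> \<bar>sqrt (E t) - sqrt (E t0)\<bar> < \<epsilon>"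
    using sqrt_E_close by blast
  obtain b where b: "t0 < b" "\<And>t. t0 < t \<Longrightarrow> t < b \<Longrightarrow> 0 < x t"
    using pos unfolding eventually_at_right_field by blast
  show "\<forall>\<^sub>F t in at_right t0. dist ((x t - x t0) / (t - t0)) (sqrt (E t0)) < \<epsilon>"
    unfolding eventually_at_right_field
  proof (intro exI[of _ "min b (t0 + d)"] conjI allI impI)
    show "t0 < min b (t0 + d)" using b d by simp
    fix t assume t: "t0 < t" "t < min b (t0 + d)"
    obtain \<xi> where \<xi>: "t0 < \<xi>" "\<xi> < t" "x t - x t0 = (t - t0) * deriv x \<xi>"
      by (rule mvt_real[OF t(1) x_cont, of "deriv x"]) (use t b free_motion(1) in auto)
    have pq: "0 < (t - t0) * deriv x \<xi>" using b(2)[of t] t \<xi>(3) x0 by simp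
    then have "0 < deriv x \<xi>" using t by (simp add: zero_less_mult_iff)
    moreover have "(deriv x \<xi>)\<^sup>2 = E \<xi>" using free_motion(3) b(2)[of \<xi>] \<xi> t by simp
    ultimately have "deriv x \<xi> = sqrt (E \<xi>)" by (metis less_imp_le real_sqrt_unique)
    then have "(x t - x t0) / (t - t0) = sqrt (E \<xi>)" using \<xi>(3) t by simp
    then show "dist ((x t - x t0) / (t - t0)) (sqrt (E t0)) < \<epsilon>"
      using d(2)[of \<xi>] \<xi> t by (simp add: dist_real_def)
  qed
qed

lemma left_derivative:
  assumes x0: "x t0 = 0" and pos: "\<forall>\<^sub>F t in at_left t0. 0 < x t"
  shows "(x has_real_derivative - sqrt (E t0)) (at_left t0)"
  unfolding has_field_derivative_iff
proof (rule tendstoI)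
  fix \<epsilon> :: real assume "0 < \<epsilon>"
  then obtain d where d: "0 < d" "\<And>t. \<bar>t - t0\<bar> < d \<Longrightarrow> \<bar>sqrt (E t) - sqrt (E t0)\<bar> < \<epsilon>"
    using sqrt_E_close by blast
  obtain b where b: "b < t0" "\<And>t. b < t \<Longrightarrow> t < t0 \<Longrightarrow> 0 < x t"
    using pos unfolding eventually_at_left_field by blast
  show "\<forall>\<^sub>F t in at_left t0. dist ((x t - x t0) / (t - t0)) (- sqrt (E t0)) < \<epsilon>"
    unfolding eventually_at_left_field
  proof (intro exI[of _ "max b (t0 - d)"] conjI allI impI)
    show "max b (t0 - d) < t0" using b d by simp
    fix t assume t: "max b (t0 - d) < t" "t < t0"
    obtain \<xi> where \<xi>: "t < \<xi>" "\<xi> < t0" "x t0 - x t = (t0 - t) * deriv x \<xi>"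
      by (rule mvt_real[OF t(2) x_cont, of "deriv x"]) (use t b free_motion(1) in auto)
    have pq: "(t0 - t) * deriv x \<xi> < 0" using b(2)[of t] t \<xi>(3) x0 by simp
    then have "deriv x \<xi> < 0" using t by (simp add: mult_less_0_iff)
    moreover have "(- deriv x \<xi>)\<^sup>2 = E \<xi>" using free_motion(3) b(2)[of \<xi>] \<xi> t by simp
    ultimately have "- deriv x \<xi> = sqrt (E \<xi>)" by (metis less_imp_le neg_0_le_iff_le real_sqrt_unique)
    moreover have "x t - x t0 = (t - t0) * deriv x \<xi>" using \<xi>(3) by (simp add: algebra_simps)
    ultimately have "(x t - x t0) / (t - t0) = - sqrt (E \<xi>)" using t by simp
    then show "dist ((x t - x t0) / (t - t0)) (- sqrt (E t0)) < \<epsilon>"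
      using d(2)[of \<xi>] \<xi> t by (simp add: dist_real_def)
  qed
qed

text \<open>With \<open>m = max (- X) 0\<close>, \<open>(X V)' = energy - 2 n m\<^sup>2 - X g\<close> and \<open>n m\<^sup>2 \<le> \<sigma> n m = \<sigma> (V' + g)\<close> for
  \<open>\<sigma> = M / sqrt n\<close>; so \<open>X V + 2 \<sigma> V\<close> would have to increase by a definite amount between two zeros
  of the limit, where it tends to 0.\<close>
lemma zero_isolated:
  assumes x0: "x t0 = 0" and E0: "0 < E t0"
  shows "\<forall>\<^sub>F t in at t0. 0 < x t"
proof -
  \<comment> \<open>Near \<open>t0\<close> the limit energy exceeds \<open>3 * e\<close> and the
    approximating ones \<open>2 * e\<close>. The force terms of the derivative \<open>?D\<close>
    cost at most \<open>e / 4 + e / 2\<close> by the choice of \<open>\<eta>\<close>, so a growth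
    rate of at least \<open>e\<close> remains.\<close>
  define e where "e = E t0 / 4"
  have e: "0 < e" using E0 by (simp add: e_def)
  let ?G = "B * (1 + M)"
  have G0: "0 \<le> ?G" using B M_nonneg by simp
  define \<eta> where "\<eta> = e / (4 * (1 + ?G))"
  have \<eta>: "0 < \<eta>" "\<eta> * ?G \<le> e / 4" using e G0 by (auto simp: \<eta>_def field_simps)
  obtain d1 where d1: "0 < d1" "\<And>t. \<bar>t - t0\<bar> < d1 \<Longrightarrow> \<bar>x t - x t0\<bar> < \<eta> / 2"
    using x_cont[of UNIV, unfolded continuous_on_iff, rule_format, of t0 "\<eta> / 2"] \<eta> by (auto simp: dist_real_def)
  obtain d2 where d2: "0 < d2" "\<And>t. \<bar>t - t0\<bar> < d2 \<Longrightarrow> \<bar>E t - E t0\<bar> < e"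
    using E_cont[of UNIV, unfolded continuous_on_iff, rule_format, of t0 e] e by (auto simp: dist_real_def)
  define d where "d = min d1 d2"
  have d: "0 < d" using d1 d2 by (simp add: d_def)
  have nz: False if ab: "a < b" "\<bar>a - t0\<bar> < d" "\<bar>b - t0\<bar> < d" and z: "x a = 0" "x b = 0" for a b
  proof -
    define \<sigma> where "\<sigma> i = M / sqrt (n i)" for i
    let ?\<Phi> = "\<lambda>i t. X i t * V i t + 2 * \<sigma> i * V i t"
    have "\<forall>\<^sub>F i in sequentially. \<forall>t\<in>UNIV. dist (X i t) (x t) < \<eta> / 2"
      using \<eta> by (intro uniform_limitD[OF X_lim]) auto
    moreover have "\<forall>\<^sub>F i in sequentially. \<forall>t\<in>UNIV. dist (energy 0 (n i) (X i t) (V i t)) (E t) < e"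
      using e by (intro uniform_limitD[OF E_lim]) auto
    moreover have "\<forall>\<^sub>F i in sequentially. \<sigma> i < \<eta>"
      using \<eta> by (intro order_tendstoD(2)[OF slack_lim[folded \<sigma>_def]]) auto
    ultimately have "\<forall>\<^sub>F i in sequentially. e * (b - a) \<le> ?\<Phi> i b - ?\<Phi> i a"
    proof eventually_elim
      case (elim i)
      let ?m = "\<lambda>t. max (- X i t) 0"
      let ?g = "\<lambda>t. g (l i) t (X i t)"
      let ?D = "\<lambda>t. V i t * V i t + (n i * ?m t - ?g t) * X i t + 2 * \<sigma> i * (n i * ?m t - ?g t)"
      have D: "(?\<Phi> i has_real_derivative ?D t) (at t)" for t
        by (rule derivative_eq_intros dX dV refl)+ simp
      have \<Phi>c: "continuous_on {a..b} (?\<Phi> i)" by (intro continuous_intros X_cont V_cont)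
      obtain \<xi> where \<xi>: "a < \<xi>" "\<xi> < b" "?\<Phi> i b - ?\<Phi> i a = (b - a) * ?D \<xi>"
        using mvt_real[OF ab(1) \<Phi>c D] by blast
      have near: "\<bar>\<xi> - t0\<bar> < d" using \<xi> ab by linarith
      have X\<eta>: "\<bar>X i \<xi>\<bar> \<le> \<eta>"
      proof -
        have "\<bar>x \<xi>\<bar> < \<eta> / 2" using d1(2)[of \<xi>] near x0 by (simp add: d_def)
        moreover have "dist (X i \<xi>) (x \<xi>) < \<eta> / 2" using elim(1) by blast
        ultimately show ?thesis unfolding dist_real_def by linarith
      qed
      have Ee: "2 * e \<le> energy 0 (n i) (X i \<xi>) (V i \<xi>)"
      proof -
        have "\<bar>E \<xi> - E t0\<bar> < e" using d2(2)[of \<xi>] near by (simp add: d_def)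
        moreover have "dist (energy 0 (n i) (X i \<xi>) (V i \<xi>)) (E \<xi>) < e" using elim(2) by blast
        ultimately show ?thesis unfolding dist_real_def e_def by linarith
      qed
      have \<sigma>0: "0 \<le> \<sigma> i" using M_nonneg n_pos[of i] by (simp add: \<sigma>_def)
      have "n i * ?m \<xi> * ?m \<xi> \<le> n i * ?m \<xi> * \<sigma> i"
        using pen_bound[of i \<xi>, folded \<sigma>_def] n_pos[of i] by (intro mult_left_mono) auto
      moreover have "V i \<xi> * V i \<xi> + n i * ?m \<xi> * X i \<xi> = energy 0 (n i) (X i \<xi>) (V i \<xi>) - 2 * (n i * ?m \<xi> * ?m \<xi>)"
        by (cases "X i \<xi> \<le> 0") (auto simp: energy_def power2_eq_square)
      moreover have "\<bar>?g \<xi> * X i \<xi>\<bar> \<le> ?G * \<eta>" unfolding abs_mult using g_abs[of i \<xi>] X\<eta> by (intro mult_mono) auto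
      moreover have "\<bar>\<sigma> i * ?g \<xi>\<bar> \<le> \<eta> * ?G"
        unfolding abs_mult using g_abs[of i \<xi>] elim(3) \<sigma>0 by (intro mult_mono) auto
      moreover have "?D \<xi> = (V i \<xi> * V i \<xi> + n i * ?m \<xi> * X i \<xi>) - ?g \<xi> * X i \<xi>
          + 2 * (n i * ?m \<xi> * \<sigma> i) - 2 * (\<sigma> i * ?g \<xi>)"
        by (simp add: algebra_simps)
      moreover have "?G * \<eta> \<le> e / 4" using \<eta>(2) by (simp add: mult.commute)
      ultimately have "e \<le> ?D \<xi>"
        using Ee \<eta>(2) e unfolding abs_le_iff by linarith
      then have "(b - a) * e \<le> (b - a) * ?D \<xi>" using ab by (intro mult_left_mono) auto
      then show ?case unfolding \<xi>(3) by (simp add: mult.commute)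
    qed
    \<comment> \<open>Factored as \<open>(X i s + 2 * \<sigma> i) * V i s\<close>: the first factor
      tends to 0, the second is bounded.\<close>
    moreover have \<Phi>0: "(\<lambda>i. ?\<Phi> i s) \<longlonglongrightarrow> 0" if "x s = 0" for s
    proof -
      have "(\<lambda>i. X i s + 2 * \<sigma> i) \<longlonglongrightarrow> x s + 2 * 0" by (intro tendsto_intros X_lim_at slack_lim[folded \<sigma>_def])
      then have "(\<lambda>i. (X i s + 2 * \<sigma> i)) \<longlonglongrightarrow> 0" using that by simp
      moreover have "Bfun (\<lambda>i. V i s) sequentially"
        using V_bound[of _ s] by (intro BfunI[of _ M]) auto
      ultimately have "(\<lambda>i. (X i s + 2 * \<sigma> i) * V i s) \<longlonglongrightarrow> 0"
        unfolding tendsto_Zfun_iff by (simp add: bounded_bilinear.Zfun_prod_Bfun[OF bounded_bilinear_mult])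
      then show ?thesis by (simp add: distrib_right)
    qed
    then have "(\<lambda>i. ?\<Phi> i b - ?\<Phi> i a) \<longlonglongrightarrow> 0 - 0" using z by (intro tendsto_diff) auto
    ultimately have "e * (b - a) \<le> 0 - 0" by (rule_tac tendsto_lowerbound) auto
    then show False using e ab by (simp add: mult_le_0_iff)
  qed
  show ?thesis
    unfolding eventually_at
  proof (intro exI[of _ d] conjI ballI impI)
    show "0 < d" by fact
    fix t assume "t \<noteq> t0 \<and> dist t t0 < d"
    then have "x t \<noteq> 0"
      using nz[of t t0] nz[of t0 t] x0 d by (cases "t < t0") (auto simp: dist_real_def)
    then show "0 < x t" using x_nonneg[of t] by simp
  qed
qed

text \<open>The spring only pushes away from the wall. If \<open>g\<close> were negative, it would
  do so too, and the approximations would be uniformly convex on a short interval, which contradicts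
  convergence to the constant 0.\<close>

lemma rest_nonneg:
  assumes ab: "a < b" and z: "\<And>t. t \<in> {a..b} \<Longrightarrow> x t = 0" and t: "t \<in> {a..b}"
  shows "0 \<le> g l0 t 0"
proof (rule ccontr)
  assume "\<not> 0 \<le> g l0 t 0"
  define c where "c = - g l0 t 0 / 3"
  have c: "0 < c" using \<open>\<not> 0 \<le> g l0 t 0\<close> by (simp add: c_def)
  have "continuous_on UNIV (\<lambda>s. g l0 s 0)" by (intro continuous_on_g continuous_intros)
  then obtain d where d: "0 < d" "\<And>s. \<bar>s - t\<bar> < d \<Longrightarrow> \<bar>g l0 s 0 - g l0 t 0\<bar> < c"
    using c unfolding continuous_on_iff dist_real_def by (metis UNIV_I)
  define a' where "a' = max a (t - d / 2)"
  define b' where "b' = min b (t + d / 2)"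
  have ab': "a' < b'" "a \<le> a'" "b' \<le> b" using ab t d by (auto simp: a'_def b'_def)
  have g2: "g l0 s (x s) < - 2 * c" if "s \<in> {a'..b'}" for s
  proof -
    have "\<bar>s - t\<bar> < d" using that d(1) by (auto simp: a'_def b'_def)
    then show ?thesis using d(2)[of s] z[of s] that ab' by (simp add: c_def)
  qed
  \<comment> \<open>The mean velocities over the two outer thirds are attained at times more than
    \<open>h\<close> apart, so an acceleration of at least \<open>c\<close> forces the second
    difference of the positions to be at least \<open>c * h * h\<close>.\<close>
  define h where "h = (b' - a') / 3"
  have h: "0 < h" "a' + h < a' + 2 * h" "a' + 2 * h < b'" using ab' unfolding h_def by (auto simp: field_simps)
  have "\<forall>\<^sub>F i in sequentially. c * h * h \<le> X i b' - X i (a' + 2 * h) - (X i (a' + h) - X i a')"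
    using uniform_limitD[OF g_lim[of a' b'] c]
  proof eventually_elim
    case (elim i)
    obtain \<xi>1 where \<xi>1: "a' < \<xi>1" "\<xi>1 < a' + h" "X i (a' + h) - X i a' = (a' + h - a') * V i \<xi>1"
      by (rule mvt_real[of a' "a' + h" "X i" "V i"]) (use h X_cont dX in auto)
    obtain \<xi>2 where \<xi>2: "a' + 2 * h < \<xi>2" "\<xi>2 < b'" "X i b' - X i (a' + 2 * h) = (b' - (a' + 2 * h)) * V i \<xi>2"
      by (rule mvt_real[of "a' + 2 * h" b' "X i" "V i"]) (use h X_cont dX in auto)
    have b'h: "b' - (a' + 2 * h) = h" by (simp add: h_def field_simps)
    obtain \<zeta> where \<zeta>: "\<xi>1 < \<zeta>" "\<zeta> < \<xi>2"
      "V i \<xi>2 - V i \<xi>1 = (\<xi>2 - \<xi>1) * (n i * max (- X i \<zeta>) 0 - g (l i) \<zeta> (X i \<zeta>))"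
      by (rule mvt_real[of \<xi>1 \<xi>2 "V i" "\<lambda>t. n i * max (- X i t) 0 - g (l i) t (X i t)"])
        (use \<xi>1 \<xi>2 h V_cont dV in auto)
    have "\<zeta> \<in> {a'..b'}" using \<zeta> \<xi>1 \<xi>2 by auto
    then have "g (l i) \<zeta> (X i \<zeta>) \<le> - c" using elim g2[of \<zeta>] by (auto simp: dist_real_def abs_less_iff dest!: bspec)
    moreover have "0 \<le> n i * max (- X i \<zeta>) 0" using n_pos[of i] by simp
    ultimately have "h * c \<le> (\<xi>2 - \<xi>1) * (n i * max (- X i \<zeta>) 0 - g (l i) \<zeta> (X i \<zeta>))"
      using \<xi>1 \<xi>2 h c by (intro mult_mono) auto
    then have "h * (h * c) \<le> h * (V i \<xi>2 - V i \<xi>1)" using \<zeta>(3) h by (intro mult_left_mono) auto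
    then show ?case using \<xi>1(3) \<xi>2(3) b'h by (simp add: algebra_simps)
  qed
  moreover have "(\<lambda>i. X i b' - X i (a' + 2 * h) - (X i (a' + h) - X i a')) \<longlonglongrightarrow> x b' - x (a' + 2 * h) - (x (a' + h) - x a')"
    by (intro tendsto_intros X_lim_at)
  ultimately have "c * h * h \<le> x b' - x (a' + 2 * h) - (x (a' + h) - x a')"
    by (rule_tac tendsto_lowerbound) auto
  also have "\<dots> = 0" using z ab' h by simp
  finally show False using c h by (simp add: mult_le_0_iff not_le)
qed

end

text \<open>Only multiples of \<open>T\<close> need care: there the left cell and the right cell
  give one-sided derivatives \<open>f' T\<close> and \<open>f' 0\<close>, which agree by
  \<open>match\<close>.\<close>

lemma periodic_extension_derivative:
  fixes f f' :: "real \<Rightarrow> real"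
  assumes T: "0 < T" and d: "\<And>t. t \<in> {0..T} \<Longrightarrow> (f has_real_derivative f' t) (at t within {0..T})"
    and match: "f T = f 0" "f' T = f' 0"
  shows "((\<lambda>t. f (t - T * of_int \<lfloor>t / T\<rfloor>)) has_real_derivative f' (t - T * of_int \<lfloor>t / T\<rfloor>)) (at t)"
proof -
  let ?P = "\<lambda>t. f (t - T * of_int \<lfloor>t / T\<rfloor>)"
  have floor: "\<lfloor>s / T\<rfloor> = j" if "T * of_int j \<le> s" "s < T * (of_int j + 1)" for s j
    using that T by (intro floor_unique) (auto simp: field_simps)
  have cell: "(?P has_real_derivative f' (s - T * of_int j)) (at s within {T * of_int j..T * (of_int j + 1)})"
    if s: "s \<in> {T * of_int j..T * (of_int j + 1)}" for s j
  proof -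
    let ?C = "{T * of_int j..T * (of_int j + 1)}"
    have im: "(\<lambda>s. s - T * of_int j) ` ?C = {0..T}"
      using image_add_atLeastAtMost'[of "- (T * of_int j)" "T * of_int j" "T * (of_int j + 1)"]
      by (simp add: algebra_simps)
    have "(f has_real_derivative f' (s - T * of_int j)) (at (s - T * of_int j) within (\<lambda>s. s - T * of_int j) ` ?C)"
      unfolding im using s by (intro d) (auto simp: algebra_simps)
    moreover have "((\<lambda>s. s - T * of_int j) has_real_derivative 1) (at s within ?C)"
      by (auto intro!: derivative_eq_intros)
    ultimately have "((\<lambda>s. f (s - T * of_int j)) has_real_derivative f' (s - T * of_int j)) (at s within ?C)"
      using DERIV_image_chain[of f _ "\<lambda>s. s - T * of_int j" s ?C 1] by (simp add: o_def)
    moreover have "f (r - T * of_int j) = ?P r" if "r \<in> ?C" for r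
    proof (cases "r < T * (of_int j + 1)")
      case True
      then show ?thesis using floor[of j r] that by simp
    next
      case False
      then have r: "r = T * (of_int j + 1)" using that by simp
      then have "\<lfloor>r / T\<rfloor> = j + 1" using T by simp
      then show ?thesis using r match(1) by (simp add: algebra_simps)
    qed
    ultimately show ?thesis
      by (rule has_field_derivative_transform_within[OF _ zero_less_one s])
  qed
  define k where "k = \<lfloor>t / T\<rfloor>"
  have k: "T * of_int k \<le> t" "t < T * (of_int k + 1)"
    unfolding k_def using T floor_divide_lower[OF T, of t] floor_divide_upper[OF T, of t] by (auto simp: mult.commute)
  have right: "(?P has_real_derivative f' (t - T * of_int k)) (at t within {T * of_int k..T * (of_int k + 1)})"
    using k by (intro cell) auto
  show ?thesis
  proof (cases "t = T * of_int k")
    case False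
    then show ?thesis using right k at_within_Icc_at[of "T * of_int k" t "T * (of_int k + 1)"] by (simp add: k_def)
  next
    case True
    let ?A = "{T * of_int (k - 1)..T * (of_int (k - 1) + 1)}" and ?C = "{T * of_int k..T * (of_int k + 1)}"
    have "(?P has_real_derivative f' (t - T * of_int (k - 1))) (at t within ?A)"
      by (rule cell) (use True T in auto)
    moreover have "t - T * of_int (k - 1) = T" using True by (simp add: algebra_simps)
    ultimately have left: "(?P has_real_derivative f' (t - T * of_int k)) (at t within ?A)"
      using match(2) True by simp
    have "(?P has_real_derivative f' (t - T * of_int k)) (at t within ?A \<union> ?C)"
      using left right unfolding has_field_derivative_iff Lim_within_Un by blast
    moreover have "?A \<union> ?C = {T * of_int (k - 1)..T * (of_int k + 1)}"
      using T by (auto simp: algebra_simps)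
    moreover have "at t within {T * of_int (k - 1)..T * (of_int k + 1)} = at t"
      by (rule at_within_Icc_at) (use True T in \<open>auto simp: algebra_simps\<close>)
    ultimately show ?thesis by (simp add: k_def)
  qed
qed

section \<open>Verification of the bouncing laws for the limit\<close>

context impact_limit
begin

text \<open>Each clause has its own source: free motion, the one-sided derivatives, isolation of
  zeros, and rest at the wall. For isolation, a nonzero one-sided derivative keeps \<open>x\<close>
  positive on that side, hence equals plus or minus \<open>sqrt (E t0)\<close>; so
  \<open>E t0\<close> is positive and the zero is isolated on both sides.\<close>

lemma bouncing:
  assumes p: "\<And>t r. w \<le> r \<Longrightarrow> p t r = g l0 t (r - w)"
  shows "bouncing_solution w p (- \<infinity>) \<infinity> (\<lambda>t. w + x t)"
proof -
  let ?y = "\<lambda>t. w + x t"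
  have dy: "(?y has_real_derivative D) F \<longleftrightarrow> (x has_real_derivative D) F" for D F
    by (auto simp: has_field_derivative_def has_derivative_def)
  have deriv_y: "deriv ?y = deriv x" unfolding deriv_def dy ..
  have py: "p t (?y t) = g l0 t (x t)" for t using p[of "?y t" t] x_nonneg[of t] by simp
  have pos_left: "\<forall>\<^sub>F t in at_left t0. 0 < x t" and pos_right: "\<forall>\<^sub>F t in at_right t0. 0 < x t"
    if "\<forall>\<^sub>F t in at t0. 0 < x t" for t0
    using that eventually_at_split by blast+
  have slope: "0 < x t" if "x t0 = 0" "norm ((x t - x t0) / (t - t0) - d) < \<bar>d\<bar>" for t t0 d
  proof -
    have "x t \<noteq> 0" using that by auto
    then show ?thesis using x_nonneg[of t] by simp
  qed
  have E_pos: "0 < E t0" if x0: "x t0 = 0" and d: "d \<noteq> 0"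
    "(x has_real_derivative d) (at_left t0) \<or> (x has_real_derivative d) (at_right t0)" for t0 d
  proof -
    have "sqrt (E t0) \<noteq> 0"
    using d(2)
    proof
      assume l: "(x has_real_derivative d) (at_left t0)"
      then have "\<forall>\<^sub>F t in at_left t0. dist ((x t - x t0) / (t - t0)) d < \<bar>d\<bar>"
        unfolding has_field_derivative_iff using d(1) by (intro tendstoD) auto
      then have "\<forall>\<^sub>F t in at_left t0. 0 < x t"
        by (rule eventually_mono) (use slope[OF x0] in \<open>auto simp: dist_norm\<close>)
      from left_derivative[OF x0 this] have "d = - sqrt (E t0)"
        using l unfolding has_field_derivative_iff by (intro tendsto_unique[of "at_left t0"]) auto
      then show ?thesis using d(1) by simp
    next
      assume l: "(x has_real_derivative d) (at_right t0)"
      then have "\<forall>\<^sub>F t in at_right t0. dist ((x t - x t0) / (t - t0)) d < \<bar>d\<bar>"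
        unfolding has_field_derivative_iff using d(1) by (intro tendstoD) auto
      then have "\<forall>\<^sub>F t in at_right t0. 0 < x t"
        by (rule eventually_mono) (use slope[OF x0] in \<open>auto simp: dist_norm\<close>)
      from right_derivative[OF x0 this] have "d = sqrt (E t0)"
        using l unfolding has_field_derivative_iff by (intro tendsto_unique[of "at_right t0"]) auto
      then show ?thesis using d(1) by simp
    qed
    then show ?thesis using E_nonneg[of t0] by simp
  qed
  show ?thesis
    unfolding bouncing_solution_def einterval_eq_UNIV deriv_y
  proof (intro conjI ballI allI impI)
    show "- \<infinity> < (\<infinity> :: ereal)" by simp
    show "continuous_on UNIV ?y" by (intro continuous_intros x_cont)
    show "w \<le> ?y t" for t using x_nonneg[of t] by simp
  next
    fix t0 assume "w < ?y t0"
    then have pos: "0 < x t0" by simp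
    have "\<forall>\<^sub>F t in nhds t0. 0 < x t"
    proof -
      have "(x \<longlongrightarrow> x t0) (at t0)" using x_cont[of UNIV] by (auto simp: continuous_on_def)
      then show ?thesis
        using order_tendstoD(1)[OF _ pos] pos by (auto simp: eventually_nhds_conv_at)
    qed
    then show "\<forall>\<^sub>F t in nhds t0. ?y differentiable at t"
      by (rule eventually_mono) (use free_motion(1) dy in \<open>auto simp: real_differentiable_def\<close>)
    note f = free_motion(2)[OF pos]
    show "deriv x differentiable at t0" using f real_differentiable_def by blast
    show "deriv (deriv x) t0 + p t0 (?y t0) = 0" using DERIV_imp_deriv[OF f] py by simp
  next
    fix t0 assume a: "?y t0 = w \<and> (\<forall>\<^sub>F t in at t0. w < ?y t)"
    then have x0: "x t0 = 0" "\<forall>\<^sub>F t in at t0. 0 < x t" by auto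
    show "\<exists>dl dr. (?y has_real_derivative dl) (at_left t0) \<and> (?y has_real_derivative dr) (at_right t0) \<and> dl = - dr"
      unfolding dy using left_derivative[OF x0(1) pos_left[OF x0(2)]] right_derivative[OF x0(1) pos_right[OF x0(2)]] by blast
  next
    fix t0 assume "?y t0 = w \<and> (\<exists>d. d \<noteq> 0 \<and> ((?y has_real_derivative d) (at_left t0) \<or> (?y has_real_derivative d) (at_right t0)))"
    then have "x t0 = 0" "0 < E t0" unfolding dy using E_pos by auto
    then show "\<forall>\<^sub>F t in at t0. w < ?y t" using zero_isolated by simp
  next
    fix I t assume I: "is_interval I \<and> I \<subseteq> UNIV \<and> (\<exists>r\<in>I. \<exists>s\<in>I. r < s) \<and> (\<forall>t\<in>I. ?y t = w)" and t: "t \<in> I"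
    then obtain r s where rs: "r \<in> I" "s \<in> I" "r < s" by blast
    define a b where "a = min r t" and "b = max s t"
    have ab: "a < b" "t \<in> {a..b}" using rs by (auto simp: a_def b_def)
    have abI: "a \<in> I" "b \<in> I" using rs t by (auto simp: a_def b_def min_def max_def)
    have "x u = 0" if "u \<in> {a..b}" for u
    proof -
      have "u \<in> I" using I abI that mem_is_interval_1_I[of I a b u] by auto
      then have "?y u = w" using I by blast
      then show ?thesis by simp
    qed
    then have "0 \<le> g l0 t 0" by (rule rest_nonneg[OF ab(1) _ ab(2)])
    then show "0 \<le> p t w" using p[of w t] by simp
  qed
qed

end

section \<open>Compactness as the stiffness tends to infinity\<close>

context impact
begin

text \<open>Periodic penalised solutions with initial energy at most \<open>R\<^sup>2\<close> obey
  bounds uniform in the stiffness, so a subsequence converges. Uniform convergence carries the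
  formula for \<open>l\<close> to the limit as well.\<close>

lemma bouncing_periodic_exists:
  assumes per: "\<And>l t x. g l (t + T) x = g l t x"
    and \<omega>: "0 < \<omega>" and n0: "1 \<le> n0" and c: "0 < c" and Q: "continuous_on UNIV Q"
    and sol: "\<And>n. n0 \<le> n \<Longrightarrow> \<exists>l x v. l \<in> {0..1} \<and> penalized n l x v \<and> x T = x 0 \<and> v T = v 0 \<and>
      energy \<omega> n (x 0) (v 0) \<le> R\<^sup>2 \<and> l = 1 / max 1 ((integral {0..T} (\<lambda>t. Q (x t))) / c)"
  obtains l x where "l \<in> {0..1}" "\<And>t. 0 \<le> x t"
    "\<And>t. x t \<le> sqrt (exp (rate \<omega> * T) * (1 + R\<^sup>2)) * (1 + 1 / \<omega>)"
    "\<And>t. x (t + T) = x t" "continuous_on UNIV x" "l = 1 / max 1 ((integral {0..T} (\<lambda>t. Q (x t))) / c)"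
    "\<And>w p. (\<And>t r. w \<le> r \<Longrightarrow> p t r = g l t (r - w)) \<Longrightarrow> bouncing_solution w p (- \<infinity>) \<infinity> (\<lambda>t. w + x t)"
proof -
  define m where "m = sqrt (exp (rate \<omega> * T) * (1 + R\<^sup>2))"
  \<comment> \<open>Dominates both \<open>m\<close>, the bound for speed and spring energy, and
    \<open>m / \<omega>\<close>, the bound for the position. It involves neither the stiffness nor
    \<open>c\<close>, on which the final choice of \<open>k\<close> relies.\<close>
  define M where "M = m * (1 + 1 / \<omega>)"
  have m0: "0 \<le> m" by (simp add: m_def)
  have mM: "m \<le> M" "m / \<omega> \<le> M" using m0 \<omega> by (auto simp: M_def field_simps)
  have M0: "0 \<le> M" using m0 mM by linarith
  define n where "n i = n0 + real i" for i :: nat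
  have n_ge: "n0 \<le> n i" and n1: "1 \<le> n i" and npos: "0 < n i" for i using n0 by (auto simp: n_def)
  obtain l' x' v' where seq: "\<And>i. l' i \<in> {0..1}" "\<And>i. penalized (n i) (l' i) (x' i) (v' i)" "\<And>i. x' i T = x' i 0"
    "\<And>i. v' i T = v' i 0" "\<And>i. energy \<omega> (n i) (x' i 0) (v' i 0) \<le> R\<^sup>2"
    "\<And>i. l' i = 1 / max 1 ((integral {0..T} (\<lambda>t. Q (x' i t))) / c)"
    using sol[OF n_ge] by metis
  have bnd: "\<bar>v' i t\<bar> \<le> m" "max (x' i t) 0 \<le> m / \<omega>" "max (- x' i t) 0 \<le> m / sqrt (n i)" if t: "t \<in> {0..T}" for i t
  proof -
    have "energy \<omega> (n i) (x' i t) (v' i t) \<le> exp (rate \<omega> * T) * (1 + energy \<omega> (n i) (x' i 0) (v' i 0))"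
      using energy_growth(1)[OF seq(2) t seq(1) \<omega>, of i] npos[of i] by simp
    also have "\<dots> \<le> exp (rate \<omega> * T) * (1 + R\<^sup>2)" using seq(5)[of i] by (intro mult_left_mono) auto
    also have "\<dots> = (m * 1)\<^sup>2" unfolding m_def by (simp add: add_nonneg_nonneg)
    finally show "\<bar>v' i t\<bar> \<le> m" "max (x' i t) 0 \<le> m / \<omega>" "max (- x' i t) 0 \<le> m / sqrt (n i)"
      using component_bounds[of \<omega> "n i" "x' i t" "v' i t" m 1] \<omega> npos[of i] m0 by auto
  qed
  have bM: "\<bar>v' i t\<bar> \<le> M" "x' i t \<le> M" "max (- x' i t) 0 \<le> M / sqrt (n i)" if t: "t \<in> {0..T}" for i t
  proof -
    show "\<bar>v' i t\<bar> \<le> M" "x' i t \<le> M" using bnd[OF t, of i] mM by linarith+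
    have "m / sqrt (n i) \<le> M / sqrt (n i)" using mM npos[of i] by (intro divide_right_mono) auto
    then show "max (- x' i t) 0 \<le> M / sqrt (n i)" using bnd(3)[OF t, of i] by linarith
  qed
  have x'M: "\<bar>x' i t\<bar> \<le> M" if t: "t \<in> {0..T}" for i t
  proof -
    have "M / sqrt (n i) \<le> M / 1" using M0 n1[of i] npos[of i] by (intro divide_left_mono) auto
    then show ?thesis using bM(2,3)[OF t, of i] by (auto simp: abs_le_iff)
  qed
  let ?E = "\<lambda>i t. energy 0 (n i) (x' i t) (v' i t)"
  let ?G = "B * (1 + M)"
  have gG: "\<bar>g (l' i) t (x' i t)\<bar> \<le> ?G" if "t \<in> {0..T}" for i t
  proof -
    have "B * (1 + max (x' i t) 0) \<le> B * (1 + M)" using bM(2)[OF that, of i] B M0 by (intro mult_left_mono) auto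
    then show ?thesis using g_growth[OF seq(1), of i t "x' i t"] by linarith
  qed
  define Lp where "Lp = M + 2 * M * ?G"
  have G0: "0 \<le> ?G" using B M0 by simp
  have Lp0: "0 \<le> Lp" using M0 G0 by (simp add: Lp_def)
  have lipx: "\<bar>x' i t - x' i s\<bar> \<le> M * \<bar>t - s\<bar>" if "s \<in> {0..T}" "t \<in> {0..T}" for i s t
    using field_differentiable_bound[of "{0..T}" "x' i" "v' i" M t s] penalizedD(1)[OF seq(2)] bM(1) that by auto
  have lipE: "\<bar>?E i t - ?E i s\<bar> \<le> 2 * M * ?G * \<bar>t - s\<bar>" if "s \<in> {0..T}" "t \<in> {0..T}" for i s t
  proof -
    have "norm (?E i t - ?E i s) \<le> 2 * M * ?G * norm (t - s)"
    proof (rule field_differentiable_bound[of "{0..T}"])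
      show "((\<lambda>t. ?E i t) has_real_derivative - 2 * v' i z * (g (l' i) z (x' i z) - 0\<^sup>2 * max (x' i z) 0)) (at z within {0..T})"
        if "z \<in> {0..T}" for z by (rule energy_derivative[OF seq(2) that])
      show "norm (- 2 * v' i z * (g (l' i) z (x' i z) - 0\<^sup>2 * max (x' i z) 0)) \<le> 2 * M * ?G" if "z \<in> {0..T}" for z
      proof -
        have "\<bar>v' i z\<bar> * \<bar>g (l' i) z (x' i z)\<bar> \<le> M * ?G" using bM(1)[OF that] gG[OF that] M0 by (intro mult_mono) auto
        then show ?thesis by (simp add: abs_mult)
      qed
    qed (use that in auto)
    then show ?thesis by simp
  qed
  \<comment> \<open>Positions and frequency-0 energies are compactified together. Both are uniformly
    Lipschitz: the rate of the energy contains the velocity and \<open>g\<close>, but no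
    stiffness.\<close>
  define F where "F i t = (x' i t, ?E i t)" for i t
  have lipF: "norm (F i t - F i s) \<le> Lp * \<bar>t - s\<bar>" if "s \<in> {0..T}" "t \<in> {0..T}" for i s t
  proof -
    have "norm (F i t - F i s) \<le> \<bar>x' i t - x' i s\<bar> + \<bar>?E i t - ?E i s\<bar>"
      using norm_Pair_le[of "x' i t - x' i s" "?E i t - ?E i s"] by (simp add: F_def)
    then show ?thesis using lipx[OF that, of i] lipE[OF that, of i] by (simp add: Lp_def distrib_right)
  qed
  obtain Fl k1 where Fl: "continuous_on {0..T} Fl" and k1: "strict_mono (k1 :: nat \<Rightarrow> nat)"
    and lim1: "\<And>\<epsilon>. 0 < \<epsilon> \<Longrightarrow> \<exists>N. \<forall>n t. n \<ge> N \<and> t \<in> {0..T} \<longrightarrow> norm (F (k1 n) t - Fl t) < \<epsilon>"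
  proof (rule Arzela_Ascoli[of "{0..T}" F "M + (M\<^sup>2 + M\<^sup>2)"])
    show "norm (F i t) \<le> M + (M\<^sup>2 + M\<^sup>2)" if t: "t \<in> {0..T}" for i t
    proof -
      have "?E i t \<le> M\<^sup>2 + M\<^sup>2"
      proof -
        have "(v' i t)\<^sup>2 \<le> M\<^sup>2" using power_mono[OF bM(1)[OF t, of i], of 2] by simp
        moreover have "n i * (max (- x' i t) 0)\<^sup>2 \<le> n i * (M / sqrt (n i))\<^sup>2"
          using bM(3)[OF t, of i] npos[of i] by (intro mult_left_mono power_mono) auto
        moreover have "n i * (M / sqrt (n i))\<^sup>2 = M\<^sup>2" using npos[of i] by (simp add: power_divide)
        ultimately show ?thesis by (simp add: energy_def)
      qed
      then show ?thesis
        using norm_Pair_le[of "x' i t" "?E i t"] x'M[OF t, of i] energy_nonneg[of "n i" 0 "x' i t" "v' i t"] npos[of i]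
        by (simp add: F_def)
    qed
    show "\<exists>d>0. \<forall>n y. y \<in> {0..T} \<and> norm (t - y) < d \<longrightarrow> norm (F n t - F n y) < \<epsilon>"
      if "t \<in> {0..T}" "0 < \<epsilon>" for t \<epsilon> :: real
    proof (intro exI[of _ "\<epsilon> / (Lp + 1)"] conjI allI impI)
      show "0 < \<epsilon> / (Lp + 1)" using that Lp0 by simp
      fix i y assume y: "y \<in> {0..T} \<and> norm (t - y) < \<epsilon> / (Lp + 1)"
      have "norm (F i t - F i y) \<le> Lp * \<bar>t - y\<bar>" by (rule lipF) (use y that in auto)
      also have "\<dots> \<le> (Lp + 1) * \<bar>t - y\<bar>" by (intro mult_right_mono) auto
      also have "\<dots> < \<epsilon>" using y Lp0 by (simp add: field_simps)
      finally show "norm (F i t - F i y) < \<epsilon>" .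
    qed
  qed (use compact_Icc in auto)
  obtain l k2 where l: "l \<in> {0..1}" and k2: "strict_mono (k2 :: nat \<Rightarrow> nat)" and liml: "((l' \<circ> k1) \<circ> k2) \<longlonglongrightarrow> l"
    using compact_Icc[of 0 1] seq(1) unfolding compact_def by (metis comp_apply)
  define r where "r = k1 \<circ> k2"
  have r: "strict_mono r" using k1 k2 by (simp add: r_def strict_mono_o)
  have ulF: "uniform_limit {0..T} (\<lambda>i. F (r i)) Fl sequentially"
  proof (rule uniform_limitI)
    fix \<epsilon> :: real assume "0 < \<epsilon>"
    from lim1[OF this] obtain N where N: "\<And>n t. n \<ge> N \<Longrightarrow> t \<in> {0..T} \<Longrightarrow> norm (F (k1 n) t - Fl t) < \<epsilon>" by blast
    show "\<forall>\<^sub>F i in sequentially. \<forall>t\<in>{0..T}. dist (F (r i) t) (Fl t) < \<epsilon>"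
      unfolding eventually_sequentially r_def dist_norm comp_def
      using N le_trans[OF _ seq_suble[OF k2]] by blast
  qed
  \<comment> \<open>Time reduced modulo \<open>T\<close>, which extends the solutions from one
    period to the whole line.\<close>
  define W where "W t = t - T * of_int \<lfloor>t / T\<rfloor>" for t
  have W: "W t \<in> {0..T}" for t
    using floor_divide_lower[OF T, of t] floor_divide_upper[OF T, of t] by (simp add: W_def algebra_simps)
  have WT: "W (t + T) = W t" for t
  proof -
    have "(t + T) / T = t / T + 1" using T by (simp add: add_divide_distrib)
    then show ?thesis by (simp add: W_def algebra_simps)
  qed
  have W0: "W t = (if t = T then 0 else t)" if "t \<in> {0..T}" for t
  proof (cases "t = T")
    case True
    then show ?thesis using T by (simp add: W_def)
  next
    case False
    then have "\<lfloor>t / T\<rfloor> = 0" using that T by (intro floor_unique) auto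
    then show ?thesis using False by (simp add: W_def)
  qed
  have gW: "g l (W t) y = g l t y" for l t y
  proof -
    have n: "g l (t + T * real k) y = g l t y" for k t
    proof (induction k)
      case (Suc k)
      have "t + T * real (Suc k) = (t + T * real k) + T" by (simp add: algebra_simps)
      then show ?case using per[of l "t + T * real k" y] Suc by (simp only:)
    qed simp
    show ?thesis
    proof (cases "0 \<le> \<lfloor>t / T\<rfloor>")
      case True
      then have "W t + T * real (nat \<lfloor>t / T\<rfloor>) = t" by (simp add: W_def)
      then show ?thesis using n[of "W t" "nat \<lfloor>t / T\<rfloor>"] by simp
    next
      case False
      then have "t + T * real (nat (- \<lfloor>t / T\<rfloor>)) = W t" by (simp add: W_def)
      then show ?thesis using n[of t "nat (- \<lfloor>t / T\<rfloor>)"] by simp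
    qed
  qed
  define X where "X i t = x' (r i) (W t)" for i t
  define V where "V i t = v' (r i) (W t)" for i t
  define x where "x t = fst (Fl (W t))" for t
  define E where "E t = snd (Fl (W t))" for t
  have X_ext: "(X i has_real_derivative V i t) (at t)"
    "(V i has_real_derivative n (r i) * max (- X i t) 0 - g (l' (r i)) t (X i t)) (at t)" for i t
  proof -
    note pd = penalizedD[OF seq(2)[of "r i"]]
    show "(X i has_real_derivative V i t) (at t)"
      unfolding X_def[abs_def] V_def W_def
      by (rule periodic_extension_derivative[OF T pd(1) seq(3,4)])
    have "((\<lambda>t. v' (r i) (t - T * of_int \<lfloor>t / T\<rfloor>)) has_real_derivative
        (\<lambda>s. n (r i) * max (- x' (r i) s) 0 - g (l' (r i)) s (x' (r i) s)) (t - T * of_int \<lfloor>t / T\<rfloor>)) (at t)"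
    proof (rule periodic_extension_derivative[OF T pd(2) seq(4)])
      show "n (r i) * max (- x' (r i) T) 0 - g (l' (r i)) T (x' (r i) T) = n (r i) * max (- x' (r i) 0) 0 - g (l' (r i)) 0 (x' (r i) 0)"
        using per[of "l' (r i)" 0] seq(3)[of "r i"] by simp
    qed
    then show "(V i has_real_derivative n (r i) * max (- X i t) 0 - g (l' (r i)) t (X i t)) (at t)"
      unfolding V_def[abs_def] X_def W_def[symmetric] using gW by simp
  qed
  have ulW: "uniform_limit UNIV (\<lambda>i t. F (r i) (W t)) (\<lambda>t. Fl (W t)) sequentially"
    by (rule uniform_limit_compose'[OF ulF]) (use W in auto)
  have ulX: "uniform_limit UNIV X x sequentially" and ulE: "uniform_limit UNIV (\<lambda>i t. energy 0 (n (r i)) (X i t) (V i t)) E sequentially"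
    using bounded_linear.uniform_limit[OF bounded_linear_snd ulW]
      bounded_linear.uniform_limit[OF bounded_linear_fst ulW]
    by (simp_all add: F_def X_def[abs_def] V_def x_def[abs_def] E_def[abs_def])
  interpret lim: impact_limit T B g "\<lambda>i. n (r i)" "\<lambda>i. l' (r i)" X V x E l M
  proof
    have "filterlim (\<lambda>i. real (r i)) at_top sequentially"
      using filterlim_compose[OF filterlim_real_sequentially filterlim_subseq[OF r]] .
    then show "filterlim (\<lambda>i. n (r i)) at_top sequentially"
      unfolding n_def by (rule filterlim_tendsto_add_at_top[OF tendsto_const])
    show "(\<lambda>i. l' (r i)) \<longlonglongrightarrow> l" using liml by (simp add: r_def o_def)
    show "0 < n (r i)" for i by (rule npos)
    show "l' (r i) \<in> {0..1}" for i by (rule seq(1))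
    show "\<bar>V i t\<bar> \<le> M" "X i t \<le> M" "max (- X i t) 0 \<le> M / sqrt (n (r i))" for i t
      unfolding V_def X_def by (rule bM[OF W])+
  qed (rule X_ext ulX ulE)+
  have x_int: "(\<lambda>i. integral {0..T} (\<lambda>t. Q (x' (r i) t))) \<longlonglongrightarrow> integral {0..T} (\<lambda>t. Q (x t))"
  proof -
    have uc: "uniformly_continuous_on {- M..M} Q"
      by (intro compact_uniformly_continuous continuous_on_subset[OF Q]) auto
    have "uniform_limit {0..T} (\<lambda>i t. Q (X i t)) (Q \<circ> x) sequentially"
    proof (rule uniform_limit_compose[OF _ uc])
      show "uniform_limit {0..T} X x sequentially" using ulX by (rule uniform_limit_on_subset) simp
      show "\<forall>\<^sub>F i in sequentially. X i ` {0..T} \<subseteq> {- M..M}"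
      proof (intro always_eventually allI image_subsetI)
        fix i t
        have "\<bar>X i t\<bar> \<le> M" unfolding X_def by (rule x'M[OF W])
        then show "X i t \<in> {- M..M}" unfolding atLeastAtMost_iff by linarith
      qed
      show "x ` {0..T} \<subseteq> {- M..M}"
      proof (rule image_subsetI)
        fix t
        show "x t \<in> {- M..M}" using lim.x_nonneg[of t] lim.x_le[of t] M0 by simp
      qed
    qed
    moreover have "continuous_on {0..T} (\<lambda>t. Q (X i t))" for i
      by (rule continuous_on_compose2[OF Q lim.X_cont]) auto
    ultimately obtain I J where IJ: "\<And>i. ((\<lambda>t. Q (X i t)) has_integral I i) {0..T}" "((Q \<circ> x) has_integral J) {0..T}" "I \<longlonglongrightarrow> J"
      by (rule uniform_limit_integral) auto
    have Xx: "X i t = x' (r i) t" if "t \<in> {0..T}" for i t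
      using W0[OF that] seq(3)[of "r i"] by (auto simp: X_def)
    have "integral {0..T} (\<lambda>t. Q (x' (r i) t)) = integral {0..T} (\<lambda>t. Q (X i t))" for i
      by (rule integral_cong) (simp only: Xx)
    then have "integral {0..T} (\<lambda>t. Q (x' (r i) t)) = I i" for i
      by (simp only: integral_unique[OF IJ(1)])
    then show ?thesis
      using IJ(3) integral_unique[OF IJ(2)] by (simp add: o_def)
  qed
  have l_eq: "l = 1 / max 1 ((integral {0..T} (\<lambda>t. Q (x t))) / c)"
  proof (rule LIMSEQ_unique[OF lim.l_lim])
    have "(\<lambda>i. 1 / max 1 ((integral {0..T} (\<lambda>t. Q (x' (r i) t))) / c)) \<longlonglongrightarrow> 1 / max 1 ((integral {0..T} (\<lambda>t. Q (x t))) / c)"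
      using c by (intro tendsto_intros tendsto_max x_int) auto
    then show "(\<lambda>i. l' (r i)) \<longlonglongrightarrow> 1 / max 1 ((integral {0..T} (\<lambda>t. Q (x t))) / c)"
      using seq(6) by simp
  qed
  show ?thesis
  proof (rule that[OF l lim.x_nonneg _ _ lim.x_cont l_eq lim.bouncing])
    show "x t \<le> sqrt (exp (rate \<omega> * T) * (1 + R\<^sup>2)) * (1 + 1 / \<omega>)" for t
      using lim.x_le[of t] by (simp add: M_def m_def)
    show "x (t + T) = x t" for t by (simp add: x_def WT)
  qed
qed

end

section \<open>Periodic bouncing solutions of the system\<close>

text \<open>Removing whole periods \<open>T / real j\<close> shifts the sine by multiples of \<pi>
  and lands on its first, nonnegative arch.\<close>

lemma psi_eq_abs_sin:
  assumes "0 < T" "0 < j"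
  shows "psi T j t = \<bar>sin (pi * real j / T * t)\<bar>"
proof -
  define a where "a = pi * real j / T"
  define k where "k = \<lfloor>t / (T / real j)\<rfloor>"
  have a: "0 < a" "a * (T / real j) = pi" using assms by (auto simp: a_def)
  have "sqrt (mu T j) = a" using assms by (simp add: mu_def a_def)
  then have psi: "psi T j t = sin (a * (t - (T / real j) * of_int k))" by (simp add: psi_def k_def)
  have Tj: "0 < T / real j" using assms by simp
  have r: "0 \<le> t - (T / real j) * of_int k" "t - (T / real j) * of_int k \<le> T / real j"
    using floor_divide_lower[OF Tj, of t] floor_divide_upper[OF Tj, of t] by (auto simp: k_def algebra_simps)
  have "a * (t - (T / real j) * of_int k) \<le> a * (T / real j)" using r a by (intro mult_left_mono) auto
  then have "0 \<le> sin (a * (t - (T / real j) * of_int k))"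
    using r a by (intro sin_ge_zero) auto
  then have "psi T j t = \<bar>sin (a * (t - (T / real j) * of_int k))\<bar>" by (simp add: psi)
  also have "a * (t - (T / real j) * of_int k) = a * t - (a * (T / real j)) * of_int k" by (simp add: right_diff_distrib mult.assoc)
  also have "\<bar>sin (a * t - (a * (T / real j)) * of_int k)\<bar> = \<bar>sin (a * t)\<bar>"
    unfolding a by (rule abs_sin_minus_pi_int)
  finally show ?thesis by (simp add: a_def)
qed

text \<open>Negation exchanges the two parts. In \<open>ereal\<close> the difference of two positive
  infinities is positive infinity, so a negative value already makes the first part finite.\<close>

lemma ereal_set_integral_uminus_pos:
  assumes "ereal_set_integral M A H < 0"
  shows "0 < ereal_set_integral M A (\<lambda>t. - H t)"
proof -
  let ?P = "enn2ereal (\<integral>\<^sup>+x\<in>A. e2ennreal (H x) \<partial>M)" and ?N = "enn2ereal (\<integral>\<^sup>+x\<in>A. e2ennreal (- H x) \<partial>M)"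
  have "?P - ?N < 0" using assms by (simp add: ereal_set_integral_def)
  then have "0 < ?N - ?P" by (cases ?P; cases ?N) auto
  then show ?thesis by (simp add: ereal_set_integral_def)
qed

text \<open>An antiderivative of a periodic function gains the same amount over every period,
  because its increment over \<open>T\<close> has derivative 0.\<close>

lemma angle_exists:
  fixes \<rho> :: "real \<Rightarrow> real"
  assumes T: "0 < T" and cont: "continuous_on UNIV \<rho>" and pos: "\<And>t. 0 < \<rho> t" and per: "\<And>t. \<rho> (t + T) = \<rho> t"
  obtains \<theta> where "\<And>t. (\<theta> has_real_derivative L / (\<rho> t)\<^sup>2) (at t)"
    "\<And>t. \<theta> (t + T) = \<theta> t + integral {0..T} (\<lambda>t. L / (\<rho> t)\<^sup>2)"
proof -
  let ?f = "\<lambda>t. L / (\<rho> t)\<^sup>2"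
  have cf: "continuous_on UNIV ?f"
    using cont pos by (intro continuous_intros) (auto simp: less_imp_neq[symmetric])
  then have "\<exists>F. \<forall>x :: real. - \<infinity> < ereal x \<longrightarrow> ereal x < \<infinity> \<longrightarrow> (F has_vector_derivative ?f x) (at x)"
    by (intro einterval_antiderivative) (auto simp: continuous_on_eq_continuous_at)
  then obtain \<theta> where \<theta>: "\<And>t. (\<theta> has_real_derivative ?f t) (at t)"
    by (auto simp: has_real_derivative_iff_has_vector_derivative)
  have "((\<lambda>t. \<theta> (t + T) - \<theta> t) has_real_derivative 0) (at t)" for t
  proof -
    have "((\<lambda>t. \<theta> (t + T)) has_real_derivative ?f (t + T)) (at t)"
      using \<theta>[of "t + T"] DERIV_shift by blast
    from DERIV_diff[OF this \<theta>[of t]] show ?thesis by (simp add: per)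
  qed
  then have const: "\<theta> (t + T) - \<theta> t = \<theta> (0 + T) - \<theta> 0" for t
    using DERIV_isconst_all[of "\<lambda>t. \<theta> (t + T) - \<theta> t" t 0] by blast
  have "(?f has_integral \<theta> T - \<theta> 0) {0..T}"
    using \<theta> T by (intro fundamental_theorem_of_calculus)
      (auto simp: has_real_derivative_iff_has_vector_derivative intro: has_vector_derivative_at_within)
  from integral_unique[OF this] have "\<theta> (t + T) = \<theta> t + integral {0..T} ?f" for t
    using const[of t] by simp
  then show ?thesis using that \<theta> by blast
qed

theorem theorem3p1:
  fixes T R0 \<eta> :: real and f :: "real \<Rightarrow> real \<Rightarrow> real" and N :: nat
  assumes "T > 0" and "R0 > 0"
    and f_cont: "continuous_on (UNIV \<times> {R0..}) (\<lambda>(t, x). f t x)"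
    and f_per: "\<And>t x. x \<ge> R0 \<Longrightarrow> f (t + T) x = f t x"
    and "N > 0"
    and f_bounds: "\<And>t x. t \<in> {0..T} \<Longrightarrow> x > R0 \<Longrightarrow>
          mu T N * x - \<eta> \<le> f t x \<and> f t x \<le> mu T (N + 1) * x + \<eta>"
    and LL_upper: "\<And>\<tau>. \<tau> \<in> {0..T} \<Longrightarrow>
          ereal_set_integral lborel {0..T}
            (\<lambda>t. Limsup at_top (\<lambda>x. ereal (f t (x + R0) - mu T (N + 1) * x))
                 * ereal (psi T (N + 1) (t + \<tau>))) < 0"
    and LL_lower: "\<And>\<tau>. \<tau> \<in> {0..T} \<Longrightarrow>
          ereal_set_integral lborel {0..T}
            (\<lambda>t. Liminf at_top (\<lambda>x. ereal (f t (x + R0) - mu T N * x))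
                 * ereal (psi T N (t + \<tau>))) > 0"
  shows "\<forall>\<nu>::nat. \<nu> > 0 \<longrightarrow> (\<exists>k\<^sub>\<nu>::nat. k\<^sub>\<nu> > 0 \<and> (\<forall>k\<ge>k\<^sub>\<nu>. \<exists>L \<rho> \<theta>.
           bouncing_system_solution R0 f L (-\<infinity>) \<infinity> \<rho> \<theta> \<and>
           (\<forall>t. \<rho> (t + T) = \<rho> t \<and> \<theta> (t + real k * T) = \<theta> t + 2 * pi * real \<nu>)))"
proof -
  note T = \<open>T > 0\<close> and R0 = \<open>R0 > 0\<close> and N = \<open>N > 0\<close>
  define F where "F t x = f t (x + R0)" for t x
  define g where "g l t x = f t (R0 + max x 0) - l\<^sup>2 / (R0 + max x 0) ^ 3" for l t x
  \<comment> \<open>Collects the constant \<open>\<eta>\<close>, the shift of the argument by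
    \<open>R0\<close>, and the centrifugal term, which is at most \<open>1 / R0 ^ 3\<close> for
    \<open>l\<close> in \<open>{0..1}\<close>.\<close>
  define K where "K = \<bar>\<eta>\<bar> + mu T (N + 1) * R0 + 1 / R0 ^ 3"
  define B where "B = mu T (N + 1) + K"
  have mu0: "0 \<le> mu T j" for j by (simp add: mu_def)
  have K0: "0 \<le> K" using mu0 R0 by (simp add: K_def)
  have B0: "0 \<le> B" using mu0 K0 by (simp add: B_def)
  have f_per_int: "f (t - T * of_int j) x = f t x" if x: "R0 \<le> x" for t x j
  proof -
    have n: "f (t + T * real k) x = f t x" for k t
    proof (induction k)
      case (Suc k)
      have "t + T * real (Suc k) = (t + T * real k) + T" by (simp add: algebra_simps)
      then show ?case using f_per[OF x, of "t + T * real k"] Suc by (simp only:)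
    qed simp
    show ?thesis
    proof (cases "0 \<le> j")
      case True
      then show ?thesis using n[of "t - T * of_int j" "nat j"] by simp
    next
      case False
      then show ?thesis using n[of t "nat (- j)"] by simp
    qed
  qed
  have bounds: "mu T N * x - \<eta> \<le> f t x \<and> f t x \<le> mu T (N + 1) * x + \<eta>" if x: "R0 \<le> x" for t x
  proof -
    have strict: "mu T N * x - \<eta> \<le> f t x \<and> f t x \<le> mu T (N + 1) * x + \<eta>" if "R0 < x" for x
    proof -
      have "t - T * of_int \<lfloor>t / T\<rfloor> \<in> {0..T}"
        using floor_divide_lower[OF T, of t] floor_divide_upper[OF T, of t] by (simp add: algebra_simps)
      from f_bounds[OF this that] show ?thesis using f_per_int[of x t] that by simp
    qed
    \<comment> \<open>The growth hypothesis speaks of arguments beyond \<open>R0\<close>; its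
      extension to the wall itself is a limit from the right.\<close>
    have "continuous_on {R0..} (\<lambda>x. (\<lambda>(t, x). f t x) (t, x))"
      by (rule continuous_on_compose2[OF f_cont]) (auto intro!: continuous_intros)
    then have "continuous_on {R0..} (f t)" by simp
    then have lim: "(f t \<longlongrightarrow> f t x) (at x within {R0..})" using x by (auto simp: continuous_on_def)
    then have lim: "(f t \<longlongrightarrow> f t x) (at_right x)"
      by (rule tendsto_within_subset) (use x in auto)
    have ev: "\<forall>\<^sub>F y in at_right x. R0 < y" using x by (auto simp: eventually_at_right_field intro!: exI[of _ "x + 1"])
    show ?thesis
    proof
      have "((\<lambda>y. mu T N * y - \<eta>) \<longlongrightarrow> mu T N * x - \<eta>) (at_right x)" by (intro tendsto_intros)
      then show "mu T N * x - \<eta> \<le> f t x"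
        by (rule tendsto_le[OF _ lim, rotated]) (use ev strict in \<open>auto elim: eventually_mono\<close>)
      have "((\<lambda>y. mu T (N + 1) * y + \<eta>) \<longlongrightarrow> mu T (N + 1) * x + \<eta>) (at_right x)" by (intro tendsto_intros)
      then show "f t x \<le> mu T (N + 1) * x + \<eta>"
        by (rule tendsto_le[OF _ _ lim, rotated]) (use ev strict in \<open>auto elim: eventually_mono\<close>)
    qed
  qed
  have mass: "0 \<le> l\<^sup>2 / (R0 + x) ^ 3" "l\<^sup>2 / (R0 + x) ^ 3 \<le> 1 / R0 ^ 3" if "0 \<le> x" "l \<in> {0..1}" for l x
  proof -
    show "0 \<le> l\<^sup>2 / (R0 + x) ^ 3" using that R0 by simp
    have "l\<^sup>2 \<le> 1" using that by (simp add: power_le_one)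
    moreover have "R0 ^ 3 \<le> (R0 + x) ^ 3" using that R0 by (intro power_mono) auto
    ultimately show "l\<^sup>2 / (R0 + x) ^ 3 \<le> 1 / R0 ^ 3" using R0 by (intro frac_le) auto
  qed
  have g_low: "mu T N * x - K \<le> g l t x" and g_up: "g l t x \<le> mu T (N + 1) * x + K"
    if "0 \<le> x" "l \<in> {0..1}" for l t x
  proof -
    have "0 \<le> mu T N * R0" "0 \<le> mu T (N + 1) * R0" "0 \<le> 1 / R0 ^ 3" using mu0 R0 by auto
    moreover have "g l t x = f t (R0 + x) - l\<^sup>2 / (R0 + x) ^ 3" using that by (simp add: g_def max_def)
    moreover have "mu T N * (R0 + x) - \<eta> \<le> f t (R0 + x)" "f t (R0 + x) \<le> mu T (N + 1) * (R0 + x) + \<eta>"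
      using bounds[of "R0 + x" t] that by auto
    ultimately show "mu T N * x - K \<le> g l t x" "g l t x \<le> mu T (N + 1) * x + K"
      using mass[OF that] unfolding K_def distrib_left by linarith+
  qed
  interpret impact T B g
  proof
    show "0 < T" "0 \<le> B" by fact+
    have "continuous_on UNIV (\<lambda>z :: real \<times> real \<times> real. (\<lambda>(t, x). f t x) (fst (snd z), R0 + max (snd (snd z)) 0))"
      by (rule continuous_on_compose2[OF f_cont]) (auto intro!: continuous_intros)
    moreover have "continuous_on UNIV (\<lambda>z :: real \<times> real \<times> real. (fst z)\<^sup>2 / (R0 + max (snd (snd z)) 0) ^ 3)"
      using R0 by (intro continuous_intros) (auto simp: add_pos_nonneg less_imp_neq[symmetric])
    ultimately show "continuous_on UNIV (\<lambda>(l, t, x). g l t x)"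
      unfolding g_def split_beta by (simp add: continuous_on_diff)
    show gp: "g l t x = g l t (max x 0)" for l t x by (simp add: g_def)
    show "\<bar>g l t x\<bar> \<le> B * (1 + max x 0)" if l: "l \<in> {0..1}" for l t x
    proof -
      have m: "0 \<le> max x 0" by simp
      have "- (B * (1 + max x 0)) \<le> mu T N * max x 0 - K" "mu T (N + 1) * max x 0 + K \<le> B * (1 + max x 0)"
        using mu0[of N] mu0[of "N + 1"] K0 mult_nonneg_nonneg[OF mu0[of N] m] mult_nonneg_nonneg[OF mu0[of "N + 1"] m]
          mult_nonneg_nonneg[OF K0 m] unfolding B_def distrib_left distrib_right mult_1_right by linarith+
      then show ?thesis using g_low[OF m l, of t] g_up[OF m l, of t] gp[of l t x] by (auto simp: abs_le_iff)
    qed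
  qed
  \<comment> \<open>The frequencies whose phase makes exactly \<open>N\<close> and
    \<open>N + 1\<close> half turns in time \<open>T\<close>.\<close>
  define \<omega>1 where "\<omega>1 = pi * real N / T"
  define \<omega>2 where "\<omega>2 = pi * real (N + 1) / T"
  have \<omega>: "0 < \<omega>1" "0 < \<omega>2" "\<omega>1 \<le> \<omega>2" using N T by (auto simp: \<omega>1_def \<omega>2_def divide_right_mono)
  have \<omega>sq: "\<omega>1\<^sup>2 = mu T N" "\<omega>2\<^sup>2 = mu T (N + 1)" by (auto simp: \<omega>1_def \<omega>2_def mu_def)
  have \<omega>T: "\<omega>1 * T = pi * real N" "\<omega>2 * T = pi * (real N + 1)" using T by (auto simp: \<omega>1_def \<omega>2_def)
  \<comment> \<open>The centrifugal term vanishes at infinity uniformly in \<open>l\<close>, so the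
    conditions on \<open>f\<close> alone decide about \<open>g\<close>.\<close>
  have lim: "\<forall>\<^sub>F x in at_top. \<forall>l\<in>{0..1}. \<bar>g l t x - F t x\<bar> \<le> e" if e: "0 < e" for t e
    using eventually_ge_at_top[of "max 1 (1 / e)"]
  proof eventually_elim
    case (elim x)
    then have x: "1 \<le> x" "1 / e \<le> x" by auto
    show ?case
    proof
      fix l :: real assume l: "l \<in> {0..1}"
      have "l\<^sup>2 \<le> 1" using l by (simp add: power_le_one)
      moreover have "x \<le> (R0 + x) ^ 3"
      proof -
        have "x ^ 1 \<le> x ^ 3" using x by (intro power_increasing) auto
        also have "\<dots> \<le> (R0 + x) ^ 3" using x R0 by (intro power_mono) auto
        finally show ?thesis by simp
      qed
      ultimately have "l\<^sup>2 / (R0 + x) ^ 3 \<le> 1 / x" using x by (intro frac_le) auto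
      also have "\<dots> \<le> e" using x e by (simp add: field_simps)
      finally have "l\<^sup>2 / (R0 + x) ^ 3 \<le> e" .
      moreover have "0 \<le> l\<^sup>2 / (R0 + x) ^ 3" using x R0 by simp
      ultimately show "\<bar>g l t x - F t x\<bar> \<le> e" using x by (simp add: g_def F_def max_def add.commute)
    qed
  qed
  \<comment> \<open>A phase shift \<open>\<phi>\<close> is the time shift of \<open>\<phi>\<close>
    divided by the frequency. It is at most \<open>T\<close> because the phase advances by at least
    \<pi> in time \<open>T\<close>.\<close>
  have phase: "\<phi> / (pi * real j / T) \<in> {0..T}" "\<bar>sin (\<phi> + pi * real j / T * t)\<bar> = psi T j (t + \<phi> / (pi * real j / T))"
    if "\<phi> \<in> {0..pi}" "0 < j" for \<phi> j t
  proof -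
    have "\<phi> * 1 \<le> pi * real j" using that by (intro mult_mono) auto
    then show "\<phi> / (pi * real j / T) \<in> {0..T}" using that T by (auto simp: field_simps)
    show "\<bar>sin (\<phi> + pi * real j / T * t)\<bar> = psi T j (t + \<phi> / (pi * real j / T))"
      unfolding psi_eq_abs_sin[OF T that(2)] using that T by (simp add: distrib_left add.commute)
  qed
  obtain r1 where r1: "1 \<le> r1" "\<And>n l x v h \<rho>. penalized n l x v \<Longrightarrow> l \<in> {0..1} \<Longrightarrow> r1 \<le> \<rho> \<Longrightarrow>
      energy \<omega>1 n (x 0) (v 0) = \<rho>\<^sup>2 \<Longrightarrow> \<rho> ^ 4 \<le> n \<Longrightarrow>
      continuous_on {0..T} h \<Longrightarrow> (\<And>t. t \<in> {0..T} \<Longrightarrow> exp (h t) = phase_point \<omega>1 n (x t) (v t)) \<Longrightarrow>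
      0 < 1 * (Im (h T) / 2 - Im (h 0) / 2 - \<omega>1 * T)"
  proof (rule winding_estimate[of \<omega>1 1 K F])
    show "- K \<le> 1 * (g l t x - \<omega>1\<^sup>2 * x)" if "l \<in> {0..1}" "0 \<le> x" for l t x
      using g_low[OF that(2,1), of t] by (simp add: \<omega>sq)
    show "0 < ereal_set_integral lborel {0..T}
        (\<lambda>t. Liminf at_top (\<lambda>x. ereal (1 * (F t x - \<omega>1\<^sup>2 * x))) * ereal \<bar>sin (\<phi> + \<omega>1 * t)\<bar>)" if "\<phi> \<in> {0..pi}" for \<phi>
      using LL_lower[OF phase(1)[OF that N]] phase(2)[OF that N] by (simp add: F_def \<omega>sq \<omega>1_def[symmetric])
  qed (use \<omega> K0 lim in auto)
  obtain r2 where r2: "1 \<le> r2" "\<And>n l x v h \<rho>. penalized n l x v \<Longrightarrow> l \<in> {0..1} \<Longrightarrow> r2 \<le> \<rho> \<Longrightarrow>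
      energy \<omega>2 n (x 0) (v 0) = \<rho>\<^sup>2 \<Longrightarrow> \<rho> ^ 4 \<le> n \<Longrightarrow>
      continuous_on {0..T} h \<Longrightarrow> (\<And>t. t \<in> {0..T} \<Longrightarrow> exp (h t) = phase_point \<omega>2 n (x t) (v t)) \<Longrightarrow>
      0 < - 1 * (Im (h T) / 2 - Im (h 0) / 2 - \<omega>2 * T)"
  proof (rule winding_estimate[of \<omega>2 "- 1" K F])
    show "- K \<le> - 1 * (g l t x - \<omega>2\<^sup>2 * x)" if "l \<in> {0..1}" "0 \<le> x" for l t x
      using g_up[OF that(2,1), of t] by (simp add: \<omega>sq)
    show "0 < ereal_set_integral lborel {0..T}
        (\<lambda>t. Liminf at_top (\<lambda>x. ereal (- 1 * (F t x - \<omega>2\<^sup>2 * x))) * ereal \<bar>sin (\<phi> + \<omega>2 * t)\<bar>)" if "\<phi> \<in> {0..pi}" for \<phi>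
    proof -
      have N1: "0 < N + 1" by simp
      \<comment> \<open>The upper condition enters with the opposite sign: the lower limit of the
        negated deviation is minus the upper limit.\<close>
      have "Liminf at_top (\<lambda>x. ereal (- 1 * (F t x - \<omega>2\<^sup>2 * x)))
          = - Limsup at_top (\<lambda>x. ereal (f t (x + R0) - mu T (N + 1) * x))" for t
        using ereal_Liminf_uminus[of at_top "\<lambda>x. ereal (f t (x + R0) - mu T (N + 1) * x)"]
        by (simp add: F_def \<omega>sq)
      then have "(\<lambda>t. Liminf at_top (\<lambda>x. ereal (- 1 * (F t x - \<omega>2\<^sup>2 * x))) * ereal \<bar>sin (\<phi> + \<omega>2 * t)\<bar>)
        = (\<lambda>t. - (Limsup at_top (\<lambda>x. ereal (f t (x + R0) - mu T (N + 1) * x)) * ereal (psi T (N + 1) (t + \<phi> / \<omega>2))))"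
        using phase(2)[OF that N1] unfolding \<omega>2_def by (simp only: ereal_mult_minus_left)
      then show ?thesis
        using ereal_set_integral_uminus_pos[OF LL_upper[OF phase(1)[OF that N1]]] by (simp only: \<omega>2_def)
    qed
  qed (use \<omega> K0 lim in auto)
  obtain R n0 where R: "1 \<le> R" "1 \<le> n0" "\<And>n l x v c. n0 \<le> n \<Longrightarrow> penalized n l x v \<Longrightarrow> l \<in> {0..1} \<Longrightarrow>
      energy \<omega>1 n (x 0) (v 0) = R\<^sup>2 \<Longrightarrow> x T = c * x 0 \<Longrightarrow> v T = c * v 0 \<Longrightarrow> 0 < c \<Longrightarrow> False"
  proof (rule no_aligned[OF \<omega>(1,3) \<omega>T, of r1 r2])
    show "\<omega>1 * T < Im (h T) / 2 - Im (h 0) / 2"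
      if "penalized n l x v" "l \<in> {0..1}" "r1 \<le> \<rho>" "energy \<omega>1 n (x 0) (v 0) = \<rho>\<^sup>2" "\<rho> ^ 4 \<le> n"
        "continuous_on {0..T} h" "\<And>t. t \<in> {0..T} \<Longrightarrow> exp (h t) = phase_point \<omega>1 n (x t) (v t)" for n l x v h \<rho>
      using r1(2)[OF that] by simp
    show "Im (h T) / 2 - Im (h 0) / 2 < \<omega>2 * T"
      if "penalized n l x v" "l \<in> {0..1}" "r2 \<le> \<rho>" "energy \<omega>2 n (x 0) (v 0) = \<rho>\<^sup>2" "\<rho> ^ 4 \<le> n"
        "continuous_on {0..T} h" "\<And>t. t \<in> {0..T} \<Longrightarrow> exp (h t) = phase_point \<omega>2 n (x t) (v t)" for n l x v h \<rho>
      using r2(2)[OF that] by simp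
  qed blast
  define M where "M = sqrt (exp (rate \<omega>1 * T) * (1 + R\<^sup>2)) * (1 + 1 / \<omega>1)"
  have M0: "0 \<le> M" using \<omega> by (simp add: M_def)
  define Q where "Q x = 1 / (R0 + max x 0)\<^sup>2" for x
  have Rm: "0 < R0 + max x 0" for x using R0 by simp
  have Q: "continuous_on UNIV Q"
    unfolding Q_def[abs_def] using Rm by (intro continuous_intros) (auto simp: less_imp_neq[symmetric])
  have Qb: "\<bar>Q x\<bar> \<le> 1 / R0\<^sup>2" for x
    unfolding Q_def using R0 by (auto intro!: divide_left_mono power_mono)
  have g_per: "g l (t + T) x = g l t x" for l t x
    using f_per[of "R0 + max x 0" t] by (simp add: g_def)
  show ?thesis
  proof (intro allI impI)
    fix \<nu> :: nat assume \<nu>: "0 < \<nu>"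
    \<comment> \<open>A lower bound for the integral of \<open>Q\<close> along any orbit below
      \<open>M\<close>. The threshold \<open>k0\<close> is taken so large that \<open>c\<close>, the
      angle gained per period \<open>T\<close>, is at most \<open>S\<close>.\<close>
    define S where "S = T / (R0 + M)\<^sup>2"
    have S: "0 < S" using T R0 M0 by (simp add: S_def)
    obtain k0 :: nat where k0: "2 * pi * real \<nu> / S < real k0" using reals_Archimedean2 by blast
    have "0 < 2 * pi * real \<nu> / S" using \<nu> S by simp
    then have k0pos: "0 < k0" using k0 by (cases k0) auto
    show "\<exists>k\<^sub>\<nu>::nat. k\<^sub>\<nu> > 0 \<and> (\<forall>k\<ge>k\<^sub>\<nu>. \<exists>L \<rho> \<theta>.
           bouncing_system_solution R0 f L (-\<infinity>) \<infinity> \<rho> \<theta> \<and>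
           (\<forall>t. \<rho> (t + T) = \<rho> t \<and> \<theta> (t + real k * T) = \<theta> t + 2 * pi * real \<nu>))"
    proof (intro exI[of _ k0] conjI allI impI k0pos)
      fix k assume k: "k0 \<le> k"
      define c where "c = 2 * pi * real \<nu> / real k"
      have kpos: "0 < real k" using k k0pos by simp
      have c: "0 < c" using \<nu> kpos by (simp add: c_def)
      have cS: "c \<le> S"
      proof -
        have "2 * pi * real \<nu> / S < real k" using k0 k by (meson less_le_trans of_nat_mono)
        then show ?thesis using S kpos by (simp add: c_def field_simps)
      qed
      have sol: "\<exists>l x v. l \<in> {0..1} \<and> penalized n l x v \<and> x T = x 0 \<and> v T = v 0 \<and>
          energy \<omega>1 n (x 0) (v 0) \<le> R\<^sup>2 \<and> l = 1 / max 1 ((integral {0..T} (\<lambda>t. Q (x t))) / c)" if n: "n0 \<le> n" for n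
      proof -
        have n1: "0 < n" "0 < R" using n R by auto
        show ?thesis
          by (rule penalized_periodic_exists[OF n1(1) \<omega>(1) n1(2) c Q Qb]) (use R(3)[OF n] in blast)+
      qed
      obtain l x where x: "l \<in> {0..1}" "\<And>t. 0 \<le> x t" "\<And>t. x t \<le> M" "\<And>t. x (t + T) = x t" "continuous_on UNIV x"
        "l = 1 / max 1 ((integral {0..T} (\<lambda>t. Q (x t))) / c)"
        "\<And>w p. (\<And>t r. w \<le> r \<Longrightarrow> p t r = g l t (r - w)) \<Longrightarrow> bouncing_solution w p (- \<infinity>) \<infinity> (\<lambda>t. w + x t)"
        using bouncing_periodic_exists[OF g_per \<omega>(1) R(2) c Q sol] unfolding M_def by blast
      define \<rho> where "\<rho> t = R0 + x t" for t
      have \<rho>: "\<rho> t = R0 + max (x t) 0" "0 < \<rho> t" for t using x(2)[of t] R0 by (auto simp: \<rho>_def)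
      have \<rho>c: "continuous_on UNIV \<rho>" unfolding \<rho>_def[abs_def] by (intro continuous_intros x)
      let ?I = "integral {0..T} (\<lambda>t. Q (x t))"
      have "S \<le> ?I"
      proof -
        have "integral {0..T} (\<lambda>t. 1 / (R0 + M)\<^sup>2) \<le> ?I"
        proof (rule integral_le)
          have "continuous_on {0..T} (\<lambda>t. Q (x t))"
            by (rule continuous_on_compose2[OF Q continuous_on_subset[OF x(5)]]) auto
          then show "(\<lambda>t. Q (x t)) integrable_on {0..T}" by (rule integrable_continuous_interval)
          fix t
          show "1 / (R0 + M)\<^sup>2 \<le> Q (x t)"
            unfolding Q_def using x(2,3)[of t] R0 M0 by (intro divide_left_mono power_mono mult_pos_pos) auto
        qed auto
        then show ?thesis using T by (simp add: S_def)
      qed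
      \<comment> \<open>The clipping is inactive, so \<open>l\<close> is exactly \<open>c\<close>
        divided by the integral, and the angle advances by \<open>c\<close> in each period.\<close>
      then have "1 \<le> ?I / c" using cS c by simp
      then have lI: "l * ?I = c" using x(6) c by (simp add: max_def)
      obtain \<theta> where \<theta>: "\<And>t. (\<theta> has_real_derivative l / (\<rho> t)\<^sup>2) (at t)"
          "\<And>t. \<theta> (t + T) = \<theta> t + integral {0..T} (\<lambda>t. l / (\<rho> t)\<^sup>2)"
        using angle_exists[OF T \<rho>c \<rho>(2), of l] x(4) by (auto simp: \<rho>_def)
      have "(\<lambda>t. l / (\<rho> t)\<^sup>2) = (\<lambda>t. l * Q (x t))" by (simp add: \<rho>(1) Q_def)
      then have \<theta>T: "\<theta> (t + T) = \<theta> t + c" for t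
        using \<theta>(2)[of t] lI integral_mult_right[of "{0..T}" l "\<lambda>t. Q (x t)"] by simp
      have \<theta>k: "\<theta> (t + real m * T) = \<theta> t + real m * c" for m t
      proof (induction m)
        case (Suc m)
        have "t + real (Suc m) * T = (t + real m * T) + T" by (simp add: algebra_simps)
        then show ?case using \<theta>T[of "t + real m * T"] Suc by (simp add: algebra_simps)
      qed simp
      have "bouncing_solution R0 (\<lambda>t r. - l\<^sup>2 / r ^ 3 + f t r) (- \<infinity>) \<infinity> (\<lambda>t. R0 + x t)"
        by (rule x(7)) (simp add: g_def)
      then have "bouncing_system_solution R0 f l (-\<infinity>) \<infinity> \<rho> \<theta>"
        unfolding bouncing_system_solution_def \<rho>_def[abs_def, symmetric]
        using DERIV_imp_deriv[OF \<theta>(1)] \<theta>(1) \<rho>(2) by (auto simp: real_differentiable_def less_imp_neq[symmetric])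
      moreover have "\<theta> (t + real k * T) = \<theta> t + 2 * pi * real \<nu>" for t
        using \<theta>k[of t k] kpos by (simp add: c_def)
      moreover have "\<rho> (t + T) = \<rho> t" for t by (simp add: \<rho>_def x(4))
      ultimately show "\<exists>L \<rho> \<theta>. bouncing_system_solution R0 f L (-\<infinity>) \<infinity> \<rho> \<theta> \<and>
           (\<forall>t. \<rho> (t + T) = \<rho> t \<and> \<theta> (t + real k * T) = \<theta> t + 2 * pi * real \<nu>)" by blast
    qed
  qed
qed

end
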